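(* Let $\mathbb D$ be a conservative and complete prederivator satisfying the cohomological criterion for colocal equivalences (for example, a derivator). Then a square of $\mathrm{Cat}$ satisfies the cohomological base change property for $\mathbb D$ if and only if it is weakly $\mathbb D$-exact.
   Context: $\mathrm{Cat}$ is the 2-category of small categories, $\mathrm{CAT}$ that of (not necessarily small) categories, $e$ the terminal category. For a functor $u:A\to B$ and $b\in\mathrm{Ob}\,B$: $A/b$ is the category of pairs $(a,g:u(a)\to b)$ and $b\backslash A$ that of pairs $(a,g:b\to u(a))$, with the evident morphisms. Objects $b$ of $B$ are identified with functors $b:e\to B$. A square consists of functors $v:A'\to A$ (top), $w:B'\to B$ (bottom), $u':A'\to B'$ (left), $u:A\to B$ (right) between small categories and a natural transformation $\alpha:uv\to wu'$. A prederivator is a strict 2-functor $\mathbb D$ from $\mathrm{Cat}$ to $\mathrm{CAT}$, contravariant on 1-arrows and on 2-arrows; one writes $u^*=\mathbb D(u):\mathbb D(B)\to\mathbb D(A)$ for $u:A\to B$, and $\alpha^*=\mathbb D(\alpha):v^*\to u^*$ for $\alpha:u\to v$. - Conservative (Der 2): for every small $A$, an arrow $\varphi$ of $\mathbb D(A)$ is an isomorphism as soon as $a^*(\varphi)$ is an isomorphism of $\mathbb D(e)$ for every object $a$ of $A$. - Admits cohomological (resp. homological) direct images (Der 3g, resp. Der 3d): every $u^*$ has a right adjoint $u_*$ (resp. a left adjoint $u_!$). - A square satisfies the cohomological base change property for $\mathbb D$ if $u^*,u'^*$ have right adjoints $u_*,u'_*$ and the base change morphism $w^*u_*\to u'_*v^*$,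 the composite $w^*u_*\to u'_*u'^*w^*u_*\to u'_*v^*u^*u_*\to u'_*v^*$ (unit, $\alpha^*:u'^*w^*\to v^*u^*$, counit), is an isomorphism. The homological base change property is: $v^*,w^*$ have left adjoints and the analogous morphism $v_!u'^*\to u^*w_!$ is an isomorphism. - Complete: Der 3g holds and (Der 4g) for every $u:A\to B$ and $b\in\mathrm{Ob}\,B$, the comma square with top the forgetful functor $A/b\to A$, left $A/b\to e$, bottom $b:e\to B$, right $u$ and 2-cell with component $g$ at $(a,g)$ satisfies the cohomological base change property. Cocomplete is dual: Der 3d and (Der 4d) the comma square with top $b\backslash A\to e$, left $b\backslash A\to A$, bottom $u$, right $b$ satisfies the homological base change property. - A derivator is a conservative, complete and cocomplete prederivator such that (Der 1) $\mathbb D(\coprod_i A_i)\to\prod_i\mathbb D(A_i)$ is an equivalence for every finite family of small categories. A functor $u:A\to B$ between small categories, with $p:A\to e$, $q:B\to e$, is a $\mathbb D$-equivalence if for all objects $X,Y$ of $\mathbb D(e)$ the map $\mathrm{Hom}_{\mathbb D(B)}(q^*X,q^*Y)\to\mathrm{Hom}_{\mathbb D(A)}(p^*X,p^*Y)$ induced by $u^*$ is bijective. Given a commutative triangle $v=wu$ with $u:A\to B$, $w:B\to C$, $v:A\to C$, the functor $u$ is a $\mathbb D$-equivalence colocally over $C$ if for every object $c$ of $C$ the functor $c\backslash A\to c\backslash B$ induced by $u$ is a $\mathbb D$-equivalence. A prederivator $\mathbb D$ admitting cohomological direct images satisfies the cohomological criterion for colocal equivalences if for every such triangle with $u$ a $\mathbb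 D$-equivalence colocally over $C$, the canonical morphism $q_*w^*\to p_*v^*$ (with $p:A\to e$, $q:B\to e$), i.e. the composite $q_*w^*\to q_*u_*u^*w^*\simeq p_*v^*$, is an isomorphism. A square with top $v:A'\to A$, bottom $w:B'\to B$, left $u':A'\to B'$, right $u:A\to B$ and 2-cell $\alpha:uv\to wu'$ is weakly $\mathbb D$-exact if for every object $b'$ of $B'$, the functor $A'/b'\to A/w(b')$, $(a',g':u'(a')\to b')\mapsto(v(a'),w(g')\alpha_{a'}:uv(a')\to w(b'))$, is a $\mathbb D$-equivalence colocally over $A$ (where $A/w(b')\to A$ is the forgetful functor and $A'/b'\to A$ is the composite, i.e. $(a',g')\mapsto v(a')$). *)

theory Defs
  imports Main "HOL-Library.FuncSet"
begin

section \<open>Universes\<close>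

text \<open>
  A type of class \<open>universe\<close> plays the role of a Grothendieck universe: a set of elements of the
  type is small if it is the set of members of some element. The axiom of infinity and
  well-foundedness of membership are not imposed, so every Grothendieck universe is covered.
\<close>

class universe =
  fixes elts :: "'a \<Rightarrow> 'a set"
  assumes universe_ext: "elts x = elts y \<Longrightarrow> x = y"
    and universe_subset: "X \<subseteq> elts x \<Longrightarrow> \<exists>y. elts y = X"
    and universe_pairing: "\<exists>z. elts z = {x, y}"
    and universe_power: "\<exists>y. elts y = {z. elts z \<subseteq> elts x}"
    and universe_union: "\<exists>y. elts y = (\<Union>i\<in>elts x. elts (f i))"

definition small_set :: "'v::universe set \<Rightarrow> bool" where
  "small_set X \<longleftrightarrow> (\<exists>x. elts x = X)"

definition vset :: "'v::universe set \<Rightarrow> 'v" where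
  "vset X = (THE x. elts x = X)"

text \<open>Kuratowski pairs, which are used to build categories inside the universe.\<close>

definition vpair :: "'v::universe \<Rightarrow> 'v \<Rightarrow> 'v" where
  "vpair x y = vset {vset {x}, vset {x, y}}"

definition vfst :: "'v::universe \<Rightarrow> 'v" where
  "vfst p = (THE x. \<exists>y. p = vpair x y)"

definition vsnd :: "'v::universe \<Rightarrow> 'v" where
  "vsnd p = (THE y. \<exists>x. p = vpair x y)"

section \<open>Categories, functors, natural transformations\<close>

text \<open>
  The structure maps of categories, functors and natural transformations are required to be
  \<open>undefined\<close> off their domains. Hence two of them that agree as mathematical objects are equal as
  records, and the equations of a strict 2-functor can be stated with HOL equality.
\<close>

record ('o, 'a) cat =
  Obj :: "'o set"
  Arr :: "'a set"
  Dom :: "'a \<Rightarrow> 'o"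
  Cod :: "'a \<Rightarrow> 'o"
  Id :: "'o \<Rightarrow> 'a"
  Comp :: "'a \<Rightarrow> 'a \<Rightarrow> 'a"

abbreviation comp_in :: "'a \<Rightarrow> ('o, 'a) cat \<Rightarrow> 'a \<Rightarrow> 'a"  ("_ \<cdot>\<^bsub>_\<^esub> _" [66, 0, 65] 65) where
  "g \<cdot>\<^bsub>C\<^esub> f \<equiv> Comp C g f"

definition hom :: "('o, 'a) cat \<Rightarrow> 'o \<Rightarrow> 'o \<Rightarrow> 'a set" where
  "hom C x y = {f \<in> Arr C. Dom C f = x \<and> Cod C f = y}"

definition category :: "('o, 'a) cat \<Rightarrow> bool" where
  "category C \<longleftrightarrow>
     Dom C \<in> Arr C \<rightarrow>\<^sub>E Obj C \<and>
     Cod C \<in> Arr C \<rightarrow>\<^sub>E Obj C \<and>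
     Id C \<in> extensional (Obj C) \<and>
     (\<forall>x\<in>Obj C. Id C x \<in> hom C x x) \<and>
     (\<forall>f\<in>Arr C. \<forall>g\<in>Arr C. Cod C f = Dom C g \<longrightarrow> g \<cdot>\<^bsub>C\<^esub> f \<in> hom C (Dom C f) (Cod C g)) \<and>
     (\<forall>f g. \<not> (f \<in> Arr C \<and> g \<in> Arr C \<and> Cod C f = Dom C g) \<longrightarrow> g \<cdot>\<^bsub>C\<^esub> f = undefined) \<and>
     (\<forall>f\<in>Arr C. f \<cdot>\<^bsub>C\<^esub> Id C (Dom C f) = f \<and> Id C (Cod C f) \<cdot>\<^bsub>C\<^esub> f = f) \<and>
     (\<forall>f\<in>Arr C. \<forall>g\<in>Arr C. \<forall>h\<in>Arr C. Cod C f = Dom C g \<and> Cod C g = Dom C h \<longrightarrow>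
        h \<cdot>\<^bsub>C\<^esub> (g \<cdot>\<^bsub>C\<^esub> f) = (h \<cdot>\<^bsub>C\<^esub> g) \<cdot>\<^bsub>C\<^esub> f)"

definition is_iso :: "('o, 'a) cat \<Rightarrow> 'a \<Rightarrow> bool" where
  "is_iso C f \<longleftrightarrow> f \<in> Arr C \<and>
     (\<exists>g \<in> hom C (Cod C f) (Dom C f). g \<cdot>\<^bsub>C\<^esub> f = Id C (Dom C f) \<and> f \<cdot>\<^bsub>C\<^esub> g = Id C (Cod C f))"

record ('o, 'a, 'p, 'b) fctr =
  Src :: "('o, 'a) cat"
  Trg :: "('p, 'b) cat"
  fob :: "'o \<Rightarrow> 'p"
  far :: "'a \<Rightarrow> 'b"

definition is_functor :: "('o, 'a) cat \<Rightarrow> ('p, 'b) cat \<Rightarrow> ('o, 'a, 'p, 'b) fctr \<Rightarrow> bool" where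
  "is_functor C D F \<longleftrightarrow>
     category C \<and> category D \<and> Src F = C \<and> Trg F = D \<and>
     fob F \<in> Obj C \<rightarrow>\<^sub>E Obj D \<and>
     far F \<in> extensional (Arr C) \<and>
     (\<forall>f\<in>Arr C. far F f \<in> hom D (fob F (Dom C f)) (fob F (Cod C f))) \<and>
     (\<forall>x\<in>Obj C. far F (Id C x) = Id D (fob F x)) \<and>
     (\<forall>f\<in>Arr C. \<forall>g\<in>Arr C. Cod C f = Dom C g \<longrightarrow> far F (g \<cdot>\<^bsub>C\<^esub> f) = far F g \<cdot>\<^bsub>D\<^esub> far F f)"

definition idF :: "('o, 'a) cat \<Rightarrow> ('o, 'a, 'o, 'a) fctr" where
  "idF C = \<lparr>Src = C, Trg = C, fob = (\<lambda>x\<in>Obj C. x), far = (\<lambda>f\<in>Arr C. f)\<rparr>"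

definition compF :: "('p, 'b, 'q, 'c) fctr \<Rightarrow> ('o, 'a, 'p, 'b) fctr \<Rightarrow> ('o, 'a, 'q, 'c) fctr"
    (infixr "\<odot>" 70) where
  "G \<odot> F = \<lparr>Src = Src F, Trg = Trg G,
            fob = compose (Obj (Src F)) (fob G) (fob F),
            far = compose (Arr (Src F)) (far G) (far F)\<rparr>"

record ('o, 'a, 'p, 'b) ntrans =
  NSrc :: "('o, 'a, 'p, 'b) fctr"
  NTrg :: "('o, 'a, 'p, 'b) fctr"
  cmp :: "'o \<Rightarrow> 'b"

definition is_nat ::
    "('o, 'a, 'p, 'b) fctr \<Rightarrow> ('o, 'a, 'p, 'b) fctr \<Rightarrow> ('o, 'a, 'p, 'b) ntrans \<Rightarrow> bool" where
  "is_nat F G \<alpha> \<longleftrightarrow> (\<exists>C D.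
     is_functor C D F \<and> is_functor C D G \<and> NSrc \<alpha> = F \<and> NTrg \<alpha> = G \<and>
     cmp \<alpha> \<in> extensional (Obj C) \<and>
     (\<forall>x\<in>Obj C. cmp \<alpha> x \<in> hom D (fob F x) (fob G x)) \<and>
     (\<forall>f\<in>Arr C. cmp \<alpha> (Cod C f) \<cdot>\<^bsub>D\<^esub> far F f = far G f \<cdot>\<^bsub>D\<^esub> cmp \<alpha> (Dom C f)))"

definition nat_iso :: "('o, 'a, 'p, 'b) ntrans \<Rightarrow> bool" where
  "nat_iso \<alpha> \<longleftrightarrow> (\<forall>x\<in>Obj (Src (NSrc \<alpha>)). is_iso (Trg (NSrc \<alpha>)) (cmp \<alpha> x))"

definition idN :: "('o, 'a, 'p, 'b) fctr \<Rightarrow> ('o, 'a, 'p, 'b) ntrans" where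
  "idN F = \<lparr>NSrc = F, NTrg = F, cmp = (\<lambda>x\<in>Obj (Src F). Id (Trg F) (fob F x))\<rparr>"

definition vcomp ::
    "('o, 'a, 'p, 'b) ntrans \<Rightarrow> ('o, 'a, 'p, 'b) ntrans \<Rightarrow> ('o, 'a, 'p, 'b) ntrans" where
  "vcomp \<beta> \<alpha> = \<lparr>NSrc = NSrc \<alpha>, NTrg = NTrg \<beta>,
     cmp = (\<lambda>x\<in>Obj (Src (NSrc \<alpha>)). cmp \<beta> x \<cdot>\<^bsub>Trg (NSrc \<alpha>)\<^esub> cmp \<alpha> x)\<rparr>"

definition hcomp ::
    "('p, 'b, 'q, 'c) ntrans \<Rightarrow> ('o, 'a, 'p, 'b) ntrans \<Rightarrow> ('o, 'a, 'q, 'c) ntrans" where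
  "hcomp \<beta> \<alpha> = \<lparr>NSrc = NSrc \<beta> \<odot> NSrc \<alpha>, NTrg = NTrg \<beta> \<odot> NTrg \<alpha>,
     cmp = (\<lambda>x\<in>Obj (Src (NSrc \<alpha>)).
       cmp \<beta> (fob (NTrg \<alpha>) x) \<cdot>\<^bsub>Trg (NSrc \<beta>)\<^esub> far (NSrc \<beta>) (cmp \<alpha> x))\<rparr>"

definition adjunction ::
    "('o, 'a, 'p, 'b) fctr \<Rightarrow> ('p, 'b, 'o, 'a) fctr \<Rightarrow>
     ('o, 'a, 'o, 'a) ntrans \<Rightarrow> ('p, 'b, 'p, 'b) ntrans \<Rightarrow> bool" where
  "adjunction L R \<eta> \<epsilon> \<longleftrightarrow> (\<exists>C D.
     is_functor C D L \<and> is_functor D C R \<and>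
     is_nat (idF C) (R \<odot> L) \<eta> \<and> is_nat (L \<odot> R) (idF D) \<epsilon> \<and>
     (\<forall>x\<in>Obj C. cmp \<epsilon> (fob L x) \<cdot>\<^bsub>D\<^esub> far L (cmp \<eta> x) = Id D (fob L x)) \<and>
     (\<forall>y\<in>Obj D. far R (cmp \<epsilon> y) \<cdot>\<^bsub>C\<^esub> cmp \<eta> (fob R y) = Id C (fob R y)))"

definition is_equivalence :: "('o, 'a, 'p, 'b) fctr \<Rightarrow> bool" where
  "is_equivalence F \<longleftrightarrow> (\<exists>C D G \<eta> \<epsilon>.
     is_functor C D F \<and> is_functor D C G \<and>
     is_nat (idF C) (G \<odot> F) \<eta> \<and> nat_iso \<eta> \<and> is_nat (F \<odot> G) (idF D) \<epsilon> \<and> nat_iso \<epsilon>)"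

section \<open>Small categories\<close>

type_synonym 'v scat = "('v, 'v) cat"
type_synonym 'v sfun = "('v, 'v, 'v, 'v) fctr"
type_synonym 'v snat = "('v, 'v, 'v, 'v) ntrans"

definition small_cat :: "'v::universe scat \<Rightarrow> bool" where
  "small_cat A \<longleftrightarrow> category A \<and> small_set (Obj A) \<and> small_set (Arr A)"

definition small_functor :: "'v::universe scat \<Rightarrow> 'v scat \<Rightarrow> 'v sfun \<Rightarrow> bool" where
  "small_functor A B u \<longleftrightarrow> small_cat A \<and> small_cat B \<and> is_functor A B u"

definition vzero :: "'v::universe" where
  "vzero = vset {}"

definition terminal_cat :: "'v::universe scat" where
  "terminal_cat = \<lparr>Obj = {vzero}, Arr = {vzero},
     Dom = (\<lambda>f\<in>{vzero}. vzero), Cod = (\<lambda>f\<in>{vzero}. vzero), Id = (\<lambda>x\<in>{vzero}. vzero),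
     Comp = (\<lambda>g f. if g = vzero \<and> f = vzero then vzero else undefined)\<rparr>"

definition to_terminal :: "'v::universe scat \<Rightarrow> 'v sfun" where
  "to_terminal A = \<lparr>Src = A, Trg = terminal_cat,
     fob = (\<lambda>x\<in>Obj A. vzero), far = (\<lambda>f\<in>Arr A. vzero)\<rparr>"

definition point :: "'v::universe scat \<Rightarrow> 'v \<Rightarrow> 'v sfun" where
  "point B b = \<lparr>Src = terminal_cat, Trg = B,
     fob = (\<lambda>x\<in>{vzero}. b), far = (\<lambda>f\<in>{vzero}. Id B b)\<rparr>"

text \<open>
  In \<open>A/b\<close> and \<open>b\A\<close> an arrow from \<open>x = (a, g)\<close> to \<open>y = (a', g')\<close> with
  underlying arrow \<open>f : a \<rightarrow> a'\<close> is encoded as the triple \<open>(x, f, y)\<close>, because an arrow has to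
  determine its source and target.
\<close>

definition tri :: "'v::universe \<Rightarrow> 'v \<Rightarrow> 'v \<Rightarrow> 'v" where
  "tri x f y = vpair x (vpair f y)"

definition tri_src :: "'v::universe \<Rightarrow> 'v" where "tri_src k = vfst k"
definition tri_lab :: "'v::universe \<Rightarrow> 'v" where "tri_lab k = vfst (vsnd k)"
definition tri_trg :: "'v::universe \<Rightarrow> 'v" where "tri_trg k = vsnd (vsnd k)"

definition triple_cat :: "'v::universe scat \<Rightarrow> 'v set \<Rightarrow> 'v set \<Rightarrow> 'v scat" where
  "triple_cat A X K = \<lparr>Obj = X, Arr = K,
     Dom = (\<lambda>k\<in>K. tri_src k), Cod = (\<lambda>k\<in>K. tri_trg k),
     Id = (\<lambda>x\<in>X. tri x (Id A (vfst x)) x),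
     Comp = (\<lambda>l k. if k \<in> K \<and> l \<in> K \<and> tri_trg k = tri_src l
                    then tri (tri_src k) (tri_lab l \<cdot>\<^bsub>A\<^esub> tri_lab k) (tri_trg l)
                    else undefined)\<rparr>"

definition triple_forget :: "'v::universe scat \<Rightarrow> 'v scat \<Rightarrow> 'v sfun" where
  "triple_forget K A = \<lparr>Src = K, Trg = A,
     fob = (\<lambda>x\<in>Obj K. vfst x), far = (\<lambda>k\<in>Arr K. tri_lab k)\<rparr>"

text \<open>\<open>slice u b\<close> is \<open>A/b\<close> and \<open>coslice b u\<close> is \<open>b\A\<close>, for \<open>u : A \<rightarrow> B\<close>.\<close>

definition slice :: "'v::universe sfun \<Rightarrow> 'v \<Rightarrow> 'v scat" where
  "slice u b = triple_cat (Src u)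
     {vpair a g | a g. a \<in> Obj (Src u) \<and> g \<in> hom (Trg u) (fob u a) b}
     {tri (vpair a g) f (vpair a' g') | a g f a' g'.
        f \<in> hom (Src u) a a' \<and> g \<in> hom (Trg u) (fob u a) b \<and> g' \<in> hom (Trg u) (fob u a') b \<and>
        g' \<cdot>\<^bsub>Trg u\<^esub> far u f = g}"

definition coslice :: "'v::universe \<Rightarrow> 'v sfun \<Rightarrow> 'v scat" where
  "coslice b u = triple_cat (Src u)
     {vpair a g | a g. a \<in> Obj (Src u) \<and> g \<in> hom (Trg u) b (fob u a)}
     {tri (vpair a g) f (vpair a' g') | a g f a' g'.
        f \<in> hom (Src u) a a' \<and> g \<in> hom (Trg u) b (fob u a) \<and> g' \<in> hom (Trg u) b (fob u a') \<and>
        far u f \<cdot>\<^bsub>Trg u\<^esub> g = g'}"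

definition slice_forget :: "'v::universe sfun \<Rightarrow> 'v \<Rightarrow> 'v sfun" where
  "slice_forget u b = triple_forget (slice u b) (Src u)"

definition coslice_forget :: "'v::universe \<Rightarrow> 'v sfun \<Rightarrow> 'v sfun" where
  "coslice_forget b u = triple_forget (coslice b u) (Src u)"

definition triple_functor ::
    "'v::universe scat \<Rightarrow> 'v scat \<Rightarrow> ('v \<Rightarrow> 'v) \<Rightarrow> ('v \<Rightarrow> 'v) \<Rightarrow> 'v sfun" where
  "triple_functor K L \<phi> \<psi> = \<lparr>Src = K, Trg = L,
     fob = (\<lambda>x\<in>Obj K. \<phi> x),
     far = (\<lambda>k\<in>Arr K. tri (\<phi> (tri_src k)) (\<psi> (tri_lab k)) (\<phi> (tri_trg k)))\<rparr>"

text \<open>The functor \<open>c\A \<rightarrow> c\B\<close> induced by \<open>u\<close>, for a commutative triangle \<open>v = w u\<close>.\<close>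

definition coslice_map :: "'v::universe \<Rightarrow> 'v sfun \<Rightarrow> 'v sfun \<Rightarrow> 'v sfun \<Rightarrow> 'v sfun" where
  "coslice_map c u w v = triple_functor (coslice c v) (coslice c w)
     (\<lambda>x. vpair (fob u (vfst x)) (vsnd x)) (far u)"

text \<open>Coproducts of families of small categories indexed by a set of elements of the universe.\<close>

definition coprod_cat :: "'v::universe set \<Rightarrow> ('v \<Rightarrow> 'v scat) \<Rightarrow> 'v scat" where
  "coprod_cat I A = (let X = {vpair i x | i x. i \<in> I \<and> x \<in> Obj (A i)};
                         K = {vpair i f | i f. i \<in> I \<and> f \<in> Arr (A i)} in
     \<lparr>Obj = X, Arr = K,
      Dom = (\<lambda>k\<in>K. vpair (vfst k) (Dom (A (vfst k)) (vsnd k))),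
      Cod = (\<lambda>k\<in>K. vpair (vfst k) (Cod (A (vfst k)) (vsnd k))),
      Id = (\<lambda>x\<in>X. vpair (vfst x) (Id (A (vfst x)) (vsnd x))),
      Comp = (\<lambda>l k. if k \<in> K \<and> l \<in> K \<and> vfst k = vfst l \<and>
                        Cod (A (vfst k)) (vsnd k) = Dom (A (vfst k)) (vsnd l)
                     then vpair (vfst k) (vsnd l \<cdot>\<^bsub>A (vfst k)\<^esub> vsnd k) else undefined)\<rparr>)"

definition coprod_inj :: "'v::universe set \<Rightarrow> ('v \<Rightarrow> 'v scat) \<Rightarrow> 'v \<Rightarrow> 'v sfun" where
  "coprod_inj I A i = \<lparr>Src = A i, Trg = coprod_cat I A,
     fob = (\<lambda>x\<in>Obj (A i). vpair i x), far = (\<lambda>f\<in>Arr (A i). vpair i f)\<rparr>"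

definition prod_cat :: "'i set \<Rightarrow> ('i \<Rightarrow> ('o, 'a) cat) \<Rightarrow> ('i \<Rightarrow> 'o, 'i \<Rightarrow> 'a) cat" where
  "prod_cat I C = (let X = (\<Pi>\<^sub>E i\<in>I. Obj (C i)); K = (\<Pi>\<^sub>E i\<in>I. Arr (C i)) in
     \<lparr>Obj = X, Arr = K,
      Dom = (\<lambda>k\<in>K. \<lambda>i\<in>I. Dom (C i) (k i)),
      Cod = (\<lambda>k\<in>K. \<lambda>i\<in>I. Cod (C i) (k i)),
      Id = (\<lambda>x\<in>X. \<lambda>i\<in>I. Id (C i) (x i)),
      Comp = (\<lambda>l k. if k \<in> K \<and> l \<in> K \<and> (\<forall>i\<in>I. Cod (C i) (k i) = Dom (C i) (l i))
                     then (\<lambda>i\<in>I. l i \<cdot>\<^bsub>C i\<^esub> k i) else undefined)\<rparr>)"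

section \<open>Squares\<close>

text \<open>
  The 2-cell of a square goes from \<open>sq_right \<odot> sq_top\<close> to \<open>sq_bot \<odot> sq_left\<close>.
  In the notation \<open>\<alpha> : u v \<rightarrow> w u'\<close> one has \<open>v = sq_top\<close>, \<open>w = sq_bot\<close>,
  \<open>u' = sq_left\<close> and \<open>u = sq_right\<close>.
\<close>

record 'v square =
  sq_top :: "'v sfun"
  sq_bot :: "'v sfun"
  sq_left :: "'v sfun"
  sq_right :: "'v sfun"
  sq_cell :: "'v snat"

definition is_square :: "'v::universe square \<Rightarrow> bool" where
  "is_square S \<longleftrightarrow> (\<exists>A' A B' B.
     small_functor A' A (sq_top S) \<and> small_functor B' B (sq_bot S) \<and>
     small_functor A' B' (sq_left S) \<and> small_functor A B (sq_right S) \<and>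
     is_nat (sq_right S \<odot> sq_top S) (sq_bot S \<odot> sq_left S) (sq_cell S))"

definition slice_square :: "'v::universe sfun \<Rightarrow> 'v \<Rightarrow> 'v square" where
  "slice_square u b =
     \<lparr>sq_top = slice_forget u b, sq_bot = point (Trg u) b,
      sq_left = to_terminal (slice u b), sq_right = u,
      sq_cell = \<lparr>NSrc = u \<odot> slice_forget u b,
                 NTrg = point (Trg u) b \<odot> to_terminal (slice u b),
                 cmp = (\<lambda>x\<in>Obj (slice u b). vsnd x)\<rparr>\<rparr>"

definition coslice_square :: "'v::universe \<Rightarrow> 'v sfun \<Rightarrow> 'v square" where
  "coslice_square b u =
     \<lparr>sq_top = to_terminal (coslice b u), sq_bot = u,
      sq_left = coslice_forget b u, sq_right = point (Trg u) b,
      sq_cell = \<lparr>NSrc = point (Trg u) b \<odot> to_terminal (coslice b u),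
                 NTrg = u \<odot> coslice_forget b u,
                 cmp = (\<lambda>x\<in>Obj (coslice b u). vsnd x)\<rparr>\<rparr>"

text \<open>
  \<open>square_slice_map S b'\<close> is the functor \<open>A'/b' \<rightarrow> A/w(b')\<close> which sends \<open>(a', g')\<close> to
  \<open>(v(a'), w(g') \<alpha>\<^sub>a\<^sub>')\<close>.
\<close>

definition square_slice_map :: "'v::universe square \<Rightarrow> 'v \<Rightarrow> 'v sfun" where
  "square_slice_map S b' =
     triple_functor (slice (sq_left S) b') (slice (sq_right S) (fob (sq_bot S) b'))
       (\<lambda>x. vpair (fob (sq_top S) (vfst x))
                  (far (sq_bot S) (vsnd x) \<cdot>\<^bsub>Trg (sq_bot S)\<^esub> cmp (sq_cell S) (vfst x)))
       (far (sq_top S))"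

section \<open>Prederivators\<close>

text \<open>
  The types \<open>'o\<close> and \<open>'m\<close> of objects and arrows of the categories \<open>\<D>(A)\<close> are arbitrary and not
  related to the universe \<open>'v\<close>. The values of a prederivator outside small categories, functors
  between them and their natural transformations are irrelevant.
\<close>

record ('v, 'o, 'm) prederiv =
  D0 :: "'v scat \<Rightarrow> ('o, 'm) cat"
  D1 :: "'v sfun \<Rightarrow> ('o, 'm, 'o, 'm) fctr"
  D2 :: "'v snat \<Rightarrow> ('o, 'm, 'o, 'm) ntrans"

definition prederivator :: "('v::universe, 'o, 'm) prederiv \<Rightarrow> bool" where
  "prederivator D \<longleftrightarrow>
     (\<forall>A. small_cat A \<longrightarrow> category (D0 D A)) \<and>
     (\<forall>A B u. small_functor A B u \<longrightarrow> is_functor (D0 D B) (D0 D A) (D1 D u)) \<and>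
     (\<forall>A B u v \<alpha>. small_functor A B u \<and> small_functor A B v \<and> is_nat u v \<alpha> \<longrightarrow>
        is_nat (D1 D v) (D1 D u) (D2 D \<alpha>)) \<and>
     (\<forall>A. small_cat A \<longrightarrow> D1 D (idF A) = idF (D0 D A)) \<and>
     (\<forall>A B C u v. small_functor A B u \<and> small_functor B C v \<longrightarrow>
        D1 D (v \<odot> u) = D1 D u \<odot> D1 D v) \<and>
     (\<forall>A B u. small_functor A B u \<longrightarrow> D2 D (idN u) = idN (D1 D u)) \<and>
     (\<forall>A B u v w \<alpha> \<beta>. small_functor A B u \<and> small_functor A B v \<and> small_functor A B w \<and>
        is_nat u v \<alpha> \<and> is_nat v w \<beta> \<longrightarrow> D2 D (vcomp \<beta> \<alpha>) = vcomp (D2 D \<alpha>) (D2 D \<beta>)) \<and>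
     (\<forall>A B C u v w x \<alpha> \<beta>. small_functor A B u \<and> small_functor A B v \<and>
        small_functor B C w \<and> small_functor B C x \<and> is_nat u v \<alpha> \<and> is_nat w x \<beta> \<longrightarrow>
        D2 D (hcomp \<beta> \<alpha>) = hcomp (D2 D \<alpha>) (D2 D \<beta>))"

definition conservative :: "('v::universe, 'o, 'm) prederiv \<Rightarrow> bool" where
  "conservative D \<longleftrightarrow> (\<forall>A. small_cat A \<longrightarrow> (\<forall>\<phi>\<in>Arr (D0 D A).
     (\<forall>a\<in>Obj A. is_iso (D0 D terminal_cat) (far (D1 D (point A a)) \<phi>)) \<longrightarrow>
     is_iso (D0 D A) \<phi>))"

definition cohom_direct_images :: "('v::universe, 'o, 'm) prederiv \<Rightarrow> bool" where
  "cohom_direct_images D \<longleftrightarrow> (\<forall>A B u. small_functor A B u \<longrightarrow>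
     (\<exists>R \<eta> \<epsilon>. adjunction (D1 D u) R \<eta> \<epsilon>))"

definition hom_direct_images :: "('v::universe, 'o, 'm) prederiv \<Rightarrow> bool" where
  "hom_direct_images D \<longleftrightarrow> (\<forall>A B u. small_functor A B u \<longrightarrow>
     (\<exists>L \<eta> \<epsilon>. adjunction L (D1 D u) \<eta> \<epsilon>))"

text \<open>
  \<open>cohom_bc_mor D S R \<epsilon> R' \<eta>'\<close> is the base change morphism
  \<open>w\<^sup>* u\<^sub>* \<rightarrow> u'\<^sub>* u'\<^sup>* w\<^sup>* u\<^sub>* \<rightarrow> u'\<^sub>* v\<^sup>* u\<^sup>* u\<^sub>* \<rightarrow> u'\<^sub>* v\<^sup>*\<close>, where \<open>R = u\<^sub>*\<close> with counit \<open>\<epsilon>\<close>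
  and \<open>R' = u'\<^sub>*\<close> with unit \<open>\<eta>'\<close>.
\<close>

definition cohom_bc_mor ::
    "('v::universe, 'o, 'm) prederiv \<Rightarrow> 'v square \<Rightarrow>
     ('o, 'm, 'o, 'm) fctr \<Rightarrow> ('o, 'm, 'o, 'm) ntrans \<Rightarrow>
     ('o, 'm, 'o, 'm) fctr \<Rightarrow> ('o, 'm, 'o, 'm) ntrans \<Rightarrow> ('o, 'm, 'o, 'm) ntrans" where
  "cohom_bc_mor D S R \<epsilon> R' \<eta>' =
     (let vs = D1 D (sq_top S); ws = D1 D (sq_bot S) in
      vcomp (hcomp (idN (R' \<odot> vs)) \<epsilon>)
        (vcomp (hcomp (idN R') (hcomp (D2 D (sq_cell S)) (idN R)))
               (hcomp \<eta>' (idN (ws \<odot> R)))))"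

definition cohom_base_change :: "('v::universe, 'o, 'm) prederiv \<Rightarrow> 'v square \<Rightarrow> bool" where
  "cohom_base_change D S \<longleftrightarrow>
     (\<exists>R \<eta> \<epsilon>. adjunction (D1 D (sq_right S)) R \<eta> \<epsilon>) \<and>
     (\<exists>R' \<eta>' \<epsilon>'. adjunction (D1 D (sq_left S)) R' \<eta>' \<epsilon>') \<and>
     (\<forall>R \<eta> \<epsilon> R' \<eta>' \<epsilon>'. adjunction (D1 D (sq_right S)) R \<eta> \<epsilon> \<and>
        adjunction (D1 D (sq_left S)) R' \<eta>' \<epsilon>' \<longrightarrow>
        nat_iso (cohom_bc_mor D S R \<epsilon> R' \<eta>'))"

text \<open>
  \<open>hom_bc_mor D S L \<eta> L' \<epsilon>'\<close> is the morphism
  \<open>v\<^sub>! u'\<^sup>* \<rightarrow> v\<^sub>! u'\<^sup>* w\<^sup>* w\<^sub>! \<rightarrow> v\<^sub>! v\<^sup>* u\<^sup>* w\<^sub>! \<rightarrow> u\<^sup>* w\<^sub>!\<close>, where \<open>L = w\<^sub>!\<close> with unit \<open>\<eta>\<close>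
  and \<open>L' = v\<^sub>!\<close> with counit \<open>\<epsilon>'\<close>.
\<close>

definition hom_bc_mor ::
    "('v::universe, 'o, 'm) prederiv \<Rightarrow> 'v square \<Rightarrow>
     ('o, 'm, 'o, 'm) fctr \<Rightarrow> ('o, 'm, 'o, 'm) ntrans \<Rightarrow>
     ('o, 'm, 'o, 'm) fctr \<Rightarrow> ('o, 'm, 'o, 'm) ntrans \<Rightarrow> ('o, 'm, 'o, 'm) ntrans" where
  "hom_bc_mor D S L \<eta> L' \<epsilon>' =
     (let us = D1 D (sq_right S); us' = D1 D (sq_left S) in
      vcomp (hcomp \<epsilon>' (idN (us \<odot> L)))
        (vcomp (hcomp (idN L') (hcomp (D2 D (sq_cell S)) (idN L)))
               (hcomp (idN (L' \<odot> us')) \<eta>)))"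

definition hom_base_change :: "('v::universe, 'o, 'm) prederiv \<Rightarrow> 'v square \<Rightarrow> bool" where
  "hom_base_change D S \<longleftrightarrow>
     (\<exists>L \<eta> \<epsilon>. adjunction L (D1 D (sq_bot S)) \<eta> \<epsilon>) \<and>
     (\<exists>L' \<eta>' \<epsilon>'. adjunction L' (D1 D (sq_top S)) \<eta>' \<epsilon>') \<and>
     (\<forall>L \<eta> \<epsilon> L' \<eta>' \<epsilon>'. adjunction L (D1 D (sq_bot S)) \<eta> \<epsilon> \<and>
        adjunction L' (D1 D (sq_top S)) \<eta>' \<epsilon>' \<longrightarrow>
        nat_iso (hom_bc_mor D S L \<eta> L' \<epsilon>'))"

definition complete_prederivator :: "('v::universe, 'o, 'm) prederiv \<Rightarrow> bool" where
  "complete_prederivator D \<longleftrightarrow> cohom_direct_images D \<and>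
     (\<forall>A B u. small_functor A B u \<longrightarrow> (\<forall>b\<in>Obj B. cohom_base_change D (slice_square u b)))"

definition cocomplete_prederivator :: "('v::universe, 'o, 'm) prederiv \<Rightarrow> bool" where
  "cocomplete_prederivator D \<longleftrightarrow> hom_direct_images D \<and>
     (\<forall>A B u. small_functor A B u \<longrightarrow> (\<forall>b\<in>Obj B. hom_base_change D (coslice_square b u)))"

definition coprod_comparison ::
    "('v::universe, 'o, 'm) prederiv \<Rightarrow> 'v set \<Rightarrow> ('v \<Rightarrow> 'v scat) \<Rightarrow>
     ('o, 'm, 'v \<Rightarrow> 'o, 'v \<Rightarrow> 'm) fctr" where
  "coprod_comparison D I A =
     (let C = D0 D (coprod_cat I A) in
      \<lparr>Src = C, Trg = prod_cat I (\<lambda>i. D0 D (A i)),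
       fob = (\<lambda>X\<in>Obj C. \<lambda>i\<in>I. fob (D1 D (coprod_inj I A i)) X),
       far = (\<lambda>\<phi>\<in>Arr C. \<lambda>i\<in>I. far (D1 D (coprod_inj I A i)) \<phi>)\<rparr>)"

text \<open>
  The universe contains arbitrarily large finite subsets, so indexing by finite sets of its elements
  covers all finite families.
\<close>

definition der1 :: "('v::universe, 'o, 'm) prederiv \<Rightarrow> bool" where
  "der1 D \<longleftrightarrow> (\<forall>I A. finite I \<and> (\<forall>i\<in>I. small_cat (A i)) \<longrightarrow>
     is_equivalence (coprod_comparison D I A))"

definition derivator :: "('v::universe, 'o, 'm) prederiv \<Rightarrow> bool" where
  "derivator D \<longleftrightarrow> prederivator D \<and> conservative D \<and> complete_prederivator D \<and>
     cocomplete_prederivator D \<and> der1 D"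

section \<open>Local equivalences and weak exactness\<close>

definition D_equivalence ::
    "('v::universe, 'o, 'm) prederiv \<Rightarrow> 'v scat \<Rightarrow> 'v scat \<Rightarrow> 'v sfun \<Rightarrow> bool" where
  "D_equivalence D A B u \<longleftrightarrow> small_functor A B u \<and>
     (let ps = D1 D (to_terminal A); qs = D1 D (to_terminal B) in
      \<forall>X\<in>Obj (D0 D terminal_cat). \<forall>Y\<in>Obj (D0 D terminal_cat).
        bij_betw (far (D1 D u))
          (hom (D0 D B) (fob qs X) (fob qs Y)) (hom (D0 D A) (fob ps X) (fob ps Y)))"

definition commutative_triangle ::
    "'v::universe scat \<Rightarrow> 'v scat \<Rightarrow> 'v scat \<Rightarrow> 'v sfun \<Rightarrow> 'v sfun \<Rightarrow> 'v sfun \<Rightarrow> bool" where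
  "commutative_triangle A B C u w v \<longleftrightarrow>
     small_functor A B u \<and> small_functor B C w \<and> small_functor A C v \<and> v = w \<odot> u"

definition D_equivalence_colocally ::
    "('v::universe, 'o, 'm) prederiv \<Rightarrow> 'v scat \<Rightarrow> 'v scat \<Rightarrow> 'v scat \<Rightarrow>
     'v sfun \<Rightarrow> 'v sfun \<Rightarrow> 'v sfun \<Rightarrow> bool" where
  "D_equivalence_colocally D A B C u w v \<longleftrightarrow> commutative_triangle A B C u w v \<and>
     (\<forall>c\<in>Obj C. D_equivalence D (coslice c v) (coslice c w) (coslice_map c u w v))"

text \<open>
  For \<open>u : A \<rightarrow> B\<close>, \<open>p : A \<rightarrow> e\<close> and \<open>q : B \<rightarrow> e\<close>, so that \<open>p\<^sup>* = u\<^sup>* q\<^sup>*\<close>,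
  \<open>direct_image_comparison\<close> is the canonical isomorphism \<open>q\<^sub>* u\<^sub>* \<rightarrow> p\<^sub>*\<close> between right adjoints of
  \<open>p\<^sup>*\<close>, namely the composite \<open>q\<^sub>* u\<^sub>* \<rightarrow> p\<^sub>* p\<^sup>* q\<^sub>* u\<^sub>* = p\<^sub>* u\<^sup>* q\<^sup>* q\<^sub>* u\<^sub>* \<rightarrow> p\<^sub>* u\<^sup>* u\<^sub>* \<rightarrow> p\<^sub>*\<close>.
\<close>

definition direct_image_comparison ::
    "('v::universe, 'o, 'm) prederiv \<Rightarrow> 'v sfun \<Rightarrow>
     ('o, 'm, 'o, 'm) fctr \<Rightarrow> ('o, 'm, 'o, 'm) ntrans \<Rightarrow>
     ('o, 'm, 'o, 'm) fctr \<Rightarrow> ('o, 'm, 'o, 'm) ntrans \<Rightarrow>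
     ('o, 'm, 'o, 'm) fctr \<Rightarrow> ('o, 'm, 'o, 'm) ntrans \<Rightarrow> ('o, 'm, 'o, 'm) ntrans" where
  "direct_image_comparison D u Ru \<epsilon>u Rq \<epsilon>q Rp \<eta>p =
     vcomp (hcomp (idN Rp) \<epsilon>u)
       (vcomp (hcomp (idN (Rp \<odot> D1 D u)) (hcomp \<epsilon>q (idN Ru)))
              (hcomp \<eta>p (idN (Rq \<odot> Ru))))"

text \<open>The canonical morphism \<open>q\<^sub>* w\<^sup>* \<rightarrow> q\<^sub>* u\<^sub>* u\<^sup>* w\<^sup>* \<simeq> p\<^sub>* v\<^sup>*\<close>, where \<open>v = w u\<close>.\<close>

definition triangle_mor ::
    "('v::universe, 'o, 'm) prederiv \<Rightarrow> 'v sfun \<Rightarrow> 'v sfun \<Rightarrow> 'v sfun \<Rightarrow>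
     ('o, 'm, 'o, 'm) fctr \<Rightarrow> ('o, 'm, 'o, 'm) ntrans \<Rightarrow> ('o, 'm, 'o, 'm) ntrans \<Rightarrow>
     ('o, 'm, 'o, 'm) fctr \<Rightarrow> ('o, 'm, 'o, 'm) ntrans \<Rightarrow>
     ('o, 'm, 'o, 'm) fctr \<Rightarrow> ('o, 'm, 'o, 'm) ntrans \<Rightarrow> ('o, 'm, 'o, 'm) ntrans" where
  "triangle_mor D u w v Ru \<eta>u \<epsilon>u Rq \<epsilon>q Rp \<eta>p =
     vcomp (hcomp (direct_image_comparison D u Ru \<epsilon>u Rq \<epsilon>q Rp \<eta>p) (idN (D1 D v)))
           (hcomp (idN Rq) (hcomp \<eta>u (idN (D1 D w))))"

definition cohom_criterion_colocal :: "('v::universe, 'o, 'm) prederiv \<Rightarrow> bool" where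
  "cohom_criterion_colocal D \<longleftrightarrow> cohom_direct_images D \<and>
     (\<forall>A B C u w v. D_equivalence_colocally D A B C u w v \<longrightarrow>
        (\<forall>Ru \<eta>u \<epsilon>u Rq \<eta>q \<epsilon>q Rp \<eta>p \<epsilon>p.
           adjunction (D1 D u) Ru \<eta>u \<epsilon>u \<and>
           adjunction (D1 D (to_terminal B)) Rq \<eta>q \<epsilon>q \<and>
           adjunction (D1 D (to_terminal A)) Rp \<eta>p \<epsilon>p \<longrightarrow>
           nat_iso (triangle_mor D u w v Ru \<eta>u \<epsilon>u Rq \<epsilon>q Rp \<eta>p)))"

definition weakly_exact :: "('v::universe, 'o, 'm) prederiv \<Rightarrow> 'v square \<Rightarrow> bool" where
  "weakly_exact D S \<longleftrightarrow>
     (\<forall>b'\<in>Obj (Src (sq_bot S)).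
        let A = Src (sq_right S);
            K = slice (sq_left S) b';
            L = slice (sq_right S) (fob (sq_bot S) b')
        in D_equivalence_colocally D K L A (square_slice_map S b')
             (slice_forget (sq_right S) (fob (sq_bot S) b'))
             (sq_top S \<odot> slice_forget (sq_left S) b'))"

end

theory Submission
  imports Defs
begin

text \<open>
  A morphism into a value \<open>u\<^sub>* F\<close> of a right adjoint is invertible if and only if its transpose is a
  couniversal arrow from \<open>u\<^sup>*\<close> to \<open>F\<close>. Thus base change morphisms never have to be pasted:
  it is enough to follow couniversal arrows.

  By conservativity and Der 4g, applied to \<open>u'\<close> at \<open>b'\<close> and to \<open>u\<close> at \<open>w(b')\<close>, the base change
  morphism of a square is invertible at \<open>F\<close> if and only if, for every \<open>b'\<close>, the functor
  \<open>A'/b' \<rightarrow> A/w(b')\<close> over \<open>A\<close> induces an isomorphism between the cohomologies of the restrictions of \<open>F\<close>.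
  The criterion deduces this from weak exactness.
  Conversely, let \<open>u : A \<rightarrow> B\<close> over \<open>C\<close> induce such isomorphisms for all \<open>F\<close>, and take
  \<open>F = c\<^sub>* X\<close>. The comma square of \<open>c\<close> and \<open>w : B \<rightarrow> C\<close> satisfies base change, so the cohomology of
  \<open>w\<^sup>* c\<^sub>* X\<close> is that of the constant diagram \<open>X\<close> on \<open>c\B\<close>, and likewise on \<open>c\A\<close>; hence \<open>c\A \<rightarrow> c\B\<close> is
  a \<open>\<D>\<close>-equivalence.

  In a derivator the criterion follows by transposition from the invertibility of
  \<open>v\<^sub>! p\<^sup>* \<rightarrow> w\<^sub>! q\<^sup>*\<close>, which Der 4d reduces to the functors \<open>c\A \<rightarrow> c\B\<close>.
\<close>

section \<open>Categories and functors\<close>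

text \<open>Der 4g evaluates direct images through slices, whereas colocal equivalences concern
  coslices; two detours bridge this gap. In the converse, the comma square of c and w is not an
  instance of Der 4g, so its base change is itself derived from the slice criterion: over b the
  comparison functor goes from a slice of the coslice to the discrete category on Hom(c, w b), and
  it is a D-equivalence because each component of its source has a terminal object. The object c_* X
  is the right test object because a D-equivalence is a statement about constant coefficients on
  coslices, and c_* X is what produces them. For derivators the coslices are reached by Der 4d,
  hence the passage to left adjoints. All conditions are stated at a single object and as bijections
  of hom sets (\<open>cohom_iso_at\<close>). This form is shared by D-equivalences, the criterion
  and base change, and the adjoints over which the definitions quantify drop out of it.\<close>

lemma homD:
  assumes "f \<in> hom C x y"
  shows "f \<in> Arr C" "Dom C f = x" "Cod C f = y"
  using assms by (auto simp: hom_def)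

lemma hom_objs:
  assumes "category C" "f \<in> hom C x y"
  shows "x \<in> Obj C" "y \<in> Obj C"
  using assms by (auto simp: category_def hom_def)

lemma Id_hom: "category C \<Longrightarrow> x \<in> Obj C \<Longrightarrow> Id C x \<in> hom C x x"
  by (simp add: category_def)

lemma Comp_hom: "category C \<Longrightarrow> f \<in> hom C x y \<Longrightarrow> g \<in> hom C y z \<Longrightarrow> g \<cdot>\<^bsub>C\<^esub> f \<in> hom C x z"
  by (auto simp: category_def hom_def)

lemma Comp_Id_right: "category C \<Longrightarrow> f \<in> hom C x y \<Longrightarrow> f \<cdot>\<^bsub>C\<^esub> Id C x = f"
  by (auto simp: category_def hom_def)

lemma Comp_Id_left: "category C \<Longrightarrow> f \<in> hom C x y \<Longrightarrow> Id C y \<cdot>\<^bsub>C\<^esub> f = f"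
  by (auto simp: category_def hom_def)

lemma Comp_assoc:
  assumes "category C" "f \<in> hom C x y" "g \<in> hom C y z" "h \<in> hom C z t"
  shows "(h \<cdot>\<^bsub>C\<^esub> g) \<cdot>\<^bsub>C\<^esub> f = h \<cdot>\<^bsub>C\<^esub> (g \<cdot>\<^bsub>C\<^esub> f)"
  using assms by (simp add: category_def hom_def)

lemma is_isoI:
  assumes "f \<in> hom C x y" "g \<in> hom C y x" "g \<cdot>\<^bsub>C\<^esub> f = Id C x" "f \<cdot>\<^bsub>C\<^esub> g = Id C y"
  shows "is_iso C f"
  using assms unfolding is_iso_def hom_def by auto

lemma is_isoE:
  assumes "is_iso C f" "f \<in> hom C x y"
  obtains g where "g \<in> hom C y x" "g \<cdot>\<^bsub>C\<^esub> f = Id C x" "f \<cdot>\<^bsub>C\<^esub> g = Id C y"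
  using assms unfolding is_iso_def hom_def by auto

lemma functor_cats:
  assumes "is_functor C D F"
  shows "category C" "category D" "Src F = C" "Trg F = D"
  using assms by (auto simp: is_functor_def)

lemma fob_in: "is_functor C D F \<Longrightarrow> x \<in> Obj C \<Longrightarrow> fob F x \<in> Obj D"
  by (auto simp: is_functor_def)

lemma far_hom: "is_functor C D F \<Longrightarrow> f \<in> hom C x y \<Longrightarrow> far F f \<in> hom D (fob F x) (fob F y)"
  by (auto simp: is_functor_def hom_def)

lemma far_Id: "is_functor C D F \<Longrightarrow> x \<in> Obj C \<Longrightarrow> far F (Id C x) = Id D (fob F x)"
  by (auto simp: is_functor_def)

lemma far_Comp:
  "is_functor C D F \<Longrightarrow> f \<in> hom C x y \<Longrightarrow> g \<in> hom C y z \<Longrightarrow>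
    far F (g \<cdot>\<^bsub>C\<^esub> f) = far F g \<cdot>\<^bsub>D\<^esub> far F f"
  by (auto simp: is_functor_def hom_def)

lemma functor_is_iso:
  assumes F: "is_functor C D F" and f: "f \<in> hom C x y" and iso: "is_iso C f"
  shows "is_iso D (far F f)"
proof -
  obtain g where g: "g \<in> hom C y x" "g \<cdot>\<^bsub>C\<^esub> f = Id C x" "f \<cdot>\<^bsub>C\<^esub> g = Id C y"
    using iso f by (rule is_isoE)
  have "x \<in> Obj C" "y \<in> Obj C"
    using hom_objs[OF functor_cats(1)[OF F] f] by auto
  then show ?thesis
    using far_Comp[OF F f g(1)] far_Comp[OF F g(1) f] g far_Id[OF F]
    by (intro is_isoI[OF far_hom[OF F f] far_hom[OF F g(1)]]) auto
qed

text \<open>The maps of a functor are \<open>undefined\<close> off their domains, so agreement on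
  objects and arrows is equality of records. The equations of a strict 2-functor can then be used by
  rewriting.\<close>

lemma functor_eqI:
  assumes F: "is_functor C D F" and G: "is_functor C D G"
    and "\<And>x. x \<in> Obj C \<Longrightarrow> fob F x = fob G x"
    and "\<And>f. f \<in> Arr C \<Longrightarrow> far F f = far G f"
  shows "F = (G :: ('o, 'a, 'p, 'b) fctr)"
proof (rule fctr.equality)
  show "fob F = fob G"
    by (rule extensionalityI[of _ "Obj C"]) (use F G assms(3) in \<open>auto simp: is_functor_def PiE_iff\<close>)
  show "far F = far G"
    by (rule extensionalityI[of _ "Arr C"]) (use F G assms(4) in \<open>auto simp: is_functor_def\<close>)
qed (use functor_cats[OF F] functor_cats[OF G] in auto)

lemma fob_compF: "is_functor C D F \<Longrightarrow> x \<in> Obj C \<Longrightarrow> fob (G \<odot> F) x = fob G (fob F x)"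
  by (simp add: compF_def compose_def functor_cats)

lemma far_compF: "is_functor C D F \<Longrightarrow> f \<in> hom C x y \<Longrightarrow> far (G \<odot> F) f = far G (far F f)"
  by (simp add: compF_def compose_def functor_cats hom_def)

lemma is_functor_compF:
  assumes F: "is_functor C D F" and G: "is_functor D E G"
  shows "is_functor C E (G \<odot> F)"
proof -
  note c = functor_cats[OF F] functor_cats[OF G]
  have fo: "fob (G \<odot> F) x = fob G (fob F x)" if "x \<in> Obj C" for x
    using fob_compF[OF F that] .
  have fa: "far (G \<odot> F) f = far G (far F f)" if "f \<in> Arr C" for f
    using far_compF[OF F] that by (auto simp: hom_def)
  have ob: "Dom C f \<in> Obj C" "Cod C f \<in> Obj C" if "f \<in> Arr C" for f
    using hom_objs[OF c(1)] that by (auto simp: hom_def)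
  show ?thesis
    unfolding is_functor_def
  proof (intro conjI ballI impI)
    show "fob (G \<odot> F) \<in> Obj C \<rightarrow>\<^sub>E Obj E"
      using fob_in[OF F] fob_in[OF G] by (auto simp: fo) (simp add: compF_def compose_def c)
    show "far (G \<odot> F) \<in> extensional (Arr C)"
      by (simp add: compF_def c)
    show "far (G \<odot> F) f \<in> hom E (fob (G \<odot> F) (Dom C f)) (fob (G \<odot> F) (Cod C f))"
      if "f \<in> Arr C" for f
      using far_hom[OF G far_hom[OF F, of f "Dom C f" "Cod C f"]] that ob[OF that]
      by (simp add: fo fa hom_def)
    show "far (G \<odot> F) (Id C x) = Id E (fob (G \<odot> F) x)" if "x \<in> Obj C" for x
      using far_Id[OF F that] far_Id[OF G fob_in[OF F that]] Id_hom[OF c(1) that] that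
      by (simp add: fo fa hom_def)
    show "far (G \<odot> F) (g \<cdot>\<^bsub>C\<^esub> f) = far (G \<odot> F) g \<cdot>\<^bsub>E\<^esub> far (G \<odot> F) f"
      if "f \<in> Arr C" "g \<in> Arr C" "Cod C f = Dom C g" for f g
    proof -
      have f: "f \<in> hom C (Dom C f) (Cod C f)" and g: "g \<in> hom C (Cod C f) (Cod C g)"
        using that by (auto simp: hom_def)
      show ?thesis
        using far_Comp[OF F f g] far_Comp[OF G far_hom[OF F f] far_hom[OF F g]]
          Comp_hom[OF c(1) f g] that by (simp add: fa hom_def)
    qed
  qed (use c in \<open>simp_all add: compF_def\<close>)
qed

text \<open>\<open>compose\<close> restricts to the given carrier, so the two bracketings agree
  because \<open>F\<close> lands in the source of \<open>G\<close>.\<close>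

lemma compF_assoc:
  assumes "is_functor B C F" and "Src G = C"
  shows "(H \<odot> G) \<odot> F = H \<odot> (G \<odot> F)"
proof -
  have "fob F \<in> Obj B \<rightarrow> Obj C" "far F \<in> Arr B \<rightarrow> Arr C"
    using assms by (auto simp: is_functor_def hom_def)
  then show ?thesis
    using assms(2) by (simp add: compF_def functor_cats[OF assms(1)] compose_assoc)
qed

lemma is_functor_idF: "category C \<Longrightarrow> is_functor C C (idF C)"
  using Comp_hom[of C] by (auto simp: is_functor_def idF_def category_def hom_def)

lemma idF_simps:
  "x \<in> Obj C \<Longrightarrow> fob (idF C) x = x" "f \<in> hom C x y \<Longrightarrow> far (idF C) f = f"
  by (auto simp: idF_def hom_def)

lemma idF_compF:
  assumes F: "is_functor C D F"
  shows "idF D \<odot> F = F"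
proof (rule functor_eqI[OF _ F])
  note c = functor_cats[OF F]
  show "is_functor C D (idF D \<odot> F)"
    using is_functor_compF[OF F is_functor_idF[OF c(2)]] .
  show "fob (idF D \<odot> F) x = fob F x" if "x \<in> Obj C" for x
    using fob_in[OF F that] by (simp add: fob_compF[OF F that] idF_simps)
  show "far (idF D \<odot> F) f = far F f" if "f \<in> Arr C" for f
  proof -
    have "f \<in> hom C (Dom C f) (Cod C f)" using that by (simp add: hom_def)
    then show ?thesis
      by (simp add: far_compF[OF F] idF_simps(2)[OF far_hom[OF F]])
  qed
qed

section \<open>Natural transformations, vertical composition and whiskering\<close>

text \<open>\<open>is_nat\<close> hides its two categories behind existential quantifiers; the
  fields \<open>Src\<close> and \<open>Trg\<close> of \<open>F\<close> determine them.\<close>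

lemma is_natD:
  assumes "is_nat F G \<alpha>" and F: "is_functor C D F"
  shows "is_functor C D G \<and> NSrc \<alpha> = F \<and> NTrg \<alpha> = G \<and> cmp \<alpha> \<in> extensional (Obj C) \<and>
    (\<forall>x\<in>Obj C. cmp \<alpha> x \<in> hom D (fob F x) (fob G x)) \<and>
    (\<forall>f\<in>Arr C. cmp \<alpha> (Cod C f) \<cdot>\<^bsub>D\<^esub> far F f = far G f \<cdot>\<^bsub>D\<^esub> cmp \<alpha> (Dom C f))"
proof -
  obtain C' D' where *: "is_functor C' D' F" and nat: "is_functor C' D' G \<and> NSrc \<alpha> = F \<and>
    NTrg \<alpha> = G \<and> cmp \<alpha> \<in> extensional (Obj C') \<and>
    (\<forall>x\<in>Obj C'. cmp \<alpha> x \<in> hom D' (fob F x) (fob G x)) \<and>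
    (\<forall>f\<in>Arr C'. cmp \<alpha> (Cod C' f) \<cdot>\<^bsub>D'\<^esub> far F f = far G f \<cdot>\<^bsub>D'\<^esub> cmp \<alpha> (Dom C' f))"
    using assms(1) unfolding is_nat_def by blast
  have "C' = C" "D' = D"
    using functor_cats(3,4)[OF F] functor_cats(3,4)[OF *] by simp_all
  then show ?thesis
    using nat by simp
qed

lemma nat_cmp:
  assumes "is_nat F G \<alpha>" "is_functor C D F" "x \<in> Obj C"
  shows "cmp \<alpha> x \<in> hom D (fob F x) (fob G x)"
  using is_natD[OF assms(1,2)] assms(3) by blast

lemma nat_naturality:
  assumes "is_nat F G \<alpha>" "is_functor C D F" "f \<in> hom C x y"
  shows "cmp \<alpha> y \<cdot>\<^bsub>D\<^esub> far F f = far G f \<cdot>\<^bsub>D\<^esub> cmp \<alpha> x"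
  using is_natD[OF assms(1,2)] assms(3) by (auto simp: hom_def)

lemma nat_functors:
  assumes "is_nat F G \<alpha>" "is_functor C D F"
  shows "is_functor C D G" "NSrc \<alpha> = F" "NTrg \<alpha> = G" "cmp \<alpha> \<in> extensional (Obj C)"
  using is_natD[OF assms] by blast+

lemma is_natI:
  assumes "is_functor C D F" "is_functor C D G" "NSrc \<alpha> = F" "NTrg \<alpha> = G"
    and "cmp \<alpha> \<in> extensional (Obj C)"
    and "\<And>x. x \<in> Obj C \<Longrightarrow> cmp \<alpha> x \<in> hom D (fob F x) (fob G x)"
    and "\<And>f x y. f \<in> hom C x y \<Longrightarrow> cmp \<alpha> y \<cdot>\<^bsub>D\<^esub> far F f = far G f \<cdot>\<^bsub>D\<^esub> cmp \<alpha> x"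
  shows "is_nat F G \<alpha>"
  unfolding is_nat_def using assms by (intro exI[of _ C] exI[of _ D]) (auto simp: hom_def)

lemma nat_eqI:
  assumes "is_nat F G \<alpha>" "is_nat F G \<beta>" "is_functor C D F"
    and "\<And>x. x \<in> Obj C \<Longrightarrow> cmp \<alpha> x = cmp \<beta> x"
  shows "\<alpha> = (\<beta> :: ('o, 'a, 'p, 'b) ntrans)"
proof (rule ntrans.equality)
  show "cmp \<alpha> = cmp \<beta>"
    using nat_functors(4)[OF assms(1,3)] nat_functors(4)[OF assms(2,3)] assms(4)
    by (rule extensionalityI)
qed (use nat_functors[OF assms(1,3)] nat_functors[OF assms(2,3)] in auto)

lemma idN_simps: "NSrc (idN F) = F" "NTrg (idN F) = F"
  by (simp_all add: idN_def)

lemma cmp_idN: "is_functor C D F \<Longrightarrow> x \<in> Obj C \<Longrightarrow> cmp (idN F) x = Id D (fob F x)"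
  using functor_cats[of C D F] by (simp add: idN_def)

lemma is_nat_idN:
  assumes F: "is_functor C D F"
  shows "is_nat F F (idN F)"
proof (rule is_natI[OF F F])
  note c = functor_cats[OF F]
  show "cmp (idN F) x \<in> hom D (fob F x) (fob F x)" if "x \<in> Obj C" for x
    using Id_hom[OF c(2) fob_in[OF F that]] by (simp add: cmp_idN[OF F that])
  show "cmp (idN F) y \<cdot>\<^bsub>D\<^esub> far F f = far F f \<cdot>\<^bsub>D\<^esub> cmp (idN F) x" if f: "f \<in> hom C x y" for f x y
    using hom_objs[OF c(1) f] Comp_Id_left[OF c(2) far_hom[OF F f]]
      Comp_Id_right[OF c(2) far_hom[OF F f]]
    by (simp add: cmp_idN[OF F])
qed (use functor_cats[OF F] in \<open>simp_all add: idN_def\<close>)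

lemma is_nat_vcomp:
  assumes \<alpha>: "is_nat F G \<alpha>" and \<beta>: "is_nat G H \<beta>" and F: "is_functor C D F"
  shows "is_nat F H (vcomp \<beta> \<alpha>)"
proof -
  note G = nat_functors[OF \<alpha> F]
  note H = nat_functors[OF \<beta> G(1)]
  note c = functor_cats[OF F]
  show ?thesis
  proof (rule is_natI[OF F H(1)])
    show "cmp (vcomp \<beta> \<alpha>) x \<in> hom D (fob F x) (fob H x)" if "x \<in> Obj C" for x
      using that Comp_hom[OF c(2) nat_cmp[OF \<alpha> F that] nat_cmp[OF \<beta> G(1) that]]
      by (simp add: vcomp_def c G)
    show "cmp (vcomp \<beta> \<alpha>) y \<cdot>\<^bsub>D\<^esub> far F f = far H f \<cdot>\<^bsub>D\<^esub> cmp (vcomp \<beta> \<alpha>) x"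
      if f: "f \<in> hom C x y" for f x y
    proof -
      have x: "x \<in> Obj C" and y: "y \<in> Obj C"
        using hom_objs[OF c(1) f] by auto
      show ?thesis
        using Comp_assoc[OF c(2) far_hom[OF F f] nat_cmp[OF \<alpha> F y] nat_cmp[OF \<beta> G(1) y]]
          Comp_assoc[OF c(2) nat_cmp[OF \<alpha> F x] far_hom[OF G(1) f] nat_cmp[OF \<beta> G(1) y]]
          Comp_assoc[OF c(2) nat_cmp[OF \<alpha> F x] nat_cmp[OF \<beta> G(1) x] far_hom[OF H(1) f]]
          nat_naturality[OF \<alpha> F f] nat_naturality[OF \<beta> G(1) f] x y
        by (simp add: vcomp_def c G)
    qed
  qed (simp_all add: vcomp_def G H c)
qed

lemma cmp_vcomp:
  assumes "is_nat F G \<alpha>" "is_functor C D F" "x \<in> Obj C"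
  shows "cmp (vcomp \<beta> \<alpha>) x = cmp \<beta> x \<cdot>\<^bsub>D\<^esub> cmp \<alpha> x"
  using nat_functors[OF assms(1,2)] functor_cats[OF assms(2)] assms(3) by (simp add: vcomp_def)

lemma cmp_whisker_left:
  assumes \<alpha>: "is_nat F G \<alpha>" and F: "is_functor C D F" and H: "is_functor D E H" and x: "x \<in> Obj C"
  shows "cmp (hcomp (idN H) \<alpha>) x = far H (cmp \<alpha> x)"
proof -
  note n = nat_functors[OF \<alpha> F]
  note c = functor_cats[OF F] functor_cats[OF H]
  show ?thesis
    using Comp_Id_left[OF c(6) far_hom[OF H nat_cmp[OF \<alpha> F x]]] x fob_in[OF n(1) x]
    by (simp add: hcomp_def n(2,3) c(3,8) cmp_idN[OF H] idN_simps)
qed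

lemma cmp_whisker_right:
  assumes \<beta>: "is_nat G H \<beta>" and G: "is_functor D E G" and F: "is_functor C D F" and x: "x \<in> Obj C"
  shows "cmp (hcomp \<beta> (idN F)) x = cmp \<beta> (fob F x)"
proof -
  note n = nat_functors[OF \<beta> G]
  note c = functor_cats[OF F] functor_cats[OF G]
  have "far G (cmp (idN F) x) = Id E (fob G (fob F x))"
    using far_Id[OF G fob_in[OF F x]] by (simp add: cmp_idN[OF F x])
  then show ?thesis
    using Comp_Id_right[OF c(6) nat_cmp[OF \<beta> G fob_in[OF F x]]] x
    by (simp add: hcomp_def n(2,3) c(3,8) idN_simps)
qed

lemma is_nat_whisker_left:
  assumes \<alpha>: "is_nat F G \<alpha>" and F: "is_functor C D F" and H: "is_functor D E H"
  shows "is_nat (H \<odot> F) (H \<odot> G) (hcomp (idN H) \<alpha>)"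
proof -
  note n = nat_functors[OF \<alpha> F]
  note c = functor_cats[OF F] functor_cats[OF H]
  show ?thesis
  proof (rule is_natI[OF is_functor_compF[OF F H] is_functor_compF[OF n(1) H]])
    show "cmp (hcomp (idN H) \<alpha>) x \<in> hom E (fob (H \<odot> F) x) (fob (H \<odot> G) x)" if x: "x \<in> Obj C" for x
      using far_hom[OF H nat_cmp[OF \<alpha> F x]]
      by (simp add: cmp_whisker_left[OF \<alpha> F H x] fob_compF[OF F x] fob_compF[OF n(1) x])
    show "cmp (hcomp (idN H) \<alpha>) y \<cdot>\<^bsub>E\<^esub> far (H \<odot> F) f = far (H \<odot> G) f \<cdot>\<^bsub>E\<^esub> cmp (hcomp (idN H) \<alpha>) x"
      if f: "f \<in> hom C x y" for f x y
    proof -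
      have x: "x \<in> Obj C" and y: "y \<in> Obj C"
        using hom_objs[OF c(1) f] by auto
      show ?thesis
        using far_Comp[OF H far_hom[OF F f] nat_cmp[OF \<alpha> F y]]
          far_Comp[OF H nat_cmp[OF \<alpha> F x] far_hom[OF n(1) f]] nat_naturality[OF \<alpha> F f]
        by (simp add: cmp_whisker_left[OF \<alpha> F H] x y far_compF[OF F f] far_compF[OF n(1) f])
    qed
  qed (simp_all add: hcomp_def n(2,3) c(3) idN_simps)
qed

lemma is_nat_whisker_right:
  assumes \<beta>: "is_nat G H \<beta>" and G: "is_functor D E G" and F: "is_functor C D F"
  shows "is_nat (G \<odot> F) (H \<odot> F) (hcomp \<beta> (idN F))"
proof -
  note n = nat_functors[OF \<beta> G]
  note c = functor_cats[OF F] functor_cats[OF G]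
  show ?thesis
  proof (rule is_natI[OF is_functor_compF[OF F G] is_functor_compF[OF F n(1)]])
    show "cmp (hcomp \<beta> (idN F)) x \<in> hom E (fob (G \<odot> F) x) (fob (H \<odot> F) x)" if x: "x \<in> Obj C" for x
      using nat_cmp[OF \<beta> G fob_in[OF F x]]
      by (simp add: cmp_whisker_right[OF \<beta> G F x] fob_compF[OF F x])
    show "cmp (hcomp \<beta> (idN F)) y \<cdot>\<^bsub>E\<^esub> far (G \<odot> F) f = far (H \<odot> F) f \<cdot>\<^bsub>E\<^esub> cmp (hcomp \<beta> (idN F)) x"
      if f: "f \<in> hom C x y" for f x y
    proof -
      have x: "x \<in> Obj C" and y: "y \<in> Obj C"
        using hom_objs[OF c(1) f] by auto
      show ?thesis
        using nat_naturality[OF \<beta> G far_hom[OF F f]]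
        by (simp add: cmp_whisker_right[OF \<beta> G F] x y far_compF[OF F f])
    qed
  qed (simp_all add: hcomp_def n(2,3) c(3) idN_simps)
qed

section \<open>Couniversal and universal arrows\<close>

text \<open>A terminal object of the comma category of \<open>L\<close> over \<open>F\<close>,
  stated as representability of Hom(L Y, F). It is one value of a right adjoint together with its
  counit, and makes sense without a choice of adjoint functor.\<close>

definition couniversal :: "('o, 'a, 'p, 'b) fctr \<Rightarrow> 'p \<Rightarrow> 'o \<Rightarrow> 'b \<Rightarrow> bool" where
  "couniversal L F M \<epsilon> \<longleftrightarrow> M \<in> Obj (Src L) \<and> \<epsilon> \<in> hom (Trg L) (fob L M) F \<and>
     (\<forall>Y\<in>Obj (Src L). bij_betw (\<lambda>f. \<epsilon> \<cdot>\<^bsub>Trg L\<^esub> far L f) (hom (Src L) Y M) (hom (Trg L) (fob L Y) F))"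

text \<open>The dual notion, an initial object of the comma category of \<open>F\<close> under
  \<open>R\<close>: one value of a left adjoint together with its unit. It serves the part on
  derivators.\<close>

definition universal :: "('o, 'a, 'p, 'b) fctr \<Rightarrow> 'p \<Rightarrow> 'o \<Rightarrow> 'b \<Rightarrow> bool" where
  "universal R F M \<eta> \<longleftrightarrow> M \<in> Obj (Src R) \<and> \<eta> \<in> hom (Trg R) F (fob R M) \<and>
     (\<forall>Y\<in>Obj (Src R). bij_betw (\<lambda>f. far R f \<cdot>\<^bsub>Trg R\<^esub> \<eta>) (hom (Src R) M Y) (hom (Trg R) F (fob R Y)))"

lemma couniversalI:
  assumes "is_functor C D L" "M \<in> Obj C" "\<epsilon> \<in> hom D (fob L M) F"
    and "\<And>Y. Y \<in> Obj C \<Longrightarrow> bij_betw (\<lambda>f. \<epsilon> \<cdot>\<^bsub>D\<^esub> far L f) (hom C Y M) (hom D (fob L Y) F)"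
  shows "couniversal L F M \<epsilon>"
  using assms functor_cats(3,4)[OF assms(1)] by (simp add: couniversal_def)

lemma couniversalD:
  assumes "couniversal L F M \<epsilon>" "is_functor C D L"
  shows "M \<in> Obj C" "\<epsilon> \<in> hom D (fob L M) F"
    and "Y \<in> Obj C \<Longrightarrow> bij_betw (\<lambda>f. \<epsilon> \<cdot>\<^bsub>D\<^esub> far L f) (hom C Y M) (hom D (fob L Y) F)"
  using assms functor_cats(3,4)[OF assms(2)] by (simp_all add: couniversal_def)

lemma universalI:
  assumes "is_functor C D R" "M \<in> Obj C" "\<eta> \<in> hom D F (fob R M)"
    and "\<And>Y. Y \<in> Obj C \<Longrightarrow> bij_betw (\<lambda>f. far R f \<cdot>\<^bsub>D\<^esub> \<eta>) (hom C M Y) (hom D F (fob R Y))"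
  shows "universal R F M \<eta>"
  using assms functor_cats(3,4)[OF assms(1)] by (simp add: universal_def)

lemma universalD:
  assumes "universal R F M \<eta>" "is_functor C D R"
  shows "M \<in> Obj C" "\<eta> \<in> hom D F (fob R M)"
    and "Y \<in> Obj C \<Longrightarrow> bij_betw (\<lambda>f. far R f \<cdot>\<^bsub>D\<^esub> \<eta>) (hom C M Y) (hom D F (fob R Y))"
  using assms functor_cats(3,4)[OF assms(2)] by (simp_all add: universal_def)

lemma couniversal_factor:
  assumes "couniversal L F M \<epsilon>" "is_functor C D L" "Y \<in> Obj C" "g \<in> hom D (fob L Y) F"
  obtains f where "f \<in> hom C Y M" "\<epsilon> \<cdot>\<^bsub>D\<^esub> far L f = g"
proof -
  have "g \<in> (\<lambda>f. \<epsilon> \<cdot>\<^bsub>D\<^esub> far L f) ` hom C Y M"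
    using couniversalD(3)[OF assms(1-3)] assms(4) by (simp add: bij_betw_def)
  then show ?thesis
    using that by blast
qed

lemma couniversal_unique:
  assumes "couniversal L F M \<epsilon>" "is_functor C D L" "f \<in> hom C Y M" "f' \<in> hom C Y M"
    and "\<epsilon> \<cdot>\<^bsub>D\<^esub> far L f = \<epsilon> \<cdot>\<^bsub>D\<^esub> far L f'"
  shows "f = f'"
  using couniversalD(3)[OF assms(1,2) hom_objs(1)[OF functor_cats(1)[OF assms(2)] assms(3)]] assms(3-5)
  unfolding bij_betw_def inj_on_def by blast

lemma universal_factor:
  assumes "universal R F M \<eta>" "is_functor C D R" "Y \<in> Obj C" "g \<in> hom D F (fob R Y)"
  obtains f where "f \<in> hom C M Y" "far R f \<cdot>\<^bsub>D\<^esub> \<eta> = g"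
proof -
  have "g \<in> (\<lambda>f. far R f \<cdot>\<^bsub>D\<^esub> \<eta>) ` hom C M Y"
    using universalD(3)[OF assms(1-3)] assms(4) by (simp add: bij_betw_def)
  then show ?thesis
    using that by blast
qed

lemma universal_unique:
  assumes "universal R F M \<eta>" "is_functor C D R" "f \<in> hom C M Y" "f' \<in> hom C M Y"
    and "far R f \<cdot>\<^bsub>D\<^esub> \<eta> = far R f' \<cdot>\<^bsub>D\<^esub> \<eta>"
  shows "f = f'"
  using universalD(3)[OF assms(1,2) hom_objs(2)[OF functor_cats(1)[OF assms(2)] assms(3)]] assms(3-5)
  unfolding bij_betw_def inj_on_def by blast

text \<open>The usual argument for terminal objects: the factorisation \<open>g\<close> in the other
  direction is an inverse, since both composites factor a couniversal arrow through itself.\<close>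

lemma couniversal_compare:
  assumes M: "couniversal L F M \<epsilon>" and M': "couniversal L F M' \<epsilon>'" and L: "is_functor C D L"
    and f: "f \<in> hom C M M'" "\<epsilon>' \<cdot>\<^bsub>D\<^esub> far L f = \<epsilon>"
  shows "is_iso C f"
proof -
  note c = functor_cats[OF L]
  note m = couniversalD[OF M L] and m' = couniversalD[OF M' L]
  obtain g where g: "g \<in> hom C M' M" "\<epsilon> \<cdot>\<^bsub>D\<^esub> far L g = \<epsilon>'"
    using couniversal_factor[OF M L m'(1,2)] .
  have "g \<cdot>\<^bsub>C\<^esub> f = Id C M"
  proof (rule couniversal_unique[OF M L])
    show "\<epsilon> \<cdot>\<^bsub>D\<^esub> far L (g \<cdot>\<^bsub>C\<^esub> f) = \<epsilon> \<cdot>\<^bsub>D\<^esub> far L (Id C M)"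
      using Comp_assoc[OF c(2) far_hom[OF L f(1)] far_hom[OF L g(1)] m(2)] f g
        Comp_Id_right[OF c(2) m(2)]
      by (simp add: far_Comp[OF L f(1) g(1)] far_Id[OF L m(1)])
  qed (use c Comp_hom[OF c(1) f(1) g(1)] Id_hom[OF c(1) m(1)] in auto)
  moreover have "f \<cdot>\<^bsub>C\<^esub> g = Id C M'"
  proof (rule couniversal_unique[OF M' L])
    show "\<epsilon>' \<cdot>\<^bsub>D\<^esub> far L (f \<cdot>\<^bsub>C\<^esub> g) = \<epsilon>' \<cdot>\<^bsub>D\<^esub> far L (Id C M')"
      using Comp_assoc[OF c(2) far_hom[OF L g(1)] far_hom[OF L f(1)] m'(2)] f g
        Comp_Id_right[OF c(2) m'(2)]
      by (simp add: far_Comp[OF L g(1) f(1)] far_Id[OF L m'(1)])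
  qed (use c Comp_hom[OF c(1) g(1) f(1)] Id_hom[OF c(1) m'(1)] in auto)
  ultimately show ?thesis
    using is_isoI[OF f(1) g(1)] by blast
qed

lemma universal_compare:
  assumes M: "universal R F M \<eta>" and M': "universal R F M' \<eta>'" and R: "is_functor C D R"
    and f: "f \<in> hom C M' M" "far R f \<cdot>\<^bsub>D\<^esub> \<eta>' = \<eta>"
  shows "is_iso C f"
proof -
  note c = functor_cats[OF R]
  note m = universalD[OF M R] and m' = universalD[OF M' R]
  obtain g where g: "g \<in> hom C M M'" "far R g \<cdot>\<^bsub>D\<^esub> \<eta> = \<eta>'"
    using universal_factor[OF M R m'(1,2)] .
  have "g \<cdot>\<^bsub>C\<^esub> f = Id C M'"
  proof (rule universal_unique[OF M' R])
    show "far R (g \<cdot>\<^bsub>C\<^esub> f) \<cdot>\<^bsub>D\<^esub> \<eta>' = far R (Id C M') \<cdot>\<^bsub>D\<^esub> \<eta>'"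
      using Comp_assoc[OF c(2) m'(2) far_hom[OF R f(1)] far_hom[OF R g(1)]] f g
        Comp_Id_left[OF c(2) m'(2)]
      by (simp add: far_Comp[OF R f(1) g(1)] far_Id[OF R m'(1)])
  qed (use c Comp_hom[OF c(1) f(1) g(1)] Id_hom[OF c(1) m'(1)] in auto)
  moreover have "f \<cdot>\<^bsub>C\<^esub> g = Id C M"
  proof (rule universal_unique[OF M R])
    show "far R (f \<cdot>\<^bsub>C\<^esub> g) \<cdot>\<^bsub>D\<^esub> \<eta> = far R (Id C M) \<cdot>\<^bsub>D\<^esub> \<eta>"
      using Comp_assoc[OF c(2) m(2) far_hom[OF R g(1)] far_hom[OF R f(1)]] f g
        Comp_Id_left[OF c(2) m(2)]
      by (simp add: far_Comp[OF R g(1) f(1)] far_Id[OF R m(1)])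
  qed (use c Comp_hom[OF c(1) g(1) f(1)] Id_hom[OF c(1) m(1)] in auto)
  ultimately show ?thesis
    using is_isoI[OF f(1) g(1)] by blast
qed

lemma postcomp_iso_bij:
  assumes c: "category C" and f: "f \<in> hom C x y" and iso: "is_iso C f"
  shows "bij_betw (\<lambda>h. f \<cdot>\<^bsub>C\<^esub> h) (hom C z x) (hom C z y)"
proof -
  obtain g where g: "g \<in> hom C y x" "g \<cdot>\<^bsub>C\<^esub> f = Id C x" "f \<cdot>\<^bsub>C\<^esub> g = Id C y"
    using iso f by (rule is_isoE)
  show ?thesis
  proof (rule bij_betw_byWitness[where f' = "\<lambda>h. g \<cdot>\<^bsub>C\<^esub> h"])
    show "\<forall>h\<in>hom C z x. g \<cdot>\<^bsub>C\<^esub> (f \<cdot>\<^bsub>C\<^esub> h) = h"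
      using Comp_assoc[OF c _ f g(1), symmetric] Comp_Id_left[OF c] g(2) by simp
    show "\<forall>h\<in>hom C z y. f \<cdot>\<^bsub>C\<^esub> (g \<cdot>\<^bsub>C\<^esub> h) = h"
      using Comp_assoc[OF c _ g(1) f, symmetric] Comp_Id_left[OF c] g(3) by simp
    show "(\<lambda>h. f \<cdot>\<^bsub>C\<^esub> h) ` hom C z x \<subseteq> hom C z y"
      using Comp_hom[OF c _ f] by blast
    show "(\<lambda>h. g \<cdot>\<^bsub>C\<^esub> h) ` hom C z y \<subseteq> hom C z x"
      using Comp_hom[OF c _ g(1)] by blast
  qed
qed

lemma precomp_iso_bij:
  assumes c: "category C" and f: "f \<in> hom C x y" and iso: "is_iso C f"
  shows "bij_betw (\<lambda>h. h \<cdot>\<^bsub>C\<^esub> f) (hom C y z) (hom C x z)"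
proof -
  obtain g where g: "g \<in> hom C y x" "g \<cdot>\<^bsub>C\<^esub> f = Id C x" "f \<cdot>\<^bsub>C\<^esub> g = Id C y"
    using iso f by (rule is_isoE)
  show ?thesis
  proof (rule bij_betw_byWitness[where f' = "\<lambda>h. h \<cdot>\<^bsub>C\<^esub> g"])
    show "\<forall>h\<in>hom C y z. (h \<cdot>\<^bsub>C\<^esub> f) \<cdot>\<^bsub>C\<^esub> g = h"
      using Comp_assoc[OF c g(1) f] Comp_Id_right[OF c] g(3) by simp
    show "\<forall>h\<in>hom C x z. (h \<cdot>\<^bsub>C\<^esub> g) \<cdot>\<^bsub>C\<^esub> f = h"
      using Comp_assoc[OF c f g(1)] Comp_Id_right[OF c] g(2) by simp
    show "(\<lambda>h. h \<cdot>\<^bsub>C\<^esub> f) ` hom C y z \<subseteq> hom C x z"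
      using Comp_hom[OF c f] by blast
    show "(\<lambda>h. h \<cdot>\<^bsub>C\<^esub> g) ` hom C x z \<subseteq> hom C y z"
      using Comp_hom[OF c g(1)] by blast
  qed
qed

lemma couniversal_precomp_iso:
  assumes M': "couniversal L F M' \<epsilon>'" and L: "is_functor C D L"
    and f: "f \<in> hom C M M'" "is_iso C f"
  shows "couniversal L F M (\<epsilon>' \<cdot>\<^bsub>D\<^esub> far L f)"
proof (rule couniversalI[OF L])
  note c = functor_cats[OF L]
  note m' = couniversalD[OF M' L]
  show "M \<in> Obj C"
    using hom_objs(1)[OF c(1) f(1)] .
  show "\<epsilon>' \<cdot>\<^bsub>D\<^esub> far L f \<in> hom D (fob L M) F"
    using Comp_hom[OF c(2) far_hom[OF L f(1)] m'(2)] .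
  show "bij_betw (\<lambda>g. (\<epsilon>' \<cdot>\<^bsub>D\<^esub> far L f) \<cdot>\<^bsub>D\<^esub> far L g) (hom C Y M) (hom D (fob L Y) F)"
    if Y: "Y \<in> Obj C" for Y
  proof -
    have "bij_betw ((\<lambda>g. \<epsilon>' \<cdot>\<^bsub>D\<^esub> far L g) \<circ> (\<lambda>g. f \<cdot>\<^bsub>C\<^esub> g)) (hom C Y M) (hom D (fob L Y) F)"
      using postcomp_iso_bij[OF c(1) f] m'(3)[OF Y] by (rule bij_betw_trans)
    moreover have "((\<lambda>g. \<epsilon>' \<cdot>\<^bsub>D\<^esub> far L g) \<circ> (\<lambda>g. f \<cdot>\<^bsub>C\<^esub> g)) g = (\<epsilon>' \<cdot>\<^bsub>D\<^esub> far L f) \<cdot>\<^bsub>D\<^esub> far L g"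
      if "g \<in> hom C Y M" for g
      using Comp_assoc[OF c(2) far_hom[OF L that] far_hom[OF L f(1)] m'(2)]
      by (simp add: far_Comp[OF L that f(1)])
    ultimately show ?thesis
      by (simp cong: bij_betw_cong)
  qed
qed

lemma universal_postcomp_iso:
  assumes M': "universal R F M' \<eta>'" and R: "is_functor C D R"
    and f: "f \<in> hom C M' M" "is_iso C f"
  shows "universal R F M (far R f \<cdot>\<^bsub>D\<^esub> \<eta>')"
proof (rule universalI[OF R])
  note c = functor_cats[OF R]
  note m' = universalD[OF M' R]
  show "M \<in> Obj C"
    using hom_objs(2)[OF c(1) f(1)] .
  show "far R f \<cdot>\<^bsub>D\<^esub> \<eta>' \<in> hom D F (fob R M)"
    using Comp_hom[OF c(2) m'(2) far_hom[OF R f(1)]] .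
  show "bij_betw (\<lambda>g. far R g \<cdot>\<^bsub>D\<^esub> (far R f \<cdot>\<^bsub>D\<^esub> \<eta>')) (hom C M Y) (hom D F (fob R Y))"
    if Y: "Y \<in> Obj C" for Y
  proof -
    have "bij_betw ((\<lambda>g. far R g \<cdot>\<^bsub>D\<^esub> \<eta>') \<circ> (\<lambda>g. g \<cdot>\<^bsub>C\<^esub> f)) (hom C M Y) (hom D F (fob R Y))"
      using precomp_iso_bij[OF c(1) f] m'(3)[OF Y] by (rule bij_betw_trans)
    moreover have "((\<lambda>g. far R g \<cdot>\<^bsub>D\<^esub> \<eta>') \<circ> (\<lambda>g. g \<cdot>\<^bsub>C\<^esub> f)) g = far R g \<cdot>\<^bsub>D\<^esub> (far R f \<cdot>\<^bsub>D\<^esub> \<eta>')"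
      if "g \<in> hom C M Y" for g
      using Comp_assoc[OF c(2) m'(2) far_hom[OF R f(1)] far_hom[OF R that]]
      by (simp add: far_Comp[OF R f(1) that])
    ultimately show ?thesis
      by (simp cong: bij_betw_cong)
  qed
qed

text \<open>One direction is uniqueness of couniversal arrows, the other their stability under
  precomposition with an isomorphism. Applied to a counit, this trades invertibility of a morphism
  for a property of its transpose.\<close>

lemma couniversal_iff_iso:
  assumes M': "couniversal L F M' \<epsilon>'" and L: "is_functor C D L"
    and f: "f \<in> hom C M M'" "\<epsilon>' \<cdot>\<^bsub>D\<^esub> far L f = \<epsilon>"
  shows "couniversal L F M \<epsilon> \<longleftrightarrow> is_iso C f"
  using couniversal_compare[OF _ M' L f] couniversal_precomp_iso[OF M' L f(1)] f(2) by auto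

text \<open>Chaining the two representability bijections gives the objectwise form of the fact that
  right adjoints compose; the new arrow is the counit of the composite adjunction.\<close>

lemma couniversal_compF:
  assumes M: "couniversal L F M \<epsilon>" and L: "is_functor C D L"
    and N: "couniversal K M N \<delta>" and K: "is_functor B C K"
  shows "couniversal (L \<odot> K) F N (\<epsilon> \<cdot>\<^bsub>D\<^esub> far L \<delta>)"
proof (rule couniversalI[OF is_functor_compF[OF K L]])
  note c = functor_cats[OF L]
  note m = couniversalD[OF M L] and n = couniversalD[OF N K]
  show "N \<in> Obj B"
    using n(1) .
  show "\<epsilon> \<cdot>\<^bsub>D\<^esub> far L \<delta> \<in> hom D (fob (L \<odot> K) N) F"
    using Comp_hom[OF c(2) far_hom[OF L n(2)] m(2)] by (simp add: fob_compF[OF K n(1)])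
  show "bij_betw (\<lambda>g. (\<epsilon> \<cdot>\<^bsub>D\<^esub> far L \<delta>) \<cdot>\<^bsub>D\<^esub> far (L \<odot> K) g) (hom B Y N) (hom D (fob (L \<odot> K) Y) F)"
    if Y: "Y \<in> Obj B" for Y
  proof -
    have "bij_betw ((\<lambda>g. \<epsilon> \<cdot>\<^bsub>D\<^esub> far L g) \<circ> (\<lambda>g. \<delta> \<cdot>\<^bsub>C\<^esub> far K g)) (hom B Y N) (hom D (fob L (fob K Y)) F)"
      using n(3)[OF Y] m(3)[OF fob_in[OF K Y]] by (rule bij_betw_trans)
    moreover have "((\<lambda>g. \<epsilon> \<cdot>\<^bsub>D\<^esub> far L g) \<circ> (\<lambda>g. \<delta> \<cdot>\<^bsub>C\<^esub> far K g)) g = (\<epsilon> \<cdot>\<^bsub>D\<^esub> far L \<delta>) \<cdot>\<^bsub>D\<^esub> far (L \<odot> K) g"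
      if g: "g \<in> hom B Y N" for g
      using Comp_assoc[OF c(2) far_hom[OF L far_hom[OF K g]] far_hom[OF L n(2)] m(2)]
      by (simp add: far_Comp[OF L far_hom[OF K g] n(2)] far_compF[OF K g])
    ultimately show ?thesis
      unfolding fob_compF[OF K Y] by (simp cong: bij_betw_cong)
  qed
qed

section \<open>Adjunctions and transposition\<close>

lemma adjunctionD:
  assumes "adjunction L R \<eta> \<epsilon>" "is_functor C D L"
  shows "is_functor D C R \<and> is_nat (idF C) (R \<odot> L) \<eta> \<and> is_nat (L \<odot> R) (idF D) \<epsilon> \<and>
     (\<forall>x\<in>Obj C. cmp \<epsilon> (fob L x) \<cdot>\<^bsub>D\<^esub> far L (cmp \<eta> x) = Id D (fob L x)) \<and>
     (\<forall>y\<in>Obj D. far R (cmp \<epsilon> y) \<cdot>\<^bsub>C\<^esub> cmp \<eta> (fob R y) = Id C (fob R y))"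
proof -
  obtain C' D' where *: "is_functor C' D' L" and nat:
    "is_functor D' C' R \<and> is_nat (idF C') (R \<odot> L) \<eta> \<and> is_nat (L \<odot> R) (idF D') \<epsilon> \<and>
     (\<forall>x\<in>Obj C'. cmp \<epsilon> (fob L x) \<cdot>\<^bsub>D'\<^esub> far L (cmp \<eta> x) = Id D' (fob L x)) \<and>
     (\<forall>y\<in>Obj D'. far R (cmp \<epsilon> y) \<cdot>\<^bsub>C'\<^esub> cmp \<eta> (fob R y) = Id C' (fob R y))"
    using assms(1) unfolding adjunction_def by blast
  have "C' = C" "D' = D"
    using functor_cats(3,4)[OF assms(2)] functor_cats(3,4)[OF *] by simp_all
  then show ?thesis
    using nat by simp
qed

locale adj =
  fixes L :: "('o, 'a, 'p, 'b) fctr" and R \<eta> \<epsilon> C D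
  assumes adj: "adjunction L R \<eta> \<epsilon>" and L: "is_functor C D L"
begin

lemma R: "is_functor D C R"
  and unit: "is_nat (idF C) (R \<odot> L) \<eta>"
  and counit: "is_nat (L \<odot> R) (idF D) \<epsilon>"
  and triangle_L: "x \<in> Obj C \<Longrightarrow> cmp \<epsilon> (fob L x) \<cdot>\<^bsub>D\<^esub> far L (cmp \<eta> x) = Id D (fob L x)"
  and triangle_R: "y \<in> Obj D \<Longrightarrow> far R (cmp \<epsilon> y) \<cdot>\<^bsub>C\<^esub> cmp \<eta> (fob R y) = Id C (fob R y)"
  using adjunctionD[OF adj L] by blast+

lemma cats: "category C" "category D"
  using functor_cats[OF L] by auto

lemma unit_hom: "x \<in> Obj C \<Longrightarrow> cmp \<eta> x \<in> hom C x (fob R (fob L x))"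
  using nat_cmp[OF unit is_functor_idF[OF cats(1)]] by (simp add: idF_simps(1) fob_compF[OF L])

lemma counit_hom: "y \<in> Obj D \<Longrightarrow> cmp \<epsilon> y \<in> hom D (fob L (fob R y)) y"
  using nat_cmp[OF counit is_functor_compF[OF R L]] by (simp add: idF_simps(1) fob_compF[OF R])

lemma unit_naturality:
  assumes "f \<in> hom C x y"
  shows "cmp \<eta> y \<cdot>\<^bsub>C\<^esub> f = far R (far L f) \<cdot>\<^bsub>C\<^esub> cmp \<eta> x"
  using nat_naturality[OF unit is_functor_idF[OF cats(1)] assms]
  by (simp add: idF_simps(2)[OF assms] far_compF[OF L assms])

lemma counit_naturality:
  assumes "f \<in> hom D x y"
  shows "cmp \<epsilon> y \<cdot>\<^bsub>D\<^esub> far L (far R f) = f \<cdot>\<^bsub>D\<^esub> cmp \<epsilon> x"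
  using nat_naturality[OF counit is_functor_compF[OF R L] assms]
  by (simp add: idF_simps(2)[OF assms] far_compF[OF R assms])

lemma transpose_hom:
  assumes "x \<in> Obj C" "k \<in> hom D (fob L x) y"
  shows "far R k \<cdot>\<^bsub>C\<^esub> cmp \<eta> x \<in> hom C x (fob R y)"
  using Comp_hom[OF cats(1) unit_hom[OF assms(1)] far_hom[OF R assms(2)]] .

lemma counit_transpose:
  assumes x: "x \<in> Obj C" and k: "k \<in> hom D (fob L x) y"
  shows "cmp \<epsilon> y \<cdot>\<^bsub>D\<^esub> far L (far R k \<cdot>\<^bsub>C\<^esub> cmp \<eta> x) = k"
proof -
  have y: "y \<in> Obj D"
    using hom_objs(2)[OF cats(2) k] .
  have "far L (far R k \<cdot>\<^bsub>C\<^esub> cmp \<eta> x) = far L (far R k) \<cdot>\<^bsub>D\<^esub> far L (cmp \<eta> x)"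
    using far_Comp[OF L unit_hom[OF x] far_hom[OF R k]] .
  then show ?thesis
    using Comp_assoc[OF cats(2) far_hom[OF L unit_hom[OF x]] far_hom[OF L far_hom[OF R k]] counit_hom[OF y]]
      Comp_assoc[OF cats(2) far_hom[OF L unit_hom[OF x]] counit_hom[OF fob_in[OF L x]] k]
      counit_naturality[OF k] triangle_L[OF x] Comp_Id_right[OF cats(2) k]
    by simp
qed

lemma transpose_counit:
  assumes f: "f \<in> hom C x (fob R y)" and y: "y \<in> Obj D"
  shows "far R (cmp \<epsilon> y \<cdot>\<^bsub>D\<^esub> far L f) \<cdot>\<^bsub>C\<^esub> cmp \<eta> x = f"
proof -
  have x: "x \<in> Obj C"
    using hom_objs(1)[OF cats(1) f] .
  have "far R (cmp \<epsilon> y \<cdot>\<^bsub>D\<^esub> far L f) = far R (cmp \<epsilon> y) \<cdot>\<^bsub>C\<^esub> far R (far L f)"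
    using far_Comp[OF R far_hom[OF L f] counit_hom[OF y]] .
  then show ?thesis
    using Comp_assoc[OF cats(1) unit_hom[OF x] far_hom[OF R far_hom[OF L f]] far_hom[OF R counit_hom[OF y]]]
      Comp_assoc[OF cats(1) f unit_hom[OF fob_in[OF R y]] far_hom[OF R counit_hom[OF y]]]
      unit_naturality[OF f] triangle_R[OF y] Comp_Id_left[OF cats(1) f]
    by simp
qed

text \<open>The inverse bijection is transposition by the unit; each of the two triangle identities
  accounts for one of the two composites.\<close>

lemma couniversal_counit:
  assumes y: "y \<in> Obj D"
  shows "couniversal L y (fob R y) (cmp \<epsilon> y)"
proof (rule couniversalI[OF L fob_in[OF R y] counit_hom[OF y]])
  fix x assume x: "x \<in> Obj C"
  show "bij_betw (\<lambda>f. cmp \<epsilon> y \<cdot>\<^bsub>D\<^esub> far L f) (hom C x (fob R y)) (hom D (fob L x) y)"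
    by (rule bij_betw_byWitness[where f' = "\<lambda>k. far R k \<cdot>\<^bsub>C\<^esub> cmp \<eta> x"])
      (use transpose_counit[OF _ y] counit_transpose[OF x] transpose_hom[OF x]
        Comp_hom[OF cats(2) far_hom[OF L] counit_hom[OF y]] in auto)
qed

lemma universal_unit:
  assumes x: "x \<in> Obj C"
  shows "universal R x (fob L x) (cmp \<eta> x)"
proof (rule universalI[OF R fob_in[OF L x] unit_hom[OF x]])
  fix y assume y: "y \<in> Obj D"
  show "bij_betw (\<lambda>k. far R k \<cdot>\<^bsub>C\<^esub> cmp \<eta> x) (hom D (fob L x) y) (hom C x (fob R y))"
    by (rule bij_betw_byWitness[where f' = "\<lambda>f. cmp \<epsilon> y \<cdot>\<^bsub>D\<^esub> far L f"])
      (use transpose_counit[OF _ y] counit_transpose[OF x] transpose_hom[OF x]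
        Comp_hom[OF cats(2) far_hom[OF L] counit_hom[OF y]] in auto)
qed

end

text \<open>For a left adjoint of an inverse image functor only the right-hand functor is known in
  advance; its \<open>Src\<close> and \<open>Trg\<close> fix the categories of
  \<open>L\<close>.\<close>

lemma adj_right:
  assumes "adjunction L R \<eta> \<epsilon>" "is_functor D C R"
  shows "adj L R \<eta> \<epsilon> C D"
proof -
  obtain C' D' where *: "is_functor C' D' L" "is_functor D' C' R"
    using assms(1) unfolding adjunction_def by blast
  then have "is_functor C D L"
    using functor_cats(3,4)[OF assms(2)] functor_cats(3,4)[OF *(2)] by simp
  then show ?thesis
    using assms(1) by unfold_locales
qed

section \<open>Small sets and pairs\<close>

lemma small_set_subset:
  assumes "small_set X" "Y \<subseteq> X"
  shows "small_set Y"
proof -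
  obtain x where "Y \<subseteq> elts x"
    using assms unfolding small_set_def by auto
  then show ?thesis
    unfolding small_set_def by (rule universe_subset)
qed

lemma small_set_pair: "small_set {x, y}"
  unfolding small_set_def by (rule universe_pairing)

lemma small_set_singleton: "small_set {x}"
  using small_set_pair[of x x] by simp

lemma elts_vset:
  assumes "small_set X"
  shows "elts (vset X) = X"
proof -
  obtain x where x: "elts x = X"
    using assms unfolding small_set_def by blast
  have "vset X = x"
    unfolding vset_def using x by (intro the_equality universe_ext) simp_all
  then show ?thesis
    using x by simp
qed

text \<open>The universe axiom takes unions of families of elements, so each set \<open>X i\<close>
  is first coded as the element \<open>vset (X i)\<close>.\<close>

lemma small_set_UN:
  fixes X :: "'v::universe \<Rightarrow> 'v set"
  assumes "small_set I" "\<And>i. i \<in> I \<Longrightarrow> small_set (X i)"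
  shows "small_set (\<Union>i\<in>I. X i)"
proof -
  obtain x where x: "elts x = I"
    using assms(1) unfolding small_set_def by blast
  obtain y where "elts y = (\<Union>i\<in>elts x. elts (vset (X i)))"
    using universe_union[where x = x and f = "\<lambda>i. vset (X i)"] by blast
  then have "elts y = (\<Union>i\<in>I. X i)"
    using assms(2) x by (simp add: elts_vset)
  then show ?thesis
    unfolding small_set_def by blast
qed

text \<open>Replacement, obtained as a small union of singletons.\<close>

lemma small_set_image: "small_set I \<Longrightarrow> small_set (h ` I)" for h :: "'v::universe \<Rightarrow> 'v"
  using small_set_UN[of I "\<lambda>i. {h i}", OF _ small_set_singleton] by (simp add: UNION_singleton_eq_range)

lemma small_set_Times:
  fixes h :: "'v::universe \<Rightarrow> 'v \<Rightarrow> 'v"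
  assumes "small_set X" "small_set Y"
  shows "small_set {h x y | x y. x \<in> X \<and> y \<in> Y}"
proof -
  have eq: "{h x y | x y. x \<in> X \<and> y \<in> Y} = (\<Union>x\<in>X. h x ` Y)"
    by auto
  show ?thesis
    unfolding eq by (rule small_set_UN[OF assms(1)], rule small_set_image[OF assms(2)])
qed

lemma vset_eqD: "vset X = vset Y \<Longrightarrow> small_set X \<Longrightarrow> small_set Y \<Longrightarrow> X = Y"
  by (drule arg_cong[of _ _ elts]) (simp only: elts_vset)

text \<open>\<open>vset\<close> is injective on small sets, so equality of Kuratowski pairs reduces
  to equality of doubletons. The crossed matching forces all entries to coincide.\<close>

lemma vpair_eq_iff [simp]: "vpair x y = vpair x' y' \<longleftrightarrow> x = x' \<and> y = y'"
proof
  assume "vpair x y = vpair x' y'"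
  then have "{vset {x}, vset {x, y}} = {vset {x'}, vset {x', y'}}"
    unfolding vpair_def by (rule vset_eqD[OF _ small_set_pair small_set_pair])
  then consider "vset {x} = vset {x'}" "vset {x, y} = vset {x', y'}"
    | "vset {x} = vset {x', y'}" "vset {x, y} = vset {x'}"
    unfolding doubleton_eq_iff by blast
  then show "x = x' \<and> y = y'"
  proof cases
    case 1
    then show ?thesis
      using vset_eqD[OF 1(1) small_set_singleton small_set_singleton]
        vset_eqD[OF 1(2) small_set_pair small_set_pair] by (auto simp: doubleton_eq_iff)
  next
    case 2
    then show ?thesis
      using vset_eqD[OF 2(1) small_set_singleton small_set_pair]
        vset_eqD[OF 2(2) small_set_pair small_set_singleton] by auto
  qed
qed simp

lemma vfst_vpair [simp]: "vfst (vpair x y) = x"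
  by (simp add: vfst_def)

lemma vsnd_vpair [simp]: "vsnd (vpair x y) = y"
  by (simp add: vsnd_def)

lemma tri_eq_iff [simp]: "tri x f y = tri x' f' y' \<longleftrightarrow> x = x' \<and> f = f' \<and> y = y'"
  by (simp add: tri_def)

lemma tri_simps [simp]:
  "tri_src (tri x f y) = x" "tri_lab (tri x f y) = f" "tri_trg (tri x f y) = y"
  by (simp_all add: tri_def tri_src_def tri_lab_def tri_trg_def)

section \<open>The terminal category\<close>

lemma hom_terminal: "hom terminal_cat vzero vzero = {vzero}"
  by (auto simp: hom_def terminal_cat_def)

lemma small_cat_terminal: "small_cat terminal_cat"
  by (auto simp: small_cat_def terminal_cat_def category_def hom_def small_set_singleton)

lemma category_terminal: "category terminal_cat"
  by (rule conjunct1[OF small_cat_terminal[unfolded small_cat_def]])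

lemma terminal_simps:
  "Obj terminal_cat = {vzero}" "Arr terminal_cat = {vzero}" "Id terminal_cat vzero = vzero"
  by (simp_all add: terminal_cat_def)

lemma small_functorD:
  assumes "small_functor A B u"
  shows "small_cat A" "small_cat B" "is_functor A B u" "category A" "category B" "Src u = A" "Trg u = B"
  using assms functor_cats[of A B u] by (auto simp: small_functor_def)

lemma small_functor_compF: "small_functor A B u \<Longrightarrow> small_functor B C v \<Longrightarrow> small_functor A C (v \<odot> u)"
  using is_functor_compF by (auto simp: small_functor_def)

lemma Comp_terminal: "vzero \<cdot>\<^bsub>terminal_cat\<^esub> vzero = vzero"
  by (simp add: terminal_cat_def)

lemma small_functor_to_terminal:
  assumes "small_cat A"
  shows "small_functor A terminal_cat (to_terminal A)"
proof -
  have A: "category A"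
    using assms by (simp add: small_cat_def)
  note T = category_terminal
  have ob: "Dom A f \<in> Obj A" "Cod A f \<in> Obj A" if "f \<in> Arr A" for f
    using A that by (auto simp: category_def)
  have co: "g \<cdot>\<^bsub>A\<^esub> f \<in> Arr A" if "f \<in> Arr A" "g \<in> Arr A" "Cod A f = Dom A g" for f g
    using Comp_hom[OF A, of f _ _ g] that by (simp add: hom_def)
  have "is_functor A terminal_cat (to_terminal A)"
    using A T ob co Id_hom[OF A]
    by (simp add: is_functor_def to_terminal_def hom_terminal terminal_simps Comp_terminal hom_def[of A])
  then show ?thesis
    using assms small_cat_terminal by (simp add: small_functor_def)
qed

lemma functor_to_terminal:
  assumes "is_functor A terminal_cat F"
  shows "F = to_terminal A"
proof -
  have fo: "fob F \<in> Obj A \<rightarrow>\<^sub>E {vzero}"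
    using assms by (simp add: is_functor_def terminal_simps)
  have fa: "far F \<in> Arr A \<rightarrow>\<^sub>E {vzero}"
  proof (rule PiE_I)
    fix f assume "f \<in> Arr A"
    then have "f \<in> hom A (Dom A f) (Cod A f)"
      by (simp add: hom_def)
    then show "far F f \<in> {vzero}"
      using homD(1)[OF far_hom[OF assms]] by (simp add: terminal_simps)
  next
    show "far F f = undefined" if "f \<notin> Arr A" for f
      using assms that by (simp add: is_functor_def extensional_def)
  qed
  have "fob F = (\<lambda>x\<in>Obj A. vzero)" "far F = (\<lambda>f\<in>Arr A. vzero)"
    using fo fa by (auto simp: fun_eq_iff PiE_iff extensional_def)
  then show ?thesis
    using functor_cats[OF assms] by (simp add: to_terminal_def)
qed

lemma small_functor_point:
  fixes B :: "'v::universe scat"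
  assumes "small_cat B" "b \<in> Obj B"
  shows "small_functor terminal_cat B (point B b)"
proof -
  have B: "category B"
    using assms by (simp add: small_cat_def)
  note T = category_terminal[where 'a = 'v]
  have "Dom terminal_cat vzero = (vzero :: 'v)" "Cod terminal_cat vzero = (vzero :: 'v)"
    by (simp_all add: terminal_cat_def)
  then have "is_functor terminal_cat B (point B b)"
    using B T assms(2) Id_hom[OF B assms(2)] Comp_Id_left[OF B Id_hom[OF B assms(2)]]
    by (simp add: is_functor_def point_def terminal_simps Comp_terminal)
  then show ?thesis
    using assms small_cat_terminal by (simp add: small_functor_def)
qed

lemma point_simps: "fob (point B b) vzero = b" "far (point B b) vzero = Id B b"
  by (simp_all add: point_def)

lemma functor_from_terminal:
  assumes F: "is_functor terminal_cat B F" and B: "small_cat B"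
  shows "F = point B (fob F vzero)"
proof (rule functor_eqI[OF F])
  have "fob F vzero \<in> Obj B"
    using fob_in[OF F] by (simp add: terminal_simps)
  then show "is_functor terminal_cat B (point B (fob F vzero))"
    using small_functor_point[OF B] small_functorD by blast
  show "far F f = far (point B (fob F vzero)) f" if "f \<in> Arr terminal_cat" for f
    using that far_Id[OF F, of vzero] by (simp add: terminal_simps point_simps)
qed (simp add: terminal_simps point_simps)

text \<open>An equality of functors, not just an isomorphism: a prederivator turns it into the
  equality of restriction at \<open>u(a)\<close> with u^* followed by restriction at
  \<open>a\<close>.\<close>

lemma compF_point:
  assumes "small_functor A B u" "a \<in> Obj A"
  shows "u \<odot> point A a = point B (fob u a)"
proof -
  note u = small_functorD[OF assms(1)]
  note p = small_functor_point[OF u(1) assms(2)]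
  have "u \<odot> point A a = point B (fob (u \<odot> point A a) vzero)"
    using functor_from_terminal[OF small_functorD(3)[OF small_functor_compF[OF p assms(1)]] u(2)] .
  then show ?thesis
    by (simp add: fob_compF[OF small_functorD(3)[OF p]] terminal_simps point_simps)
qed

text \<open>With p and q the functors to e, strict functoriality turns this into p^* = u^* q^*, so
  constant diagrams restrict to constant diagrams without coherence isomorphisms.\<close>

lemma to_terminal_compF:
  assumes "small_functor A B u"
  shows "to_terminal B \<odot> u = to_terminal A"
  using functor_to_terminal small_functorD(3)
    small_functor_compF[OF assms small_functor_to_terminal[OF small_functorD(2)[OF assms]]] by blast

section \<open>Comma categories\<close>

text \<open>What slices and coslices have in common: objects lie over objects of \<open>A\<close>
  through \<open>vfst\<close>, and arrows are triples over arrows of \<open>A\<close>, closed under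
  identities and composition. The category laws then come from those of \<open>A\<close>, whatever
  condition cuts out \<open>X\<close> and \<open>K\<close>.\<close>

locale triples =
  fixes A :: "'v::universe scat" and X K
  assumes base: "category A"
    and obj: "x \<in> X \<Longrightarrow> vfst x \<in> Obj A"
    and arr: "k \<in> K \<Longrightarrow> \<exists>x f y. k = tri x f y \<and> x \<in> X \<and> y \<in> X \<and> f \<in> hom A (vfst x) (vfst y)"
    and ident: "x \<in> X \<Longrightarrow> tri x (Id A (vfst x)) x \<in> K"
    and composite: "tri x f y \<in> K \<Longrightarrow> tri y g z \<in> K \<Longrightarrow> tri x (g \<cdot>\<^bsub>A\<^esub> f) z \<in> K"
begin

lemma triD:
  assumes "tri x f y \<in> K"
  shows "x \<in> X" "y \<in> X" "f \<in> hom A (vfst x) (vfst y)"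
  using arr[OF assms] by auto

lemma hom_triples: "hom (triple_cat A X K) x y = {tri x f y | f. tri x f y \<in> K}"
  using arr by (fastforce simp: hom_def triple_cat_def)

lemma Obj_triples: "Obj (triple_cat A X K) = X"
  and Arr_triples: "Arr (triple_cat A X K) = K"
  by (simp_all add: triple_cat_def)

lemma Id_triples: "x \<in> X \<Longrightarrow> Id (triple_cat A X K) x = tri x (Id A (vfst x)) x"
  by (simp add: triple_cat_def)

lemma Comp_triples: "tri x f y \<in> K \<Longrightarrow> tri y g z \<in> K \<Longrightarrow>
    tri y g z \<cdot>\<^bsub>triple_cat A X K\<^esub> tri x f y = tri x (g \<cdot>\<^bsub>A\<^esub> f) z"
  by (simp add: triple_cat_def)

lemma ArrE:
  assumes "k \<in> K"
  obtains x f y where "k = tri x f y" "tri x f y \<in> K" "x \<in> X" "y \<in> X" "f \<in> hom A (vfst x) (vfst y)"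
  using assms arr by blast

lemma category_triples: "category (triple_cat A X K)" (is "category ?T")
proof -
  have Dom: "Dom ?T (tri x f y) = x" and Cod: "Cod ?T (tri x f y) = y" if "tri x f y \<in> K" for x f y
    using that by (simp_all add: triple_cat_def)
  show ?thesis
    unfolding category_def
  proof (intro conjI allI impI ballI)
    show "Dom ?T \<in> Arr ?T \<rightarrow>\<^sub>E Obj ?T" "Cod ?T \<in> Arr ?T \<rightarrow>\<^sub>E Obj ?T"
      using arr by (force simp: triple_cat_def)+
    show "Id ?T \<in> extensional (Obj ?T)"
      by (simp add: triple_cat_def)
    show "Id ?T x \<in> hom ?T x x" if "x \<in> Obj ?T" for x
      using that ident by (simp add: hom_triples Id_triples Obj_triples)
    show "g \<cdot>\<^bsub>?T\<^esub> f = undefined" if "\<not> (f \<in> Arr ?T \<and> g \<in> Arr ?T \<and> Cod ?T f = Dom ?T g)" for f g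
      using that by (auto simp: triple_cat_def)
    show "g \<cdot>\<^bsub>?T\<^esub> f \<in> hom ?T (Dom ?T f) (Cod ?T g)"
      if fg: "f \<in> Arr ?T" "g \<in> Arr ?T" "Cod ?T f = Dom ?T g" for f g
    proof -
      obtain x p y where f: "f = tri x p y" "tri x p y \<in> K"
        using fg(1) unfolding Arr_triples by (rule ArrE)
      obtain y' q z where g: "g = tri y' q z" "tri y' q z \<in> K"
        using fg(2) unfolding Arr_triples by (rule ArrE)
      show ?thesis
        using f g fg(3) composite[of x p y q z] by (simp add: hom_triples Dom Cod Comp_triples)
    qed
    show "f \<cdot>\<^bsub>?T\<^esub> Id ?T (Dom ?T f) = f" "Id ?T (Cod ?T f) \<cdot>\<^bsub>?T\<^esub> f = f" if f: "f \<in> Arr ?T" for f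
    proof -
      obtain x p y where f: "f = tri x p y" "tri x p y \<in> K" "x \<in> X" "y \<in> X" "p \<in> hom A (vfst x) (vfst y)"
        using f unfolding Arr_triples by (rule ArrE)
      show "f \<cdot>\<^bsub>?T\<^esub> Id ?T (Dom ?T f) = f" "Id ?T (Cod ?T f) \<cdot>\<^bsub>?T\<^esub> f = f"
        using f ident[OF f(3)] ident[OF f(4)] Comp_Id_left[OF base f(5)] Comp_Id_right[OF base f(5)]
        by (simp_all add: Dom Cod Comp_triples Id_triples)
    qed
    show "h \<cdot>\<^bsub>?T\<^esub> (g \<cdot>\<^bsub>?T\<^esub> f) = (h \<cdot>\<^bsub>?T\<^esub> g) \<cdot>\<^bsub>?T\<^esub> f"
      if fgh: "f \<in> Arr ?T" "g \<in> Arr ?T" "h \<in> Arr ?T" "Cod ?T f = Dom ?T g \<and> Cod ?T g = Dom ?T h" for f g h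
    proof -
      obtain x p y where f: "f = tri x p y" "tri x p y \<in> K" "p \<in> hom A (vfst x) (vfst y)"
        using fgh(1) unfolding Arr_triples by (rule ArrE)
      obtain y' q z where g: "g = tri y' q z" "tri y' q z \<in> K" "q \<in> hom A (vfst y') (vfst z)"
        using fgh(2) unfolding Arr_triples by (rule ArrE)
      obtain z' r t where h: "h = tri z' r t" "tri z' r t \<in> K" "r \<in> hom A (vfst z') (vfst t)"
        using fgh(3) unfolding Arr_triples by (rule ArrE)
      have eq: "y' = y" "z' = z"
        using fgh(4) f(1,2) g(1,2) h(1,2) by (simp_all add: Dom Cod)
      show ?thesis
        using f g h unfolding eq
        by (simp add: Comp_triples composite[OF f(2) g(2)[unfolded eq]]
            composite[OF g(2)[unfolded eq] h(2)[unfolded eq]]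
            Comp_assoc[OF base f(3) g(3)[unfolded eq] h(3)[unfolded eq]])
    qed
  qed
qed

text \<open>Functors out of a comma category are checked on explicit triples, whose source and
  target can be read off the encoding.\<close>

lemma is_functor_from_triples:
  assumes "category E" "Src F = triple_cat A X K" "Trg F = E"
    and "fob F \<in> X \<rightarrow>\<^sub>E Obj E" "far F \<in> extensional K"
    and hom: "\<And>x f y. tri x f y \<in> K \<Longrightarrow> far F (tri x f y) \<in> hom E (fob F x) (fob F y)"
    and id: "\<And>x. x \<in> X \<Longrightarrow> far F (tri x (Id A (vfst x)) x) = Id E (fob F x)"
    and comp: "\<And>x f y g z. tri x f y \<in> K \<Longrightarrow> tri y g z \<in> K \<Longrightarrow>
      far F (tri x (g \<cdot>\<^bsub>A\<^esub> f) z) = far F (tri y g z) \<cdot>\<^bsub>E\<^esub> far F (tri x f y)"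
  shows "is_functor (triple_cat A X K) E F"
  unfolding is_functor_def
proof (intro conjI ballI impI)
  let ?T = "triple_cat A X K"
  have Dom: "Dom ?T (tri x f y) = x" and Cod: "Cod ?T (tri x f y) = y" if "tri x f y \<in> K" for x f y
    using that by (simp_all add: triple_cat_def)
  show "far F f \<in> hom E (fob F (Dom ?T f)) (fob F (Cod ?T f))" if f: "f \<in> Arr ?T" for f
  proof -
    obtain x p y where "f = tri x p y" "tri x p y \<in> K"
      using f unfolding Arr_triples by (rule ArrE)
    then show ?thesis
      using hom by (simp add: Dom Cod)
  qed
  show "far F (Id ?T x) = Id E (fob F x)" if "x \<in> Obj ?T" for x
    using that id by (simp add: Obj_triples Id_triples)
  show "far F (g \<cdot>\<^bsub>?T\<^esub> f) = far F g \<cdot>\<^bsub>E\<^esub> far F f"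
    if fg: "f \<in> Arr ?T" "g \<in> Arr ?T" "Cod ?T f = Dom ?T g" for f g
  proof -
    obtain x p y where f: "f = tri x p y" "tri x p y \<in> K"
      using fg(1) unfolding Arr_triples by (rule ArrE)
    obtain y' q z where g: "g = tri y' q z" "tri y' q z \<in> K"
      using fg(2) unfolding Arr_triples by (rule ArrE)
    have "y' = y"
      using f g fg(3) by (simp add: Dom Cod)
    then show ?thesis
      using f g comp by (simp add: Comp_triples)
  qed
qed (use assms category_triples in \<open>simp_all add: Obj_triples Arr_triples\<close>)

lemma forget_simps:
  "x \<in> X \<Longrightarrow> fob (triple_forget (triple_cat A X K) B) x = vfst x"
  "tri x f y \<in> K \<Longrightarrow> far (triple_forget (triple_cat A X K) B) (tri x f y) = f"
  by (simp_all add: triple_forget_def Obj_triples Arr_triples)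

lemma is_functor_forget: "is_functor (triple_cat A X K) A (triple_forget (triple_cat A X K) A)"
proof (rule is_functor_from_triples[OF base])
  let ?F = "triple_forget (triple_cat A X K) A"
  show "fob ?F \<in> X \<rightarrow>\<^sub>E Obj A"
    using obj by (simp add: triple_forget_def Obj_triples)
  show "far ?F \<in> extensional K"
    by (simp add: triple_forget_def Arr_triples)
qed (use triD ident composite in \<open>simp_all add: forget_simps triple_forget_def[of _ A]
    Obj_triples Arr_triples\<close>)

text \<open>\<open>tri x f y\<close> is a nested pair, so \<open>K\<close> is a subset of an
  iterated product of the small sets \<open>X\<close>, \<open>Arr A\<close> and
  \<open>X\<close>.\<close>

lemma small_triples:
  assumes "small_set X" "small_set (Arr A)"
  shows "small_cat (triple_cat A X K)"
proof -
  have "small_set {vpair f y | f y. f \<in> Arr A \<and> y \<in> X}"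
    using small_set_Times[OF assms(2,1)] .
  then have "small_set {vpair x z | x z. x \<in> X \<and> z \<in> {vpair f y | f y. f \<in> Arr A \<and> y \<in> X}}"
    using small_set_Times[OF assms(1)] by blast
  then have "small_set K"
  proof (rule small_set_subset)
    show "K \<subseteq> {vpair x z | x z. x \<in> X \<and> z \<in> {vpair f y | f y. f \<in> Arr A \<and> y \<in> X}}"
    proof
      fix k assume "k \<in> K"
      then obtain x f y where "k = tri x f y" "x \<in> X" "y \<in> X" "f \<in> hom A (vfst x) (vfst y)"
        by (rule ArrE)
      then show "k \<in> {vpair x z | x z. x \<in> X \<and> z \<in> {vpair f y | f y. f \<in> Arr A \<and> y \<in> X}}"
        unfolding tri_def hom_def by blast
    qed
  qed
  then show ?thesis
    using assms(1) category_triples by (simp add: small_cat_def Obj_triples Arr_triples)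
qed

end

lemma small_set_comma_objects:
  assumes "small_set X" "small_set Y" "\<And>a g. P a g \<Longrightarrow> a \<in> X \<and> g \<in> Y"
  shows "small_set {vpair a g | a g. P a g}"
  by (rule small_set_subset[OF small_set_Times[OF assms(1,2), of vpair]]) (use assms(3) in blast)

text \<open>Covers both \<open>coslice_map\<close> and \<open>square_slice_map\<close>, which differ
  in \<open>\<phi>\<close>. The second conclusion says that \<open>U\<close> lies over
  \<open>F\<close>; it supplies the commutative triangles to which the criterion applies.\<close>

lemma is_functor_triple_functor:
  assumes T: "triples A X K" and T': "triples A' X' K'" and F: "is_functor A A' F"
    and obj: "\<And>x. x \<in> X \<Longrightarrow> \<phi> x \<in> X' \<and> vfst (\<phi> x) = fob F (vfst x)"
    and arr: "\<And>x f y. tri x f y \<in> K \<Longrightarrow> tri (\<phi> x) (far F f) (\<phi> y) \<in> K'"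
  defines "U \<equiv> triple_functor (triple_cat A X K) (triple_cat A' X' K') \<phi> (far F)"
  shows "is_functor (triple_cat A X K) (triple_cat A' X' K') U"
    and "triple_forget (triple_cat A' X' K') A' \<odot> U = F \<odot> triple_forget (triple_cat A X K) A"
proof -
  interpret T: triples A X K by fact
  interpret T': triples A' X' K' by fact
  let ?T = "triple_cat A X K" and ?T' = "triple_cat A' X' K'"
  have fob_U: "fob U x = \<phi> x" if "x \<in> X" for x
    using that by (simp add: U_def triple_functor_def T.Obj_triples)
  have far_U: "far U (tri x f y) = tri (\<phi> x) (far F f) (\<phi> y)" if "tri x f y \<in> K" for x f y
    using that by (simp add: U_def triple_functor_def T.Arr_triples)
  show U: "is_functor ?T ?T' U"
  proof (rule T.is_functor_from_triples[OF T'.category_triples])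
    show "fob U \<in> X \<rightarrow>\<^sub>E Obj ?T'"
      using obj by (simp add: U_def triple_functor_def T.Obj_triples T'.Obj_triples)
    show "far U \<in> extensional K"
      by (simp add: U_def triple_functor_def T.Arr_triples)
    show "far U (tri x f y) \<in> hom ?T' (fob U x) (fob U y)" if "tri x f y \<in> K" for x f y
      using arr[OF that] T.triD[OF that] by (simp add: T'.hom_triples far_U[OF that] fob_U)
    show "far U (tri x (Id A (vfst x)) x) = Id ?T' (fob U x)" if "x \<in> X" for x
      using that obj[OF that] far_Id[OF F T.obj[OF that]]
      by (simp add: far_U[OF T.ident[OF that]] fob_U T'.Id_triples)
    show "far U (tri x (g \<cdot>\<^bsub>A\<^esub> f) z) = far U (tri y g z) \<cdot>\<^bsub>?T'\<^esub> far U (tri x f y)"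
      if f: "tri x f y \<in> K" and g: "tri y g z \<in> K" for x f y g z
      using far_Comp[OF F T.triD(3)[OF f] T.triD(3)[OF g]]
      by (simp add: far_U[OF f] far_U[OF g] far_U[OF T.composite[OF f g]] T'.Comp_triples[OF arr[OF f] arr[OF g]])
  qed (simp_all add: U_def triple_functor_def)
  show "triple_forget ?T' A' \<odot> U = F \<odot> triple_forget ?T A"
  proof (rule functor_eqI)
    show "is_functor ?T A' (triple_forget ?T' A' \<odot> U)"
      using is_functor_compF[OF U T'.is_functor_forget] .
    show "is_functor ?T A' (F \<odot> triple_forget ?T A)"
      using is_functor_compF[OF T.is_functor_forget F] .
    show "fob (triple_forget ?T' A' \<odot> U) x = fob (F \<odot> triple_forget ?T A) x" if "x \<in> Obj ?T" for x
      using that obj[of x]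
      by (simp add: fob_compF[OF U that] fob_compF[OF T.is_functor_forget that] T.Obj_triples
          T.forget_simps T'.forget_simps fob_U)
    show "far (triple_forget ?T' A' \<odot> U) f = far (F \<odot> triple_forget ?T A) f" if f: "f \<in> Arr ?T" for f
    proof -
      obtain x p y where "f = tri x p y" and K: "tri x p y \<in> K"
        using f unfolding T.Arr_triples by (rule T.ArrE)
      moreover have "tri x p y \<in> hom ?T x y"
        using K by (simp add: T.hom_triples)
      ultimately show ?thesis
        by (simp add: far_compF[OF U] far_compF[OF T.is_functor_forget] T.forget_simps
            T'.forget_simps far_U arr)
    qed
  qed
qed

section \<open>Slices and coslices as comma categories of triples\<close>

text \<open>The second conclusion describes the slice by its own objects and arrows; folding with it
  transports the facts of the locale \<open>triples\<close> to \<open>slice u b\<close>.\<close>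

lemma slice_triples:
  assumes "is_functor A B u" and b: "b \<in> Obj B"
  shows "triples A (Obj (slice u b)) (Arr (slice u b))"
    and "slice u b = triple_cat A (Obj (slice u b)) (Arr (slice u b))"
    and "x \<in> Obj (slice u b) \<longleftrightarrow>
      (\<exists>a g. x = vpair a g \<and> a \<in> Obj A \<and> g \<in> hom B (fob u a) b)"
    and "k \<in> Arr (slice u b) \<longleftrightarrow>
      (\<exists>x f y. k = tri x f y \<and> x \<in> Obj (slice u b) \<and> y \<in> Obj (slice u b) \<and> f \<in> hom A (vfst x) (vfst y) \<and>
        vsnd y \<cdot>\<^bsub>B\<^esub> far u f = vsnd x)"
proof -
  note c = functor_cats[OF assms(1)]
  show obj: "x \<in> Obj (slice u b) \<longleftrightarrow> (\<exists>a g. x = vpair a g \<and> a \<in> Obj A \<and> g \<in> hom B (fob u a) b)" for x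
    by (simp add: slice_def triple_cat_def c)
  show arr: "k \<in> Arr (slice u b) \<longleftrightarrow>
      (\<exists>x f y. k = tri x f y \<and> x \<in> Obj (slice u b) \<and> y \<in> Obj (slice u b) \<and> f \<in> hom A (vfst x) (vfst y) \<and>
        vsnd y \<cdot>\<^bsub>B\<^esub> far u f = vsnd x)" for k
  proof -
    have "k \<in> Arr (slice u b) \<longleftrightarrow> (\<exists>a g f a' g'. k = tri (vpair a g) f (vpair a' g') \<and> f \<in> hom A a a' \<and>
        g \<in> hom B (fob u a) b \<and> g' \<in> hom B (fob u a') b \<and> g' \<cdot>\<^bsub>B\<^esub> far u f = g)"
      by (simp add: slice_def triple_cat_def c)
    \<comment> \<open>The definition of the arrows leaves implicit that \<open>a\<close> and
      \<open>a'\<close> are objects of \<open>A\<close>; this is needed to recognise both ends as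
      objects of the slice.\<close>
    also have "\<dots> \<longleftrightarrow> (\<exists>a g f a' g'. k = tri (vpair a g) f (vpair a' g') \<and> a \<in> Obj A \<and> a' \<in> Obj A \<and>
        f \<in> hom A a a' \<and> g \<in> hom B (fob u a) b \<and> g' \<in> hom B (fob u a') b \<and> g' \<cdot>\<^bsub>B\<^esub> far u f = g)"
      by (intro ex_cong1) (auto dest: hom_objs[OF c(1)])
    finally show ?thesis
      by (auto simp: obj)
  qed
  show "slice u b = triple_cat A (Obj (slice u b)) (Arr (slice u b))"
    by (simp add: slice_def triple_cat_def c)
  have objD: "vfst x \<in> Obj A \<and> vsnd x \<in> hom B (fob u (vfst x)) b" if "x \<in> Obj (slice u b)" for x
    using that by (auto simp: obj)
  have tri: "tri x f y \<in> Arr (slice u b) \<longleftrightarrow> x \<in> Obj (slice u b) \<and> y \<in> Obj (slice u b) \<and>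
      f \<in> hom A (vfst x) (vfst y) \<and> vsnd y \<cdot>\<^bsub>B\<^esub> far u f = vsnd x" for x f y
    by (simp add: arr)
  show "triples A (Obj (slice u b)) (Arr (slice u b))"
  proof
    show "category A" by (fact c(1))
    show "vfst x \<in> Obj A" if "x \<in> Obj (slice u b)" for x
      using objD[OF that] by simp
    show "\<exists>x f y. k = tri x f y \<and> x \<in> Obj (slice u b) \<and> y \<in> Obj (slice u b) \<and> f \<in> hom A (vfst x) (vfst y)"
      if "k \<in> Arr (slice u b)" for k
      using that unfolding arr by blast
    show "tri x (Id A (vfst x)) x \<in> Arr (slice u b)" if "x \<in> Obj (slice u b)" for x
      using that objD[OF that] Id_hom[OF c(1)] far_Id[OF assms(1)]
        Comp_Id_right[OF c(2) conjunct2[OF objD[OF that]]] by (simp add: tri)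
    show "tri x (g \<cdot>\<^bsub>A\<^esub> f) z \<in> Arr (slice u b)"
      if "tri x f y \<in> Arr (slice u b)" "tri y g z \<in> Arr (slice u b)" for x f y g z
    proof -
      have f: "f \<in> hom A (vfst x) (vfst y)" and g: "g \<in> hom A (vfst y) (vfst z)"
        and z: "vsnd z \<in> hom B (fob u (vfst z)) b"
        using that objD by (simp_all add: tri)
      show ?thesis
        using that Comp_hom[OF c(1) f g] far_Comp[OF assms(1) f g]
          Comp_assoc[OF c(2) far_hom[OF assms(1) f] far_hom[OF assms(1) g] z]
        by (simp add: tri)
    qed
  qed
qed

lemma coslice_triples:
  assumes "is_functor A B u" and b: "b \<in> Obj B"
  shows "triples A (Obj (coslice b u)) (Arr (coslice b u))"
    and "coslice b u = triple_cat A (Obj (coslice b u)) (Arr (coslice b u))"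
    and "x \<in> Obj (coslice b u) \<longleftrightarrow>
      (\<exists>a g. x = vpair a g \<and> a \<in> Obj A \<and> g \<in> hom B b (fob u a))"
    and "k \<in> Arr (coslice b u) \<longleftrightarrow>
      (\<exists>x f y. k = tri x f y \<and> x \<in> Obj (coslice b u) \<and> y \<in> Obj (coslice b u) \<and> f \<in> hom A (vfst x) (vfst y) \<and>
        far u f \<cdot>\<^bsub>B\<^esub> vsnd x = vsnd y)"
proof -
  note c = functor_cats[OF assms(1)]
  show obj: "x \<in> Obj (coslice b u) \<longleftrightarrow> (\<exists>a g. x = vpair a g \<and> a \<in> Obj A \<and> g \<in> hom B b (fob u a))" for x
    by (simp add: coslice_def triple_cat_def c)
  show arr: "k \<in> Arr (coslice b u) \<longleftrightarrow>
      (\<exists>x f y. k = tri x f y \<and> x \<in> Obj (coslice b u) \<and> y \<in> Obj (coslice b u) \<and> f \<in> hom A (vfst x) (vfst y) \<and>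
        far u f \<cdot>\<^bsub>B\<^esub> vsnd x = vsnd y)" for k
  proof -
    have "k \<in> Arr (coslice b u) \<longleftrightarrow> (\<exists>a g f a' g'. k = tri (vpair a g) f (vpair a' g') \<and> f \<in> hom A a a' \<and>
        g \<in> hom B b (fob u a) \<and> g' \<in> hom B b (fob u a') \<and> far u f \<cdot>\<^bsub>B\<^esub> g = g')"
      by (simp add: coslice_def triple_cat_def c)
    also have "\<dots> \<longleftrightarrow> (\<exists>a g f a' g'. k = tri (vpair a g) f (vpair a' g') \<and> a \<in> Obj A \<and> a' \<in> Obj A \<and>
        f \<in> hom A a a' \<and> g \<in> hom B b (fob u a) \<and> g' \<in> hom B b (fob u a') \<and> far u f \<cdot>\<^bsub>B\<^esub> g = g')"
      by (intro ex_cong1) (auto dest: hom_objs[OF c(1)])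
    finally show ?thesis
      by (auto simp: obj)
  qed
  show "coslice b u = triple_cat A (Obj (coslice b u)) (Arr (coslice b u))"
    by (simp add: coslice_def triple_cat_def c)
  have objD: "vfst x \<in> Obj A \<and> vsnd x \<in> hom B b (fob u (vfst x))" if "x \<in> Obj (coslice b u)" for x
    using that by (auto simp: obj)
  have tri: "tri x f y \<in> Arr (coslice b u) \<longleftrightarrow> x \<in> Obj (coslice b u) \<and> y \<in> Obj (coslice b u) \<and>
      f \<in> hom A (vfst x) (vfst y) \<and> far u f \<cdot>\<^bsub>B\<^esub> vsnd x = vsnd y" for x f y
    by (simp add: arr)
  show "triples A (Obj (coslice b u)) (Arr (coslice b u))"
  proof
    show "category A" by (fact c(1))
    show "vfst x \<in> Obj A" if "x \<in> Obj (coslice b u)" for x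
      using objD[OF that] by simp
    show "\<exists>x f y. k = tri x f y \<and> x \<in> Obj (coslice b u) \<and> y \<in> Obj (coslice b u) \<and> f \<in> hom A (vfst x) (vfst y)"
      if "k \<in> Arr (coslice b u)" for k
      using that unfolding arr by blast
    show "tri x (Id A (vfst x)) x \<in> Arr (coslice b u)" if "x \<in> Obj (coslice b u)" for x
      using that objD[OF that] Id_hom[OF c(1)] far_Id[OF assms(1)]
        Comp_Id_left[OF c(2) conjunct2[OF objD[OF that]]] by (simp add: tri)
    show "tri x (g \<cdot>\<^bsub>A\<^esub> f) z \<in> Arr (coslice b u)"
      if "tri x f y \<in> Arr (coslice b u)" "tri y g z \<in> Arr (coslice b u)" for x f y g z
    proof -
      have f: "f \<in> hom A (vfst x) (vfst y)" and g: "g \<in> hom A (vfst y) (vfst z)"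
        and x: "vsnd x \<in> hom B b (fob u (vfst x))"
        using that objD by (simp_all add: tri)
      show ?thesis
        using that Comp_hom[OF c(1) f g] far_Comp[OF assms(1) f g]
          Comp_assoc[OF c(2) x far_hom[OF assms(1) f] far_hom[OF assms(1) g]]
        by (simp add: tri)
    qed
  qed
qed

lemma hom_slice:
  assumes "is_functor A B u" "b \<in> Obj B"
  shows "hom (slice u b) x y = {tri x f y | f. tri x f y \<in> Arr (slice u b)}"
  using triples.hom_triples[OF slice_triples(1)[OF assms], folded slice_triples(2)[OF assms]] .

lemma hom_coslice:
  assumes "is_functor A B u" "b \<in> Obj B"
  shows "hom (coslice b u) x y = {tri x f y | f. tri x f y \<in> Arr (coslice b u)}"
  using triples.hom_triples[OF coslice_triples(1)[OF assms], folded coslice_triples(2)[OF assms]] .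

lemma slice_objD:
  assumes "is_functor A B u" "b \<in> Obj B" "x \<in> Obj (slice u b)"
  shows "vfst x \<in> Obj A" "vsnd x \<in> hom B (fob u (vfst x)) b"
  using assms(3) unfolding slice_triples(3)[OF assms(1,2)] by auto

lemma coslice_objD:
  assumes "is_functor A B u" "b \<in> Obj B" "x \<in> Obj (coslice b u)"
  shows "vfst x \<in> Obj A" "vsnd x \<in> hom B b (fob u (vfst x))"
  using assms(3) unfolding coslice_triples(3)[OF assms(1,2)] by auto

lemma tri_slice:
  assumes "is_functor A B u" "b \<in> Obj B"
  shows "tri x f y \<in> Arr (slice u b) \<longleftrightarrow> x \<in> Obj (slice u b) \<and> y \<in> Obj (slice u b) \<and>
    f \<in> hom A (vfst x) (vfst y) \<and> vsnd y \<cdot>\<^bsub>B\<^esub> far u f = vsnd x"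
  unfolding slice_triples(4)[OF assms] by simp

lemma tri_coslice:
  assumes "is_functor A B u" "b \<in> Obj B"
  shows "tri x f y \<in> Arr (coslice b u) \<longleftrightarrow> x \<in> Obj (coslice b u) \<and> y \<in> Obj (coslice b u) \<and>
    f \<in> hom A (vfst x) (vfst y) \<and> far u f \<cdot>\<^bsub>B\<^esub> vsnd x = vsnd y"
  unfolding coslice_triples(4)[OF assms] by simp

lemma vpair_slice:
  assumes "is_functor A B u" "b \<in> Obj B"
  shows "vpair a g \<in> Obj (slice u b) \<longleftrightarrow> a \<in> Obj A \<and> g \<in> hom B (fob u a) b"
  unfolding slice_triples(3)[OF assms] by simp

lemma vpair_coslice:
  assumes "is_functor A B u" "b \<in> Obj B"
  shows "vpair a g \<in> Obj (coslice b u) \<longleftrightarrow> a \<in> Obj A \<and> g \<in> hom B b (fob u a)"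
  unfolding coslice_triples(3)[OF assms] by simp

lemma small_set_hom_pairs:
  assumes "small_cat A" "small_cat B" "\<And>a g. P a g \<Longrightarrow> a \<in> Obj A \<and> g \<in> Arr B"
  shows "small_set {vpair a g | a g. P a g}"
  using small_set_comma_objects[of "Obj A" "Arr B" P] assms by (simp add: small_cat_def)

lemma small_slice:
  assumes u: "small_functor A B u" and b: "b \<in> Obj B"
  shows "small_cat (slice u b)"
    and "small_functor (slice u b) A (slice_forget u b)"
    and "x \<in> Obj (slice u b) \<Longrightarrow> fob (slice_forget u b) x = vfst x"
    and "tri x f y \<in> Arr (slice u b) \<Longrightarrow> far (slice_forget u b) (tri x f y) = f"
proof -
  note f = small_functorD[OF u]
  have "Obj (slice u b) = {vpair a g | a g. a \<in> Obj A \<and> g \<in> hom B (fob u a) b}"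
    using slice_triples(3)[OF f(3) b] by blast
  then have "small_set (Obj (slice u b))"
    using small_set_hom_pairs[OF f(1,2), of "\<lambda>a g. a \<in> Obj A \<and> g \<in> hom B (fob u a) b"]
    by (simp add: hom_def)
  moreover have "small_set (Arr A)"
    using f(1) by (simp add: small_cat_def)
  ultimately show s: "small_cat (slice u b)"
    using triples.small_triples[OF slice_triples(1)[OF f(3) b], folded slice_triples(2)[OF f(3) b]]
    by blast
  show "small_functor (slice u b) A (slice_forget u b)"
    using triples.is_functor_forget[OF slice_triples(1)[OF f(3) b], folded slice_triples(2)[OF f(3) b]] s f(1)
    by (simp add: small_functor_def slice_forget_def f(6))
  show "x \<in> Obj (slice u b) \<Longrightarrow> fob (slice_forget u b) x = vfst x"
    "tri x f y \<in> Arr (slice u b) \<Longrightarrow> far (slice_forget u b) (tri x f y) = f"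
    by (simp_all add: slice_forget_def triple_forget_def)
qed

lemma small_coslice:
  assumes u: "small_functor A B u" and b: "b \<in> Obj B"
  shows "small_cat (coslice b u)"
    and "small_functor (coslice b u) A (coslice_forget b u)"
    and "x \<in> Obj (coslice b u) \<Longrightarrow> fob (coslice_forget b u) x = vfst x"
    and "tri x f y \<in> Arr (coslice b u) \<Longrightarrow> far (coslice_forget b u) (tri x f y) = f"
proof -
  note f = small_functorD[OF u]
  have "Obj (coslice b u) = {vpair a g | a g. a \<in> Obj A \<and> g \<in> hom B b (fob u a)}"
    using coslice_triples(3)[OF f(3) b] by blast
  then have "small_set (Obj (coslice b u))"
    using small_set_hom_pairs[OF f(1,2), of "\<lambda>a g. a \<in> Obj A \<and> g \<in> hom B b (fob u a)"]
    by (simp add: hom_def)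
  moreover have "small_set (Arr A)"
    using f(1) by (simp add: small_cat_def)
  ultimately show s: "small_cat (coslice b u)"
    using triples.small_triples[OF coslice_triples(1)[OF f(3) b], folded coslice_triples(2)[OF f(3) b]]
    by blast
  show "small_functor (coslice b u) A (coslice_forget b u)"
    using triples.is_functor_forget[OF coslice_triples(1)[OF f(3) b], folded coslice_triples(2)[OF f(3) b]] s f(1)
    by (simp add: small_functor_def coslice_forget_def f(6))
  show "x \<in> Obj (coslice b u) \<Longrightarrow> fob (coslice_forget b u) x = vfst x"
    "tri x f y \<in> Arr (coslice b u) \<Longrightarrow> far (coslice_forget b u) (tri x f y) = f"
    by (simp_all add: coslice_forget_def triple_forget_def)
qed

lemma small_functor_constant:
  assumes "small_cat A" "small_cat B" "b \<in> Obj B"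
  shows "small_functor A B (point B b \<odot> to_terminal A)"
    and "x \<in> Obj A \<Longrightarrow> fob (point B b \<odot> to_terminal A) x = b"
    and "f \<in> Arr A \<Longrightarrow> far (point B b \<odot> to_terminal A) f = Id B b"
  using small_functor_compF[OF small_functor_to_terminal[OF assms(1)] small_functor_point[OF assms(2,3)]]
  by (simp_all add: compF_def to_terminal_def compose_def point_simps)

section \<open>Squares and the comparison functors between comma categories\<close>

locale small_square =
  fixes S :: "'v::universe square" and A' A B' B
  assumes top: "small_functor A' A (sq_top S)" and bot: "small_functor B' B (sq_bot S)"
    and left: "small_functor A' B' (sq_left S)" and right: "small_functor A B (sq_right S)"
    and cell: "is_nat (sq_right S \<odot> sq_top S) (sq_bot S \<odot> sq_left S) (sq_cell S)"

lemma is_squareE: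
  assumes "is_square S"
  obtains A' A B' B where "small_square S A' A B' B"
  using assms unfolding is_square_def small_square_def by blast

lemma slice_square_simps [simp]:
  "sq_top (slice_square u b) = slice_forget u b" "sq_bot (slice_square u b) = point (Trg u) b"
  "sq_left (slice_square u b) = to_terminal (slice u b)" "sq_right (slice_square u b) = u"
  "cmp (sq_cell (slice_square u b)) = (\<lambda>x\<in>Obj (slice u b). vsnd x)"
  "NSrc (sq_cell (slice_square u b)) = u \<odot> slice_forget u b"
  "NTrg (sq_cell (slice_square u b)) = point (Trg u) b \<odot> to_terminal (slice u b)"
  by (simp_all add: slice_square_def)

lemma coslice_square_simps [simp]:
  "sq_top (coslice_square b u) = to_terminal (coslice b u)" "sq_bot (coslice_square b u) = u"
  "sq_left (coslice_square b u) = coslice_forget b u" "sq_right (coslice_square b u) = point (Trg u) b"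
  "cmp (sq_cell (coslice_square b u)) = (\<lambda>x\<in>Obj (coslice b u). vsnd x)"
  "NSrc (sq_cell (coslice_square b u)) = point (Trg u) b \<odot> to_terminal (coslice b u)"
  "NTrg (sq_cell (coslice_square b u)) = u \<odot> coslice_forget b u"
  by (simp_all add: coslice_square_def)

text \<open>Naturality of the 2-cell at an arrow of \<open>slice u b\<close> is exactly the
  commutative triangle built into that arrow.\<close>

lemma small_square_slice:
  assumes u: "small_functor A B u" and b: "b \<in> Obj B"
  shows "small_square (slice_square u b) (slice u b) A terminal_cat B"
proof
  note f = small_functorD[OF u] and s = small_slice[OF u b]
  note c = small_functor_constant[OF s(1) f(2) b]
  show "small_functor (slice u b) A (sq_top (slice_square u b))"
    using s(2) by simp
  show "small_functor terminal_cat B (sq_bot (slice_square u b))"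
    using small_functor_point[OF f(2) b] f(7) by simp
  show "small_functor (slice u b) terminal_cat (sq_left (slice_square u b))"
    using small_functor_to_terminal[OF s(1)] by simp
  show "small_functor A B (sq_right (slice_square u b))"
    using u by simp
  show "is_nat (sq_right (slice_square u b) \<odot> sq_top (slice_square u b))
      (sq_bot (slice_square u b) \<odot> sq_left (slice_square u b)) (sq_cell (slice_square u b))"
    unfolding slice_square_simps f(7)
  proof (rule is_natI)
    note F = small_functorD(3)[OF s(2)]
    show "is_functor (slice u b) B (u \<odot> slice_forget u b)"
      using small_functorD(3)[OF small_functor_compF[OF s(2) u]] .
    show "is_functor (slice u b) B (point B b \<odot> to_terminal (slice u b))"
      using small_functorD(3)[OF c(1)] .
    show "cmp (sq_cell (slice_square u b)) x \<in>
        hom B (fob (u \<odot> slice_forget u b) x) (fob (point B b \<odot> to_terminal (slice u b)) x)"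
      if x: "x \<in> Obj (slice u b)" for x
      using x slice_objD[OF f(3) b x] by (simp add: fob_compF[OF F x] s(3)[OF x] c(2))
    show "cmp (sq_cell (slice_square u b)) y \<cdot>\<^bsub>B\<^esub> far (u \<odot> slice_forget u b) k =
        far (point B b \<odot> to_terminal (slice u b)) k \<cdot>\<^bsub>B\<^esub> cmp (sq_cell (slice_square u b)) x"
      if k: "k \<in> hom (slice u b) x y" for k x y
    proof -
      obtain p where "k = tri x p y" and K: "tri x p y \<in> Arr (slice u b)"
        using k unfolding hom_slice[OF f(3) b] by blast
      moreover have "x \<in> Obj (slice u b)" "y \<in> Obj (slice u b)" "vsnd y \<cdot>\<^bsub>B\<^esub> far u p = vsnd x"
        using K by (simp_all add: tri_slice[OF f(3) b])
      moreover note Comp_Id_left[OF f(5) slice_objD(2)[OF f(3) b \<open>x \<in> Obj (slice u b)\<close>]]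
      ultimately show ?thesis
        using k by (simp add: far_compF[OF F] s(4) c(3))
    qed
  qed (simp_all add: f(7))
qed

lemma small_square_coslice:
  assumes u: "small_functor A B u" and b: "b \<in> Obj B"
  shows "small_square (coslice_square b u) (coslice b u) terminal_cat A B"
proof
  note f = small_functorD[OF u] and s = small_coslice[OF u b]
  note c = small_functor_constant[OF s(1) f(2) b]
  show "small_functor (coslice b u) terminal_cat (sq_top (coslice_square b u))"
    using small_functor_to_terminal[OF s(1)] by simp
  show "small_functor A B (sq_bot (coslice_square b u))"
    using u by simp
  show "small_functor (coslice b u) A (sq_left (coslice_square b u))"
    using s(2) by simp
  show "small_functor terminal_cat B (sq_right (coslice_square b u))"
    using small_functor_point[OF f(2) b] f(7) by simp
  show "is_nat (sq_right (coslice_square b u) \<odot> sq_top (coslice_square b u))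
      (sq_bot (coslice_square b u) \<odot> sq_left (coslice_square b u)) (sq_cell (coslice_square b u))"
    unfolding coslice_square_simps f(7)
  proof (rule is_natI)
    note F = small_functorD(3)[OF s(2)]
    show "is_functor (coslice b u) B (u \<odot> coslice_forget b u)"
      using small_functorD(3)[OF small_functor_compF[OF s(2) u]] .
    show "is_functor (coslice b u) B (point B b \<odot> to_terminal (coslice b u))"
      using small_functorD(3)[OF c(1)] .
    show "cmp (sq_cell (coslice_square b u)) x \<in>
        hom B (fob (point B b \<odot> to_terminal (coslice b u)) x) (fob (u \<odot> coslice_forget b u) x)"
      if x: "x \<in> Obj (coslice b u)" for x
      using x coslice_objD[OF f(3) b x] by (simp add: fob_compF[OF F x] s(3)[OF x] c(2))
    show "cmp (sq_cell (coslice_square b u)) y \<cdot>\<^bsub>B\<^esub> far (point B b \<odot> to_terminal (coslice b u)) k =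
        far (u \<odot> coslice_forget b u) k \<cdot>\<^bsub>B\<^esub> cmp (sq_cell (coslice_square b u)) x"
      if k: "k \<in> hom (coslice b u) x y" for k x y
    proof -
      obtain p where "k = tri x p y" and K: "tri x p y \<in> Arr (coslice b u)"
        using k unfolding hom_coslice[OF f(3) b] by blast
      moreover have "x \<in> Obj (coslice b u)" "y \<in> Obj (coslice b u)" "far u p \<cdot>\<^bsub>B\<^esub> vsnd x = vsnd y"
        using K by (simp_all add: tri_coslice[OF f(3) b])
      moreover note Comp_Id_right[OF f(5) coslice_objD(2)[OF f(3) b \<open>y \<in> Obj (coslice b u)\<close>]]
      ultimately show ?thesis
        using k by (simp add: far_compF[OF F] s(4) c(3))
    qed
  qed (simp_all add: f(7))
qed

text \<open>The triangle is used in the form v = w u, so the structural arrow from \<open>c\<close>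
  to v(a) is kept unchanged as an arrow from \<open>c\<close> to w(u(a)).\<close>

lemma coslice_map_functor:
  assumes u: "small_functor A B u" and w: "small_functor B C w" and c: "c \<in> Obj C"
  defines "U \<equiv> coslice_map c u w (w \<odot> u)"
  shows "small_functor (coslice c (w \<odot> u)) (coslice c w) U"
    and "coslice_forget c w \<odot> U = u \<odot> coslice_forget c (w \<odot> u)"
    and "x \<in> Obj (coslice c (w \<odot> u)) \<Longrightarrow> fob U x = vpair (fob u (vfst x)) (vsnd x)"
proof -
  note v = small_functor_compF[OF u w]
  note f = small_functorD[OF u] and g = small_functorD[OF w] and h = small_functorD[OF v]
  note T = coslice_triples[OF h(3) c] and T' = coslice_triples[OF g(3) c]
  let ?\<phi> = "\<lambda>x. vpair (fob u (vfst x)) (vsnd x)"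
  have obj: "?\<phi> x \<in> Obj (coslice c w) \<and> vfst (?\<phi> x) = fob u (vfst x)"
    if "x \<in> Obj (coslice c (w \<odot> u))" for x
    using coslice_objD[OF h(3) c that] fob_in[OF f(3)]
    by (simp add: vpair_coslice[OF g(3) c] fob_compF[OF f(3)])
  have arr: "tri (?\<phi> x) (far u k) (?\<phi> y) \<in> Arr (coslice c w)"
    if "tri x k y \<in> Arr (coslice c (w \<odot> u))" for x k y
  proof -
    have k: "k \<in> hom A (vfst x) (vfst y)"
      using that by (simp add: tri_coslice[OF h(3) c])
    then show ?thesis
      using that obj far_hom[OF f(3) k]
      by (simp add: tri_coslice[OF h(3) c] tri_coslice[OF g(3) c] far_compF[OF f(3) k])
  qed
  note F = is_functor_triple_functor[OF T(1) T'(1) f(3) obj arr, folded T(2) T'(2)]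
  show "small_functor (coslice c (w \<odot> u)) (coslice c w) U"
    using F(1) small_coslice(1)[OF v c] small_coslice(1)[OF w c]
    by (simp add: small_functor_def U_def coslice_map_def)
  show "coslice_forget c w \<odot> U = u \<odot> coslice_forget c (w \<odot> u)"
    using F(2) by (simp add: U_def coslice_map_def coslice_forget_def f(6) g(6) h(6))
  show "x \<in> Obj (coslice c (w \<odot> u)) \<Longrightarrow> fob U x = vpair (fob u (vfst x)) (vsnd x)"
    by (simp add: U_def coslice_map_def triple_functor_def)
qed

text \<open>Both 2-cells have the component \<open>g\<close> at (a, g). Stated as an equation of
  2-cells it can be fed to \<open>D2\<close>, and then shows that restriction along
  \<open>coslice_map\<close> carries the mate of one coslice square to that of the other.\<close>

lemma coslice_cell_restrict:
  assumes u: "small_functor A B u" and w: "small_functor B C w" and c: "c \<in> Obj C"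
  shows "hcomp (sq_cell (coslice_square c w)) (idN (coslice_map c u w (w \<odot> u))) =
    sq_cell (coslice_square c (w \<odot> u))"
proof -
  note v = small_functor_compF[OF u w]
  note U = coslice_map_functor[OF u w c]
  let ?U = "coslice_map c u w (w \<odot> u)"
  interpret W: small_square "coslice_square c w" "coslice c w" terminal_cat B C
    using small_square_coslice[OF w c] .
  interpret V: small_square "coslice_square c (w \<odot> u)" "coslice c (w \<odot> u)" terminal_cat A C
    using small_square_coslice[OF v c] .
  note Trg = small_functorD(7)[OF v] small_functorD(7)[OF w]
  note fU = small_functorD(3)[OF U(1)]
  have s: "(point C c \<odot> to_terminal (coslice c w)) \<odot> ?U = point C c \<odot> to_terminal (coslice c (w \<odot> u))"
    unfolding compF_assoc[OF fU small_functorD(6)[OF small_functor_to_terminal[OF small_coslice(1)[OF w c]]]]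
      to_terminal_compF[OF U(1)] ..
  have t: "(w \<odot> coslice_forget c w) \<odot> ?U = (w \<odot> u) \<odot> coslice_forget c (w \<odot> u)"
    unfolding compF_assoc[OF fU small_functorD(6)[OF small_coslice(2)[OF w c]]] U(2)
      compF_assoc[OF small_functorD(3)[OF small_coslice(2)[OF v c]] small_functorD(6)[OF u]] ..
  have sF: "is_functor (coslice c w) C (point C c \<odot> to_terminal (coslice c w))"
    using small_functor_constant(1)[OF small_coslice(1)[OF w c] small_functorD(2)[OF w] c] small_functorD by blast
  note n = W.cell[unfolded coslice_square_simps Trg]
  show ?thesis
  proof (rule nat_eqI)
    show "is_nat (point C c \<odot> to_terminal (coslice c (w \<odot> u))) ((w \<odot> u) \<odot> coslice_forget c (w \<odot> u))
        (hcomp (sq_cell (coslice_square c w)) (idN ?U))"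
      using is_nat_whisker_right[OF n sF fU] unfolding s t .
    show "is_nat (point C c \<odot> to_terminal (coslice c (w \<odot> u))) ((w \<odot> u) \<odot> coslice_forget c (w \<odot> u))
        (sq_cell (coslice_square c (w \<odot> u)))"
      using V.cell by (simp add: Trg)
    show "is_functor (coslice c (w \<odot> u)) C (point C c \<odot> to_terminal (coslice c (w \<odot> u)))"
      using is_functor_compF[OF fU sF] unfolding s .
    show "cmp (hcomp (sq_cell (coslice_square c w)) (idN ?U)) x = cmp (sq_cell (coslice_square c (w \<odot> u))) x"
      if x: "x \<in> Obj (coslice c (w \<odot> u))" for x
      using x fob_in[OF fU x] unfolding cmp_whisker_right[OF n sF fU x] by (simp add: U(3))
  qed
qed

context small_square
begin

lemma square_slice_map_functor:
  assumes b': "b' \<in> Obj B'"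
  defines "U \<equiv> square_slice_map S b'"
  shows "small_functor (slice (sq_left S) b') (slice (sq_right S) (fob (sq_bot S) b')) U"
    and "slice_forget (sq_right S) (fob (sq_bot S) b') \<odot> U = sq_top S \<odot> slice_forget (sq_left S) b'"
    and "x \<in> Obj (slice (sq_left S) b') \<Longrightarrow> fob U x =
      vpair (fob (sq_top S) (vfst x)) (far (sq_bot S) (vsnd x) \<cdot>\<^bsub>B\<^esub> cmp (sq_cell S) (vfst x))"
proof -
  let ?v = "sq_top S" and ?w = "sq_bot S" and ?u' = "sq_left S" and ?u = "sq_right S"
  let ?\<alpha> = "cmp (sq_cell S)"
  note v = small_functorD[OF top] and w = small_functorD[OF bot]
    and u' = small_functorD[OF left] and u = small_functorD[OF right]
  have b: "fob ?w b' \<in> Obj B"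
    using fob_in[OF w(3) b'] .
  have uv: "is_functor A' B (?u \<odot> ?v)"
    using is_functor_compF[OF v(3) u(3)] .
  note T = slice_triples[OF u'(3) b'] and T' = slice_triples[OF u(3) b]
  let ?\<phi> = "\<lambda>x. vpair (fob ?v (vfst x)) (far ?w (vsnd x) \<cdot>\<^bsub>B\<^esub> ?\<alpha> (vfst x))"
  have \<alpha>: "?\<alpha> a \<in> hom B (fob ?u (fob ?v a)) (fob ?w (fob ?u' a))" if "a \<in> Obj A'" for a
    using nat_cmp[OF cell uv that] by (simp add: fob_compF[OF v(3) that] fob_compF[OF u'(3) that])
  have obj: "?\<phi> x \<in> Obj (slice ?u (fob ?w b')) \<and> vfst (?\<phi> x) = fob ?v (vfst x)"
    if "x \<in> Obj (slice ?u' b')" for x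
  proof -
    note x = slice_objD[OF u'(3) b' that]
    show ?thesis
      using Comp_hom[OF u(5) \<alpha>[OF x(1)] far_hom[OF w(3) x(2)]] fob_in[OF v(3) x(1)]
      by (simp add: vpair_slice[OF u(3) b])
  qed
  \<comment> \<open>The triangle over w(b') commutes by naturality of the 2-cell at \<open>k\<close>
    and by applying w to the triangle over \<open>b'\<close>.\<close>
  have arr: "tri (?\<phi> x) (far ?v k) (?\<phi> y) \<in> Arr (slice ?u (fob ?w b'))"
    if K: "tri x k y \<in> Arr (slice ?u' b')" for x k y
  proof -
    have k: "k \<in> hom A' (vfst x) (vfst y)" and x: "x \<in> Obj (slice ?u' b')"
      and y: "y \<in> Obj (slice ?u' b')" and eq: "vsnd y \<cdot>\<^bsub>B'\<^esub> far ?u' k = vsnd x"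
      using K by (simp_all add: tri_slice[OF u'(3) b'])
    note x' = slice_objD[OF u'(3) b' x] and y' = slice_objD[OF u'(3) b' y]
    have nat: "?\<alpha> (vfst y) \<cdot>\<^bsub>B\<^esub> far ?u (far ?v k) = far ?w (far ?u' k) \<cdot>\<^bsub>B\<^esub> ?\<alpha> (vfst x)"
      using nat_naturality[OF cell uv k] by (simp add: far_compF[OF v(3) k] far_compF[OF u'(3) k])
    have "(far ?w (vsnd y) \<cdot>\<^bsub>B\<^esub> ?\<alpha> (vfst y)) \<cdot>\<^bsub>B\<^esub> far ?u (far ?v k) =
        far ?w (vsnd y) \<cdot>\<^bsub>B\<^esub> (far ?w (far ?u' k) \<cdot>\<^bsub>B\<^esub> ?\<alpha> (vfst x))"
      using Comp_assoc[OF u(5) far_hom[OF u(3) far_hom[OF v(3) k]] \<alpha>[OF y'(1)] far_hom[OF w(3) y'(2)]] nat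
      by simp
    also have "\<dots> = far ?w (vsnd x) \<cdot>\<^bsub>B\<^esub> ?\<alpha> (vfst x)"
      using Comp_assoc[OF u(5) \<alpha>[OF x'(1)] far_hom[OF w(3) far_hom[OF u'(3) k]] far_hom[OF w(3) y'(2)]]
        far_Comp[OF w(3) far_hom[OF u'(3) k] y'(2)] eq by simp
    finally show ?thesis
      using obj[OF x] obj[OF y] far_hom[OF v(3) k] by (simp add: tri_slice[OF u(3) b])
  qed
  note F = is_functor_triple_functor[OF T(1) T'(1) v(3) obj arr, folded T(2) T'(2)]
  show "small_functor (slice ?u' b') (slice ?u (fob ?w b')) U"
    using F(1) small_slice(1)[OF left b'] small_slice(1)[OF right b]
    by (simp add: small_functor_def U_def square_slice_map_def w(7))
  show "slice_forget ?u (fob ?w b') \<odot> U = ?v \<odot> slice_forget ?u' b'"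
    using F(2) by (simp add: U_def square_slice_map_def slice_forget_def w(7) u(6) u'(6))
  show "x \<in> Obj (slice ?u' b') \<Longrightarrow> fob U x = ?\<phi> x"
    by (simp add: U_def square_slice_map_def triple_functor_def w(7))
qed

text \<open>At (a', g') both sides are w(g') after the component of the 2-cell at a'. This explains
  the formula of the comparison functor: pasting \<open>S\<close> with the slice square of
  \<open>sq_left S\<close> at \<open>b'\<close> gives the slice square of \<open>sq_right S\<close>
  at w(b'), restricted along that functor.\<close>

lemma slice_cell_paste:
  assumes b': "b' \<in> Obj B'"
  shows "hcomp (sq_cell (slice_square (sq_right S) (fob (sq_bot S) b'))) (idN (square_slice_map S b')) =
    vcomp (hcomp (idN (sq_bot S)) (sq_cell (slice_square (sq_left S) b')))
      (hcomp (sq_cell S) (idN (slice_forget (sq_left S) b')))"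
proof -
  let ?v = "sq_top S" and ?w = "sq_bot S" and ?u' = "sq_left S" and ?u = "sq_right S"
  let ?U = "square_slice_map S b'" and ?b = "fob ?w b'"
  let ?r' = "slice_forget ?u' b'" and ?r = "slice_forget ?u ?b"
  let ?K = "slice ?u' b'" and ?L = "slice ?u ?b"
  note v = small_functorD[OF top] and w = small_functorD[OF bot]
    and u' = small_functorD[OF left] and u = small_functorD[OF right]
  have b: "?b \<in> Obj B"
    using fob_in[OF w(3) b'] .
  note U = square_slice_map_functor[OF b']
  note fU = small_functorD(3)[OF U(1)]
  note r = small_slice[OF right b] and r' = small_slice[OF left b']
  note t = small_functor_to_terminal[OF r(1)] and t' = small_functor_to_terminal[OF r'(1)]
  note p = small_functor_point[OF u(2) b] and p' = small_functor_point[OF u'(2) b']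
  interpret R: small_square "slice_square ?u ?b" ?L A terminal_cat B
    using small_square_slice[OF right b] .
  interpret R': small_square "slice_square ?u' b'" ?K A' terminal_cat B'
    using small_square_slice[OF left b'] .
  note n = R.cell[unfolded slice_square_simps u(7)] and n' = R'.cell[unfolded slice_square_simps u'(7)]
  note ur = small_functorD(3)[OF small_functor_compF[OF r(2) right]]
  note ur' = small_functorD(3)[OF small_functor_compF[OF r'(2) left]]
  note uv = small_functorD(3)[OF small_functor_compF[OF top right]]
  note fr' = small_functorD(3)[OF r'(2)]
  \<comment> \<open>The two pasted cells have sources and targets that are bracketed differently.
    Composition being strict, these are equal functors, so comparing components is
    meaningful.\<close>
  have 1: "(?u \<odot> ?v) \<odot> ?r' = (?u \<odot> ?r) \<odot> ?U"
    unfolding compF_assoc[OF fr' v(6)] compF_assoc[OF fU small_functorD(6)[OF r(2)]] U(2) ..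
  have 2: "?w \<odot> (?u' \<odot> ?r') = (?w \<odot> ?u') \<odot> ?r'"
    unfolding compF_assoc[OF fr' u'(6)] ..
  have 3: "?w \<odot> (point B' b' \<odot> to_terminal ?K) = (point B ?b \<odot> to_terminal ?L) \<odot> ?U"
    unfolding compF_assoc[OF fU small_functorD(6)[OF t]] to_terminal_compF[OF U(1)]
      compF_assoc[OF small_functorD(3)[OF t'] small_functorD(6)[OF p'], symmetric]
      compF_point[OF bot b'] ..
  have N: "is_nat ((?u \<odot> ?v) \<odot> ?r') (?w \<odot> (?u' \<odot> ?r')) (hcomp (sq_cell S) (idN ?r'))"
    using is_nat_whisker_right[OF cell uv fr'] unfolding 2 .
  have uvr: "is_functor ?K B ((?u \<odot> ?v) \<odot> ?r')"
    using is_functor_compF[OF fr' uv] .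
  show ?thesis
  proof (rule nat_eqI[OF _ _ uvr])
    show "is_nat ((?u \<odot> ?v) \<odot> ?r') (?w \<odot> (point B' b' \<odot> to_terminal ?K))
        (hcomp (sq_cell (slice_square ?u ?b)) (idN ?U))"
      using is_nat_whisker_right[OF n ur fU] unfolding 1 3 .
    show "is_nat ((?u \<odot> ?v) \<odot> ?r') (?w \<odot> (point B' b' \<odot> to_terminal ?K))
        (vcomp (hcomp (idN ?w) (sq_cell (slice_square ?u' b'))) (hcomp (sq_cell S) (idN ?r')))"
      using is_nat_vcomp[OF N is_nat_whisker_left[OF n' ur' w(3)] uvr] .
    show "cmp (hcomp (sq_cell (slice_square ?u ?b)) (idN ?U)) x =
        cmp (vcomp (hcomp (idN ?w) (sq_cell (slice_square ?u' b'))) (hcomp (sq_cell S) (idN ?r'))) x"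
      if x: "x \<in> Obj ?K" for x
      using x fob_in[OF fU x]
      unfolding cmp_vcomp[OF N uvr x] cmp_whisker_right[OF n ur fU x] cmp_whisker_right[OF cell uv fr' x]
        cmp_whisker_left[OF n' ur' w(3) x]
      by (simp add: U(3) r'(3))
  qed
qed

end

section \<open>Prederivators\<close>

text \<open>
  For \<open>G = q\<^sup>*X\<close> this is the condition in the definition of a \<open>\<D>\<close>-equivalence; for \<open>G = w\<^sup>*F\<close> it says that
  \<open>q\<^sub>* w\<^sup>* F \<rightarrow> p\<^sub>* u\<^sup>* w\<^sup>* F\<close> is invertible.
\<close>

definition cohom_iso_at ::
    "('v::universe, 'o, 'm) prederiv \<Rightarrow> 'v scat \<Rightarrow> 'v scat \<Rightarrow> 'v sfun \<Rightarrow> 'o \<Rightarrow> bool" where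
  "cohom_iso_at D A B u G \<longleftrightarrow> (\<forall>Y\<in>Obj (D0 D terminal_cat). bij_betw (far (D1 D u))
     (hom (D0 D B) (fob (D1 D (to_terminal B)) Y) G)
     (hom (D0 D A) (fob (D1 D (to_terminal A)) Y) (fob (D1 D u) G)))"

text \<open>
  For \<open>M = u\<^sub>* F\<close> with counit \<open>\<epsilon>\<close> this is the transpose \<open>u'\<^sup>* w\<^sup>* u\<^sub>* F \<rightarrow> v\<^sup>* F\<close> of the base change
  morphism, so that the latter is invertible if and only if the mate is couniversal.
\<close>

definition mate ::
    "('v::universe, 'o, 'm) prederiv \<Rightarrow> 'v square \<Rightarrow> 'o \<Rightarrow> 'm \<Rightarrow> 'm" where
  "mate D S M \<epsilon> = far (D1 D (sq_top S)) \<epsilon> \<cdot>\<^bsub>D0 D (Src (sq_top S))\<^esub> cmp (D2 D (sq_cell S)) M"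

text \<open>Quantifying over all couniversal arrows makes the condition independent of a choice of
  direct image. It is not vacuous once cohomological direct images exist.\<close>

definition base_change_at :: "('v::universe, 'o, 'm) prederiv \<Rightarrow> 'v square \<Rightarrow> 'o \<Rightarrow> bool" where
  "base_change_at D S F \<longleftrightarrow> (\<forall>M \<epsilon>. couniversal (D1 D (sq_right S)) F M \<epsilon> \<longrightarrow>
     couniversal (D1 D (sq_left S)) (fob (D1 D (sq_top S)) F) (fob (D1 D (sq_bot S)) M) (mate D S M \<epsilon>))"

text \<open>Read off the record without naturality of \<open>\<alpha>\<close>, so the components of
  base change morphisms are available without first proving that these are natural
  transformations.\<close>

lemma cmp_vcomp_raw:
  "x \<in> Obj (Src (NSrc \<alpha>)) \<Longrightarrow> cmp (vcomp \<beta> \<alpha>) x = cmp \<beta> x \<cdot>\<^bsub>Trg (NSrc \<alpha>)\<^esub> cmp \<alpha> x"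
  by (simp add: vcomp_def)

lemma NSrc_simps:
  "NSrc (vcomp \<beta> \<alpha>) = NSrc \<alpha>" "NSrc (hcomp \<beta> \<alpha>) = NSrc \<beta> \<odot> NSrc \<alpha>"
  "Src (G \<odot> F) = Src F" "Trg (G \<odot> F) = Trg G" "Src (idF C) = C" "Trg (idF C) = C"
  by (simp_all add: vcomp_def hcomp_def compF_def idF_def)

section \<open>Values of a prederivator on functors and 2-cells\<close>

locale prederivator_loc =
  fixes D :: "('v::universe, 'o, 'm) prederiv"
  assumes pre: "prederivator D"
begin

abbreviation ob where "ob u \<equiv> fob (D1 D u)"
abbreviation ar where "ar u \<equiv> far (D1 D u)"
abbreviation cell_at where "cell_at \<alpha> \<equiv> cmp (D2 D \<alpha>)"

lemma D1: "small_functor A B u \<Longrightarrow> is_functor (D0 D B) (D0 D A) (D1 D u)"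
  using pre unfolding prederivator_def by meson

lemma D0: "small_cat A \<Longrightarrow> category (D0 D A)"
  using pre unfolding prederivator_def by meson

lemma D2:
  "small_functor A B u \<Longrightarrow> small_functor A B v \<Longrightarrow> is_nat u v \<alpha> \<Longrightarrow> is_nat (D1 D v) (D1 D u) (D2 D \<alpha>)"
  using pre unfolding prederivator_def by meson

lemma D1_compF: "small_functor A B u \<Longrightarrow> small_functor B C v \<Longrightarrow> D1 D (v \<odot> u) = D1 D u \<odot> D1 D v"
  using pre unfolding prederivator_def by meson

lemma D1_idF: "small_cat A \<Longrightarrow> D1 D (idF A) = idF (D0 D A)"
  using pre unfolding prederivator_def by meson

lemma D2_idN: "small_functor A B u \<Longrightarrow> D2 D (idN u) = idN (D1 D u)"
  using pre unfolding prederivator_def by meson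

lemma ob_compF:
  assumes "small_functor A B u" "small_functor B C v" "X \<in> Obj (D0 D C)"
  shows "ob (v \<odot> u) X = ob u (ob v X)"
  unfolding D1_compF[OF assms(1,2)] using fob_compF[OF D1[OF assms(2)] assms(3)] .

lemma ar_compF:
  assumes "small_functor A B u" "small_functor B C v" "f \<in> hom (D0 D C) X Y"
  shows "ar (v \<odot> u) f = ar u (ar v f)"
  unfolding D1_compF[OF assms(1,2)] using far_compF[OF D1[OF assms(2)] assms(3)] .

lemma cell_at_hom:
  assumes "small_functor A B u" "small_functor A B v" "is_nat u v \<alpha>" "X \<in> Obj (D0 D B)"
  shows "cell_at \<alpha> X \<in> hom (D0 D A) (ob v X) (ob u X)"
  using nat_cmp[OF D2[OF assms(1-3)] D1[OF assms(2)] assms(4)] .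

lemma cell_at_natural:
  assumes "small_functor A B u" "small_functor A B v" "is_nat u v \<alpha>" "f \<in> hom (D0 D B) X Y"
  shows "cell_at \<alpha> Y \<cdot>\<^bsub>D0 D A\<^esub> ar v f = ar u f \<cdot>\<^bsub>D0 D A\<^esub> cell_at \<alpha> X"
  using nat_naturality[OF D2[OF assms(1-3)] D1[OF assms(2)] assms(4)] .

lemma D2_hcomp:
  assumes "small_functor A B u" "small_functor A B v" "small_functor B C w" "small_functor B C x"
    and "is_nat u v \<alpha>" "is_nat w x \<beta>"
  shows "D2 D (hcomp \<beta> \<alpha>) = hcomp (D2 D \<alpha>) (D2 D \<beta>)"
  using pre assms unfolding prederivator_def by meson

text \<open>A prederivator reverses 1-arrows: whiskering with \<open>w\<close> after the functors
  becomes evaluation at w^* X, while in the next lemma whiskering with \<open>u\<close> before them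
  becomes application of u^*.\<close>

lemma cell_at_whisker_left:
  assumes "small_functor A B u" "small_functor A B v" "is_nat u v \<alpha>" "small_functor B C w"
    and "X \<in> Obj (D0 D C)"
  shows "cell_at (hcomp (idN w) \<alpha>) X = cell_at \<alpha> (ob w X)"
proof -
  have "D2 D (hcomp (idN w) \<alpha>) = hcomp (D2 D \<alpha>) (idN (D1 D w))"
    using D2_hcomp[OF assms(1,2,4,4,3) is_nat_idN[OF small_functorD(3)[OF assms(4)]]]
    by (simp add: D2_idN[OF assms(4)])
  then show ?thesis
    using cmp_whisker_right[OF D2[OF assms(1-3)] D1[OF assms(2)] D1[OF assms(4)] assms(5)] by simp
qed

lemma cell_at_whisker_right:
  assumes "small_functor B C w" "small_functor B C x" "is_nat w x \<beta>" "small_functor A B u"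
    and "X \<in> Obj (D0 D C)"
  shows "cell_at (hcomp \<beta> (idN u)) X = ar u (cell_at \<beta> X)"
proof -
  have "D2 D (hcomp \<beta> (idN u)) = hcomp (idN (D1 D u)) (D2 D \<beta>)"
    using D2_hcomp[OF assms(4,4,1,2) is_nat_idN[OF small_functorD(3)[OF assms(4)]] assms(3)]
    by (simp add: D2_idN[OF assms(4)])
  then show ?thesis
    using cmp_whisker_left[OF D2[OF assms(1-3)] D1[OF assms(2)] D1[OF assms(4)] assms(5)] by simp
qed

lemma cell_at_vcomp:
  assumes "small_functor A B u" "small_functor A B v" "small_functor A B w"
    and "is_nat u v \<alpha>" "is_nat v w \<beta>" "X \<in> Obj (D0 D B)"
  shows "cell_at (vcomp \<beta> \<alpha>) X = cell_at \<alpha> X \<cdot>\<^bsub>D0 D A\<^esub> cell_at \<beta> X"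
proof -
  have "D2 D (vcomp \<beta> \<alpha>) = vcomp (D2 D \<alpha>) (D2 D \<beta>)"
    using pre assms unfolding prederivator_def by meson
  then show ?thesis
    using cmp_vcomp[OF D2[OF assms(2,3,5)] D1[OF assms(3)] assms(6)] by simp
qed

lemma ex_couniversal:
  assumes "cohom_direct_images D" "small_functor A B u" "F \<in> Obj (D0 D A)"
  obtains M \<epsilon> where "couniversal (D1 D u) F M \<epsilon>"
proof -
  obtain R \<eta> \<epsilon> where "adjunction (D1 D u) R \<eta> \<epsilon>"
    using assms(1,2) unfolding cohom_direct_images_def by blast
  then interpret adj "D1 D u" R \<eta> \<epsilon> "D0 D B" "D0 D A"
    using D1[OF assms(2)] by unfold_locales
  show thesis
    using that[OF couniversal_counit[OF assms(3)]] .
qed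

text \<open>Since p^* = u^* q^*, composing u^* with the bijection Hom(Y, N) \<rightarrow> Hom(q^* Y,
  G) given by \<open>\<epsilon>\<close> yields the map that tests couniversality of
  \<open>ar u \<epsilon>\<close>. Cancelling the bijection gives the equivalence.\<close>

lemma cohom_iso_at_iff:
  assumes u: "small_functor A B u" and N: "couniversal (D1 D (to_terminal B)) G N \<epsilon>"
  shows "cohom_iso_at D A B u G \<longleftrightarrow> couniversal (D1 D (to_terminal A)) (ob u G) N (ar u \<epsilon>)"
proof -
  note p = small_functor_to_terminal[OF small_functorD(1)[OF u]]
    and q = small_functor_to_terminal[OF small_functorD(2)[OF u]]
  note p' = D1[OF p] and q' = D1[OF q] and u' = D1[OF u]
  note c = functor_cats[OF u']
  note n = couniversalD[OF N q']
  have pq: "ob (to_terminal A) Y = ob u (ob (to_terminal B) Y)" if "Y \<in> Obj (D0 D terminal_cat)" for Y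
    using ob_compF[OF u q that] by (simp add: to_terminal_compF[OF u])
  have eq: "ar u \<epsilon> \<cdot>\<^bsub>D0 D A\<^esub> ar (to_terminal A) g = ar u (\<epsilon> \<cdot>\<^bsub>D0 D B\<^esub> ar (to_terminal B) g)"
    if "g \<in> hom (D0 D terminal_cat) Y N" for g Y
    using ar_compF[OF u q that] far_Comp[OF u' far_hom[OF q' that] n(2)]
    by (simp add: to_terminal_compF[OF u])
  have "bij_betw (ar u) (hom (D0 D B) (ob (to_terminal B) Y) G)
      (hom (D0 D A) (ob (to_terminal A) Y) (ob u G)) \<longleftrightarrow>
    bij_betw (\<lambda>g. ar u \<epsilon> \<cdot>\<^bsub>D0 D A\<^esub> ar (to_terminal A) g) (hom (D0 D terminal_cat) Y N)
      (hom (D0 D A) (ob (to_terminal A) Y) (ob u G))" if Y: "Y \<in> Obj (D0 D terminal_cat)" for Y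
  proof -
    have "bij_betw (\<lambda>g. ar u \<epsilon> \<cdot>\<^bsub>D0 D A\<^esub> ar (to_terminal A) g) (hom (D0 D terminal_cat) Y N)
        (hom (D0 D A) (ob (to_terminal A) Y) (ob u G)) \<longleftrightarrow>
      bij_betw (ar u \<circ> (\<lambda>g. \<epsilon> \<cdot>\<^bsub>D0 D B\<^esub> ar (to_terminal B) g)) (hom (D0 D terminal_cat) Y N)
        (hom (D0 D A) (ob (to_terminal A) Y) (ob u G))"
      by (rule bij_betw_cong) (simp add: eq)
    then show ?thesis
      using bij_betw_comp_iff[OF n(3)[OF Y]] by simp
  qed
  moreover have "ar u \<epsilon> \<in> hom (D0 D A) (ob (to_terminal A) N) (ob u G)"
    using far_hom[OF u' n(2)] pq[OF n(1)] by simp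
  ultimately show ?thesis
    using n(1) functor_cats(3,4)[OF p'] by (simp add: cohom_iso_at_def couniversal_def)
qed

lemma D_equivalence_iff:
  assumes u: "small_functor A B u"
  shows "D_equivalence D A B u \<longleftrightarrow>
    (\<forall>X\<in>Obj (D0 D terminal_cat). cohom_iso_at D A B u (ob (to_terminal B) X))"
proof -
  note q = small_functor_to_terminal[OF small_functorD(2)[OF u]]
  have "ob u (ob (to_terminal B) Y) = ob (to_terminal A) Y" if "Y \<in> Obj (D0 D terminal_cat)" for Y
    using ob_compF[OF u q that] by (simp add: to_terminal_compF[OF u])
  then show ?thesis
    using u by (auto simp: D_equivalence_def cohom_iso_at_def Let_def)
qed

text \<open>On maps between constant diagrams the inverse of U^* is G^*. The composite G^* U^* is
  the identity because U G is, and U^* G^* is restriction along G U, which fixes such maps by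
  naturality of the 2-cell induced by \<open>\<eta>\<close>.\<close>

lemma D_equivalence_section:
  assumes U: "small_functor K L U" and G: "small_functor L K G"
    and UG: "U \<odot> G = idF L" and \<eta>: "is_nat (idF K) (G \<odot> U) \<eta>"
  shows "D_equivalence D K L U"
proof -
  let ?p = "to_terminal K" and ?q = "to_terminal L"
  note K = small_functorD(1)[OF U] and L = small_functorD(2)[OF U]
  note p = small_functor_to_terminal[OF K] and q = small_functor_to_terminal[OF L]
  note GU = small_functor_compF[OF U G]
  have idK: "small_functor K K (idF K)"
    using K is_functor_idF[of K] by (simp add: small_functor_def small_cat_def)
  \<comment> \<open>The terminal category has a single arrow, so \<open>\<eta>\<close> becomes an
    identity there. Under \<open>D2\<close> this says that the 2-cell induced by
    \<open>\<eta>\<close> has identities as components at constant diagrams.\<close>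
  have "hcomp (idN ?p) \<eta> = idN ?p"
  proof (rule nat_eqI[OF _ is_nat_idN])
    have "?p \<odot> idF K = ?p" "?p \<odot> (G \<odot> U) = ?p"
      using to_terminal_compF[OF idK] to_terminal_compF[OF GU] by auto
    then show n: "is_nat ?p ?p (hcomp (idN ?p) \<eta>)"
      using is_nat_whisker_left[OF \<eta> small_functorD(3)[OF idK] small_functorD(3)[OF p]] by simp
    show "cmp (hcomp (idN ?p) \<eta>) x = cmp (idN ?p) x" if x: "x \<in> Obj K" for x
      using homD(1)[OF nat_cmp[OF n small_functorD(3)[OF p] x]]
        homD(1)[OF nat_cmp[OF is_nat_idN[OF small_functorD(3)[OF p]] small_functorD(3)[OF p] x]]
      by (simp add: terminal_simps)
  qed (fact small_functorD(3)[OF p])+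
  then have \<eta>_p: "cell_at \<eta> (ob ?p X) = Id (D0 D K) (ob ?p X)" if "X \<in> Obj (D0 D terminal_cat)" for X
    using cell_at_whisker_left[OF idK GU \<eta> p that] cmp_idN[OF D1[OF p] that] by (simp add: D2_idN[OF p])
  have pq: "ob ?p Y = ob U (ob ?q Y)" and qp: "ob ?q Y = ob G (ob ?p Y)"
    if "Y \<in> Obj (D0 D terminal_cat)" for Y
    using ob_compF[OF U q that] ob_compF[OF G p that]
    by (simp_all add: to_terminal_compF[OF U] to_terminal_compF[OF G])
  have "bij_betw (ar U) (hom (D0 D L) (ob ?q Y) (ob ?q X)) (hom (D0 D K) (ob ?p Y) (ob ?p X))"
    if Y: "Y \<in> Obj (D0 D terminal_cat)" and X: "X \<in> Obj (D0 D terminal_cat)" for X Y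
  proof (rule bij_betw_byWitness[where f' = "ar G"])
    show "\<forall>f\<in>hom (D0 D L) (ob ?q Y) (ob ?q X). ar G (ar U f) = f"
      using ar_compF[OF G U] by (simp add: UG D1_idF[OF L] idF_simps(2))
    show "\<forall>g\<in>hom (D0 D K) (ob ?p Y) (ob ?p X). ar U (ar G g) = g"
    proof
      fix g assume g: "g \<in> hom (D0 D K) (ob ?p Y) (ob ?p X)"
      have "ar (G \<odot> U) g \<in> hom (D0 D K) (ob ?p Y) (ob ?p X)"
        using far_hom[OF D1[OF U] far_hom[OF D1[OF G] g]] X Y by (simp add: ar_compF[OF U G g] pq[symmetric] qp[symmetric])
      then have "ar (G \<odot> U) g = g"
        using cell_at_natural[OF idK GU \<eta> g] Comp_Id_left[OF D0[OF K]] Comp_Id_right[OF D0[OF K] g]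
        by (simp add: \<eta>_p X Y D1_idF[OF K] idF_simps(2)[OF g])
      then show "ar U (ar G g) = g"
        by (simp add: ar_compF[OF U G g])
    qed
    show "ar U ` hom (D0 D L) (ob ?q Y) (ob ?q X) \<subseteq> hom (D0 D K) (ob ?p Y) (ob ?p X)"
      using far_hom[OF D1[OF U]] X Y by (auto simp: pq)
    show "ar G ` hom (D0 D K) (ob ?p Y) (ob ?p X) \<subseteq> hom (D0 D L) (ob ?q Y) (ob ?q X)"
      using far_hom[OF D1[OF G]] X Y by (auto simp: qp)
  qed
  then show ?thesis
    using U by (simp add: D_equivalence_def Let_def)
qed

end

section \<open>Mates and base change at a single object\<close>

locale prederivator_square = prederivator_loc D + small_square S A' A B' B
  for D :: "('v::universe, 'o, 'm) prederiv" and S :: "'v square" and A' A B' B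
begin

abbreviation "v \<equiv> sq_top S"
abbreviation "w \<equiv> sq_bot S"
abbreviation "u' \<equiv> sq_left S"
abbreviation "u \<equiv> sq_right S"
abbreviation "\<alpha> \<equiv> sq_cell S"

lemmas v_star = D1[OF top] and w_star = D1[OF bot] and u'_star = D1[OF left] and u_star = D1[OF right]

lemma cat_A': "category (D0 D A')"
  using functor_cats(2)[OF v_star] .

lemma mate_eq: "mate D S M \<epsilon> = ar v \<epsilon> \<cdot>\<^bsub>D0 D A'\<^esub> cell_at \<alpha> M"
  by (simp add: mate_def small_functorD(6)[OF top])

lemma \<alpha>_hom:
  assumes "M \<in> Obj (D0 D B)"
  shows "cell_at \<alpha> M \<in> hom (D0 D A') (ob u' (ob w M)) (ob v (ob u M))"
  using cell_at_hom[OF small_functor_compF[OF top right] small_functor_compF[OF left bot] cell assms]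
  by (simp add: ob_compF[OF top right assms] ob_compF[OF left bot assms])

lemma \<alpha>_natural:
  assumes "f \<in> hom (D0 D B) M N"
  shows "cell_at \<alpha> N \<cdot>\<^bsub>D0 D A'\<^esub> ar u' (ar w f) = ar v (ar u f) \<cdot>\<^bsub>D0 D A'\<^esub> cell_at \<alpha> M"
  using cell_at_natural[OF small_functor_compF[OF top right] small_functor_compF[OF left bot] cell assms]
  by (simp add: ar_compF[OF top right assms] ar_compF[OF left bot assms])

lemma mate_hom:
  assumes "M \<in> Obj (D0 D B)" "\<epsilon> \<in> hom (D0 D A) (ob u M) F"
  shows "mate D S M \<epsilon> \<in> hom (D0 D A') (ob u' (ob w M)) (ob v F)"
  unfolding mate_eq using Comp_hom[OF cat_A' \<alpha>_hom[OF assms(1)] far_hom[OF v_star assms(2)]] .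

text \<open>One couniversal arrow suffices: any other one is \<open>\<epsilon>\<close> precomposed
  with u^* f for an isomorphism \<open>f\<close>. By naturality of the 2-cell the mates differ by
  u'^* w^* f, and an isomorphism preserves couniversality.\<close>

lemma base_change_atI:
  assumes M: "couniversal (D1 D u) F M \<epsilon>"
    and mate: "couniversal (D1 D u') (ob v F) (ob w M) (mate D S M \<epsilon>)"
  shows "base_change_at D S F"
  unfolding base_change_at_def
proof (intro allI impI)
  fix N \<delta> assume N: "couniversal (D1 D u) F N \<delta>"
  note m = couniversalD[OF M u_star] and n = couniversalD[OF N u_star]
  obtain f where f: "f \<in> hom (D0 D B) N M" "\<epsilon> \<cdot>\<^bsub>D0 D A\<^esub> ar u f = \<delta>"
    using couniversal_factor[OF M u_star n(1,2)] .
  have iso: "is_iso (D0 D B) f"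
    using couniversal_compare[OF N M u_star f] .
  have "mate D S M \<epsilon> \<cdot>\<^bsub>D0 D A'\<^esub> ar u' (ar w f) = mate D S N \<delta>"
    unfolding mate_eq f(2)[symmetric] far_Comp[OF v_star far_hom[OF u_star f(1)] m(2)]
      Comp_assoc[OF cat_A' far_hom[OF u'_star far_hom[OF w_star f(1)]] \<alpha>_hom[OF m(1)] far_hom[OF v_star m(2)]]
      Comp_assoc[OF cat_A' \<alpha>_hom[OF n(1)] far_hom[OF v_star far_hom[OF u_star f(1)]] far_hom[OF v_star m(2)]]
      \<alpha>_natural[OF f(1)] ..
  then show "couniversal (D1 D u') (ob v F) (ob w N) (mate D S N \<delta>)"
    using couniversal_precomp_iso[OF mate u'_star far_hom[OF w_star f(1)] functor_is_iso[OF w_star f(1) iso]]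
    by simp
qed

text \<open>At \<open>F\<close> the three factors of \<open>cohom_bc_mor\<close> collapse to
  \<open>R'\<close> of the mate after the unit, because \<open>R'\<close> preserves the composition
  that defines the mate. This transpose is then compared with the counit of
  \<open>R'\<close>.\<close>

lemma nat_iso_cohom_bc_mor_iff:
  assumes R: "adjunction (D1 D u) R \<eta> \<epsilon>" and R': "adjunction (D1 D u') R' \<eta>' \<epsilon>'"
  shows "nat_iso (cohom_bc_mor D S R \<epsilon> R' \<eta>') \<longleftrightarrow> (\<forall>F\<in>Obj (D0 D A). base_change_at D S F)"
proof -
  interpret R: adj "D1 D u" R \<eta> \<epsilon> "D0 D B" "D0 D A"
    using R u_star by unfold_locales
  interpret R': adj "D1 D u'" R' \<eta>' \<epsilon>' "D0 D B'" "D0 D A'"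
    using R' u'_star by unfold_locales
  let ?c = "cohom_bc_mor D S R \<epsilon> R' \<eta>'"
  have Src: "Src (NSrc ?c) = D0 D A" and Trg: "Trg (NSrc ?c) = D0 D B'"
    using functor_cats[OF R.R] nat_functors[OF R'.unit is_functor_idF[OF R'.cats(1)]]
    by (simp_all add: cohom_bc_mor_def Let_def NSrc_simps idN_simps)
  have "is_iso (D0 D B') (cmp ?c F) \<longleftrightarrow> base_change_at D S F" if F: "F \<in> Obj (D0 D A)" for F
  proof -
    note M = R.couniversal_counit[OF F]
    note m = couniversalD[OF M u_star]
    note wM = fob_in[OF w_star m(1)] and vF = fob_in[OF v_star F]
    note \<eta>' = R'.unit_hom[OF wM]
    note k = mate_hom[OF m(1,2)]
    have uv: "is_functor (D0 D B) (D0 D A') (D1 D (w \<odot> u'))"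
      using D1[OF small_functor_compF[OF left bot]] .
    note nc = D2[OF small_functor_compF[OF top right] small_functor_compF[OF left bot] cell]
    have 1: "cmp (hcomp (idN (R' \<odot> D1 D v)) \<epsilon>) F = far R' (ar v (cmp \<epsilon> F))"
      using cmp_whisker_left[OF R.counit is_functor_compF[OF R.R u_star] is_functor_compF[OF v_star R'.R] F]
      by (simp add: far_compF[OF v_star m(2)])
    have 2: "cmp (hcomp (idN R') (hcomp (D2 D \<alpha>) (idN R))) F = far R' (cell_at \<alpha> (fob R F))"
      using cmp_whisker_left[OF is_nat_whisker_right[OF nc uv R.R] is_functor_compF[OF R.R uv] R'.R F]
        cmp_whisker_right[OF nc uv R.R F] by simp
    have 3: "cmp (hcomp \<eta>' (idN (D1 D w \<odot> R))) F = cmp \<eta>' (ob w (fob R F))"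
      using cmp_whisker_right[OF R'.unit is_functor_idF[OF R'.cats(1)] is_functor_compF[OF R.R w_star] F]
      by (simp add: fob_compF[OF R.R F])
    have "cmp ?c F = far R' (ar v (cmp \<epsilon> F)) \<cdot>\<^bsub>D0 D B'\<^esub>
        (far R' (cell_at \<alpha> (fob R F)) \<cdot>\<^bsub>D0 D B'\<^esub> cmp \<eta>' (ob w (fob R F)))"
      using F Src Trg unfolding cohom_bc_mor_def Let_def
      by (simp add: cmp_vcomp_raw NSrc_simps(1) 1 2 3)
    also have "\<dots> = far R' (mate D S (fob R F) (cmp \<epsilon> F)) \<cdot>\<^bsub>D0 D B'\<^esub> cmp \<eta>' (ob w (fob R F))"
      using Comp_assoc[OF R'.cats(1) \<eta>' far_hom[OF R'.R \<alpha>_hom[OF m(1)]] far_hom[OF R'.R far_hom[OF v_star m(2)]]]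
        far_Comp[OF R'.R \<alpha>_hom[OF m(1)] far_hom[OF v_star m(2)]] by (simp add: mate_eq)
    finally have c: "cmp ?c F = \<dots>" .
    have "couniversal (D1 D u') (ob v F) (ob w (fob R F)) (mate D S (fob R F) (cmp \<epsilon> F)) \<longleftrightarrow>
        is_iso (D0 D B') (cmp ?c F)"
      unfolding c
      by (rule couniversal_iff_iso[OF R'.couniversal_counit[OF vF] u'_star R'.transpose_hom[OF wM k]
            R'.counit_transpose[OF wM k]])
    then show ?thesis
      using base_change_atI[OF M] M unfolding base_change_at_def by blast
  qed
  then show ?thesis
    unfolding nat_iso_def Src Trg by blast
qed

text \<open>The right-hand side mentions no adjoint, so one choice of adjoints decides for all those
  over which \<open>cohom_base_change\<close> quantifies.\<close>

lemma cohom_base_change_iff: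
  assumes "cohom_direct_images D"
  shows "cohom_base_change D S \<longleftrightarrow> (\<forall>F\<in>Obj (D0 D A). base_change_at D S F)"
proof -
  obtain R \<eta> \<epsilon> R' \<eta>' \<epsilon>' where "adjunction (D1 D u) R \<eta> \<epsilon>" "adjunction (D1 D u') R' \<eta>' \<epsilon>'"
    using assms left right unfolding cohom_direct_images_def by metis
  then show ?thesis
    unfolding cohom_base_change_def using nat_iso_cohom_bc_mor_iff by blast
qed

end

context prederivator_loc
begin

lemma base_change_at_slice:
  assumes "complete_prederivator D" and u: "small_functor A B u" and b: "b \<in> Obj B" and F: "F \<in> Obj (D0 D A)"
  shows "base_change_at D (slice_square u b) F"
proof -
  interpret small_square "slice_square u b" "slice u b" A terminal_cat B
    using small_square_slice[OF u b] .
  interpret prederivator_square D "slice_square u b" "slice u b" A terminal_cat B ..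
  show ?thesis
    using assms cohom_base_change_iff unfolding complete_prederivator_def by blast
qed

end

context prederivator_square
begin

text \<open>Fixing \<open>F\<close> makes the criterion usable twice: for the given square with
  arbitrary \<open>F\<close>, and for coslice squares, where \<open>F\<close> is an object over e
  and becomes constant on the slices.\<close>

lemma base_change_at_iff_slices:
  assumes cons: "conservative D" and compl: "complete_prederivator D" and F: "F \<in> Obj (D0 D A)"
  shows "base_change_at D S F \<longleftrightarrow> (\<forall>b'\<in>Obj B'. cohom_iso_at D (slice u' b') (slice u (fob w b'))
    (square_slice_map S b') (ob (slice_forget u (fob w b')) F))"
proof -
  have di: "cohom_direct_images D"
    using compl unfolding complete_prederivator_def by blast
  obtain M \<epsilon> where M: "couniversal (D1 D u) F M \<epsilon>"
    using ex_couniversal[OF di right F] .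
  note m = couniversalD[OF M u_star]
  note vF = fob_in[OF v_star F] and wM = fob_in[OF w_star m(1)]
  obtain N \<delta> where N: "couniversal (D1 D u') (ob v F) N \<delta>"
    using ex_couniversal[OF di left vF] .
  note n = couniversalD[OF N u'_star]
  define \<psi> where "\<psi> = mate D S M \<epsilon>"
  have \<psi>: "\<psi> \<in> hom (D0 D A') (ob u' (ob w M)) (ob v F)"
    unfolding \<psi>_def using mate_hom[OF m(1,2)] .
  \<comment> \<open>\<open>f\<close> is the base change morphism w^* u_* F \<rightarrow> u'_* v^* F,
    obtained by factoring its transpose through a couniversal arrow.\<close>
  obtain f where f: "f \<in> hom (D0 D B') (ob w M) N" "\<delta> \<cdot>\<^bsub>D0 D A'\<^esub> ar u' f = \<psi>"
    using couniversal_factor[OF N u'_star wM \<psi>] .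
  have "base_change_at D S F \<longleftrightarrow> couniversal (D1 D u') (ob v F) (ob w M) \<psi>"
    using base_change_atI[OF M] M unfolding base_change_at_def \<psi>_def by blast
  also have "\<dots> \<longleftrightarrow> is_iso (D0 D B') f"
    using couniversal_iff_iso[OF N u'_star f] .
  \<comment> \<open>Conservativity gives the implication from right to left; the other holds because
    functors preserve isomorphisms.\<close>
  also have "\<dots> \<longleftrightarrow> (\<forall>b'\<in>Obj B'. is_iso (D0 D terminal_cat) (ar (point B' b') f))"
    using functor_is_iso[OF D1[OF small_functor_point[OF small_functorD(2)[OF left]]] f(1)] cons
      homD(1)[OF f(1)] small_functorD(2)[OF left]
    unfolding conservative_def by blast
  also have "\<dots> \<longleftrightarrow> (\<forall>b'\<in>Obj B'. cohom_iso_at D (slice u' b') (slice u (fob w b'))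
    (square_slice_map S b') (ob (slice_forget u (fob w b')) F))"
  proof (rule ball_cong[OF refl])
    fix b' assume b': "b' \<in> Obj B'"
    let ?b = "fob w b'"
    let ?K = "slice u' b'" and ?L = "slice u ?b" and ?U = "square_slice_map S b'"
    let ?r' = "slice_forget u' b'" and ?r = "slice_forget u ?b"
    let ?\<beta>' = "sq_cell (slice_square u' b')" and ?\<beta> = "sq_cell (slice_square u ?b)"
    have b: "?b \<in> Obj B"
      using fob_in[OF small_functorD(3)[OF bot] b'] .
    note Trg = small_functorD(7)[OF right] small_functorD(7)[OF left]
    interpret Q': small_square "slice_square u' b'" ?K A' terminal_cat B'
      using small_square_slice[OF left b'] .
    interpret Q': prederivator_square D "slice_square u' b'" ?K A' terminal_cat B' ..
    interpret Q: small_square "slice_square u ?b" ?L A terminal_cat B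
      using small_square_slice[OF right b] .
    interpret Q: prederivator_square D "slice_square u ?b" ?L A terminal_cat B ..
    note U = square_slice_map_functor[OF b']
    note r' = Q'.top[simplified] and r = Q.top[simplified]
    note p = Q'.left[simplified] and q = Q.left[simplified]
    note x' = Q'.bot[simplified, unfolded Trg] and x = Q.bot[simplified, unfolded Trg]
    have x_eq: "point B ?b = w \<odot> point B' b'"
      using compF_point[OF bot b'] by simp
    have xM: "ob (point B ?b) M = ob (point B' b') (ob w M)"
      unfolding x_eq using ob_compF[OF x' bot m(1)] .
    have rF: "ob ?U (ob ?r F) = ob ?r' (ob v F)"
      using ob_compF[OF U(1) r F] ob_compF[OF r' top F] U(2) by simp
    \<comment> \<open>\<open>\<chi>\<close> comes from pasting \<open>S\<close> with the slice
      square of \<open>u'\<close> at \<open>b'\<close>, and it is computed twice: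
      \<open>\<beta>'_N\<close> factors it as the restriction of \<open>f\<close> at
      \<open>b'\<close> followed by a couniversal arrow, and \<open>mate_U\<close> shows it to be
      U^* of a couniversal arrow. Its couniversality thus means both invertibility of
      \<open>f\<close> at \<open>b'\<close> and the cohomology condition for
      \<open>?U\<close>.\<close>
    define \<chi> where "\<chi> = mate D (slice_square u' b') (ob w M) \<psi>"
    have \<beta>'_N: "mate D (slice_square u' b') N \<delta> \<cdot>\<^bsub>D0 D ?K\<^esub> ar (to_terminal ?K) (ar (point B' b') f) = \<chi>"
    proof -
      have nat: "cell_at ?\<beta>' N \<cdot>\<^bsub>D0 D ?K\<^esub> ar (to_terminal ?K) (ar (point B' b') f) =
          ar ?r' (ar u' f) \<cdot>\<^bsub>D0 D ?K\<^esub> cell_at ?\<beta>' (ob w M)"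
        using Q'.\<alpha>_natural[simplified, unfolded Trg, OF f(1)] .
      have h1: "ar (to_terminal ?K) (ar (point B' b') f) \<in> hom (D0 D ?K)
          (ob (to_terminal ?K) (ob (point B' b') (ob w M))) (ob (to_terminal ?K) (ob (point B' b') N))"
        using far_hom[OF D1[OF p] far_hom[OF D1[OF x'] f(1)]] .
      have h2: "cell_at ?\<beta>' N \<in> hom (D0 D ?K) (ob (to_terminal ?K) (ob (point B' b') N)) (ob ?r' (ob u' N))"
        and h3: "cell_at ?\<beta>' (ob w M) \<in> hom (D0 D ?K)
          (ob (to_terminal ?K) (ob (point B' b') (ob w M))) (ob ?r' (ob u' (ob w M)))"
        using Q'.\<alpha>_hom[simplified, unfolded Trg] n(1) wM by auto
      have h4: "ar ?r' \<delta> \<in> hom (D0 D ?K) (ob ?r' (ob u' N)) (ob ?r' (ob v F))"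
        using far_hom[OF D1[OF r'] n(2)] .
      have h5: "ar ?r' (ar u' f) \<in> hom (D0 D ?K) (ob ?r' (ob u' (ob w M))) (ob ?r' (ob u' N))"
        using far_hom[OF D1[OF r'] far_hom[OF u'_star f(1)]] .
      show ?thesis
        unfolding \<chi>_def Q'.mate_eq slice_square_simps Comp_assoc[OF Q'.cat_A' h1 h2 h4] nat
        unfolding Comp_assoc[OF Q'.cat_A' h3 h5 h4, symmetric] f(2)[symmetric]
          far_Comp[OF D1[OF r'] far_hom[OF u'_star f(1)] n(2)] ..
    qed
    have "base_change_at D (slice_square u' b') (ob v F)"
      using base_change_at_slice[OF compl left b' vF] .
    then have c': "couniversal (D1 D (to_terminal ?K)) (ob ?r' (ob v F)) (ob (point B' b') N)
        (mate D (slice_square u' b') N \<delta>)"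
      using N unfolding base_change_at_def by (simp add: Trg)
    have "base_change_at D (slice_square u ?b) F"
      using base_change_at_slice[OF compl right b F] .
    then have c: "couniversal (D1 D (to_terminal ?L)) (ob ?r F) (ob (point B ?b) M)
        (mate D (slice_square u ?b) M \<epsilon>)"
      using M unfolding base_change_at_def by (simp add: Trg)
    have mate_U: "ar ?U (mate D (slice_square u ?b) M \<epsilon>) = \<chi>"
    proof -
      note cl = Q.\<alpha>_hom[OF m(1)] and re = far_hom[OF D1[OF r] m(2)]
      note ur = small_functor_compF[OF r right] and xq = small_functor_compF[OF q x]
      note ur' = small_functor_compF[OF r' left] and xp = small_functor_compF[OF p x']
      note uv = small_functor_compF[OF top right] and wu' = small_functor_compF[OF left bot]
      note n\<beta> = Q.cell[simplified, unfolded Trg] and n\<beta>' = Q'.cell[simplified, unfolded Trg]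
      have 2: "w \<odot> (u' \<odot> ?r') = (w \<odot> u') \<odot> ?r'"
        unfolding compF_assoc[OF small_functorD(3)[OF r'] small_functorD(6)[OF left]] ..
      have n1: "is_nat ((u \<odot> v) \<odot> ?r') (w \<odot> (u' \<odot> ?r')) (hcomp \<alpha> (idN ?r'))"
        using is_nat_whisker_right[OF cell small_functorD(3)[OF uv] small_functorD(3)[OF r']] unfolding 2 .
      have n2: "is_nat (w \<odot> (u' \<odot> ?r')) (w \<odot> (point B' b' \<odot> to_terminal ?K)) (hcomp (idN w) ?\<beta>')"
        using is_nat_whisker_left[OF n\<beta>' small_functorD(3)[OF ur'] small_functorD(3)[OF bot]] .
      have "ar ?U (mate D (slice_square u ?b) M \<epsilon>) = ar ?U (ar ?r \<epsilon>) \<cdot>\<^bsub>D0 D ?K\<^esub> ar ?U (cell_at ?\<beta> M)"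
        unfolding Q.mate_eq using far_Comp[OF D1[OF U(1)] cl[simplified] re] by simp
      also have "ar ?U (ar ?r \<epsilon>) = ar ?r' (ar v \<epsilon>)"
        using ar_compF[OF U(1) r m(2)] ar_compF[OF r' top m(2)] U(2) by simp
      also have "ar ?U (cell_at ?\<beta> M) = cell_at (hcomp ?\<beta> (idN ?U)) M"
        using cell_at_whisker_right[OF ur xq n\<beta> U(1) m(1)] by simp
      \<comment> \<open>A prederivator reverses 2-cells as well, so the factor coming from the
        square \<open>S\<close> now stands on the left.\<close>
      also have "\<dots> = cell_at (hcomp \<alpha> (idN ?r')) M \<cdot>\<^bsub>D0 D ?K\<^esub> cell_at (hcomp (idN w) ?\<beta>') M"
        unfolding slice_cell_paste[OF b']
        using cell_at_vcomp[OF small_functor_compF[OF r' uv] small_functor_compF[OF ur' bot]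
          small_functor_compF[OF xp bot] n1 n2 m(1)] .
      also have "cell_at (hcomp \<alpha> (idN ?r')) M = ar ?r' (cell_at \<alpha> M)"
        using cell_at_whisker_right[OF uv wu' cell r' m(1)] .
      also have "cell_at (hcomp (idN w) ?\<beta>') M = cell_at ?\<beta>' (ob w M)"
        using cell_at_whisker_left[OF ur' xp n\<beta>' bot m(1)] .
      also have "ar ?r' (ar v \<epsilon>) \<cdot>\<^bsub>D0 D ?K\<^esub> (ar ?r' (cell_at \<alpha> M) \<cdot>\<^bsub>D0 D ?K\<^esub> cell_at ?\<beta>' (ob w M)) = \<chi>"
        using Comp_assoc[OF Q'.cat_A' Q'.\<alpha>_hom[OF wM, unfolded slice_square_simps Trg] far_hom[OF D1[OF r'] \<alpha>_hom[OF m(1)]]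
            far_hom[OF D1[OF r'] far_hom[OF v_star m(2)]]]
          far_Comp[OF D1[OF r'] \<alpha>_hom[OF m(1)] far_hom[OF v_star m(2)]]
        by (simp add: \<chi>_def \<psi>_def mate_eq Q'.mate_eq)
      finally show ?thesis .
    qed
    have "is_iso (D0 D terminal_cat) (ar (point B' b') f) \<longleftrightarrow>
        couniversal (D1 D (to_terminal ?K)) (ob ?r' (ob v F)) (ob (point B' b') (ob w M)) \<chi>"
      using couniversal_iff_iso[OF c' D1[OF p] far_hom[OF D1[OF x'] f(1)] \<beta>'_N] by simp
    then show "is_iso (D0 D terminal_cat) (ar (point B' b') f) \<longleftrightarrow> cohom_iso_at D ?K ?L ?U (ob ?r F)"
      unfolding cohom_iso_at_iff[OF U(1) c] mate_U rF xM .
  qed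
  finally show ?thesis .
qed

end

text \<open>
  For \<open>k : c \<rightarrow> w b\<close> the component of \<open>(c\B)/b\<close> over \<open>k\<close> has the terminal object
  \<open>((b, k), id\<^sub>b)\<close>, which gives a section of \<open>(c\B)/b \<rightarrow> e/w b\<close>.
\<close>

lemma coslice_square_slice_map_section:
  assumes w: "small_functor B C w" and c: "c \<in> Obj C" and b: "b \<in> Obj B"
  defines "S \<equiv> coslice_square c w"
  defines "K \<equiv> slice (sq_left S) b" and "L \<equiv> slice (sq_right S) (fob (sq_bot S) b)"
  obtains G \<eta> where "small_functor L K G" "square_slice_map S b \<odot> G = idF L"
    "is_nat (idF K) (G \<odot> square_slice_map S b) \<eta>"
proof -
  let ?E = "coslice c w" and ?s = "coslice_forget c w" and ?U = "square_slice_map S b"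
  note f = small_functorD[OF w]
  note cw = small_coslice[OF w c]
  note fs = small_functorD[OF cw(2)]
  interpret small_square S ?E terminal_cat B C
    unfolding S_def using small_square_coslice[OF w c] .
  have S: "sq_top S = to_terminal ?E" "sq_bot S = w" "sq_left S = ?s" "sq_right S = point C c"
    "cmp (sq_cell S) = (\<lambda>x\<in>Obj ?E. vsnd x)"
    by (simp_all add: S_def f(7))
  have wb: "fob w b \<in> Obj C"
    using fob_in[OF f(3) b] .
  have K_def': "K = slice ?s b" and L_def': "L = slice (point C c) (fob w b)"
    by (simp_all add: K_def L_def S)
  have pc: "small_functor terminal_cat C (point C c)"
    using right S(4) by simp
  note fp = small_functorD[OF pc]
  note U = square_slice_map_functor[OF b, folded K_def L_def]
  have sK: "small_cat K" and sL: "small_cat L"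
    using small_functorD(1,2)[OF U(1)] .
  have cK: "category K" and cL: "category L"
    using small_functorD(4,5)[OF U(1)] .
  note fU = small_functorD(3)[OF U(1)]
  note TL = slice_triples[OF fp(3) wb, folded L_def']
  note TK = slice_triples[OF fs(3) b, folded K_def']
  have L_obj: "vfst x = vzero" "vsnd x \<in> hom C c (fob w b)" if "x \<in> Obj L" for x
    using slice_objD[OF fp(3) wb, of x] that by (simp_all add: L_def' terminal_simps point_simps)
  \<comment> \<open>\<open>L\<close> is the discrete category on Hom(c, w b): an arrow of
    \<open>L\<close> lies over the only arrow of e, which acts on structural arrows by
    precomposition with an identity.\<close>
  have L_arr: "x = y \<and> x \<in> Obj L \<and> k = vzero" if "tri x k y \<in> Arr L" for x k y
  proof -
    have x: "x \<in> Obj L" and y: "y \<in> Obj L" and k: "k \<in> hom terminal_cat (vfst x) (vfst y)"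
      and eq: "vsnd y \<cdot>\<^bsub>C\<^esub> far (point C c) k = vsnd x"
      using that unfolding L_def' tri_slice[OF fp(3) wb] by auto
    have k0: "k = vzero"
      using k L_obj(1)[OF x] L_obj(1)[OF y] by (simp add: hom_terminal)
    then have "vsnd x = vsnd y"
      using eq Comp_Id_right[OF f(5) L_obj(2)[OF y]] by (simp add: point_simps)
    moreover have "x = vpair (vfst x) (vsnd x)" "y = vpair (vfst y) (vsnd y)"
      using x y unfolding TL(3) by auto
    ultimately show ?thesis
      using L_obj(1)[OF x] L_obj(1)[OF y] x k0 by simp
  qed
  define g where "g x = vpair (vpair b (vsnd x)) (Id B b)" for x
  \<comment> \<open>As \<open>L\<close> is discrete, every arrow may be sent to the identity of the
    image of its source.\<close>
  define G where "G = \<lparr>Src = L, Trg = K, fob = (\<lambda>x\<in>Obj L. g x), far = (\<lambda>k\<in>Arr L. Id K (g (tri_src k)))\<rparr>"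
  have bk: "vpair b k \<in> Obj ?E" if "k \<in> hom C c (fob w b)" for k
    using that b by (simp add: vpair_coslice[OF f(3) c])
  have gK: "g x \<in> Obj K" if "vsnd x \<in> hom C c (fob w b)" for x
    using bk[OF that] Id_hom[OF f(4) b]
    by (simp add: g_def K_def' vpair_slice[OF fs(3) b] cw(3))
  have "is_functor (triple_cat terminal_cat (Obj L) (Arr L)) K G"
  proof (rule triples.is_functor_from_triples[OF TL(1) cK])
    show "Src G = triple_cat terminal_cat (Obj L) (Arr L)"
      by (simp add: G_def TL(2)[symmetric])
    show "fob G \<in> Obj L \<rightarrow>\<^sub>E Obj K"
      using gK L_obj(2) by (simp add: G_def)
    show "far G (tri x k y) \<in> hom K (fob G x) (fob G y)" if "tri x k y \<in> Arr L" for x k y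
      using L_arr[OF that] that Id_hom[OF cK gK[OF L_obj(2)[of x]]] by (auto simp: G_def)
    show "far G (tri x (Id terminal_cat (vfst x)) x) = Id K (fob G x)" if "x \<in> Obj L" for x
      using that triples.ident[OF TL(1) that] by (simp add: G_def)
    show "far G (tri x (h \<cdot>\<^bsub>terminal_cat\<^esub> k) z) = far G (tri y h z) \<cdot>\<^bsub>K\<^esub> far G (tri x k y)"
      if k: "tri x k y \<in> Arr L" and h: "tri y h z \<in> Arr L" for x k y h z
      using L_arr[OF k] L_arr[OF h] k triples.composite[OF TL(1) k h]
        Comp_Id_left[OF cK Id_hom[OF cK gK[OF L_obj(2)[of x]]]]
      by (auto simp: G_def)
  qed (simp_all add: G_def)
  then have G: "is_functor L K G"
    unfolding TL(2)[symmetric] .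
  have G_ob: "fob G x = g x" if "x \<in> Obj L" for x
    using that by (simp add: G_def)
  have U_ob: "fob ?U x = vpair vzero (far w (vsnd x) \<cdot>\<^bsub>C\<^esub> vsnd (vfst x))" if x: "x \<in> Obj K" for x
    using U(3) x slice_objD(1)[OF fs(3) b, of x] by (simp add: K_def' S to_terminal_def)
  have Ug: "fob ?U (g x) = x" if x: "x \<in> Obj L" for x
  proof -
    have "x = vpair (vfst x) (vsnd x)"
      using x unfolding TL(3) by auto
    then show ?thesis
      using U_ob[OF gK[OF L_obj(2)[OF x]]] L_obj[OF x] far_Id[OF f(3) b] Comp_Id_left[OF f(5) L_obj(2)[OF x]]
      by (simp add: g_def)
  qed
  have UG: "?U \<odot> G = idF L"
  proof (rule functor_eqI[OF is_functor_compF[OF G fU] is_functor_idF[OF cL]])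
    show "fob (?U \<odot> G) x = fob (idF L) x" if x: "x \<in> Obj L" for x
      using x by (simp add: fob_compF[OF G x] G_ob Ug idF_simps)
    show "far (?U \<odot> G) k = far (idF L) k" if k: "k \<in> Arr L" for k
    proof -
      obtain x l y where "k = tri x l y"
        using k unfolding TL(4) by blast
      then have k_eq: "k = tri x vzero x" and x: "x \<in> Obj L"
        using L_arr k by auto
      have "far (?U \<odot> G) k = far ?U (Id K (g x))"
        using k by (simp add: compF_def compose_def G_def k_eq)
      also have "\<dots> = Id L x"
        using far_Id[OF fU gK[OF L_obj(2)[OF x]]] Ug[OF x] by simp
      also have "\<dots> = k"
        using triples.Id_triples[OF TL(1) x, folded TL(2)] L_obj(1)[OF x] by (simp add: k_eq terminal_simps)
      finally show ?thesis
        using k by (simp add: idF_def)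
    qed
  qed
  \<comment> \<open>An object \<open>x\<close> of \<open>K\<close> consists of (a, k) and l : a
    \<rightarrow> b, and lies in the component of w(l) k. \<open>h x\<close> is the terminal object
    of that component; \<open>m x\<close> is the arrow of the coslice given by l, from (a, k) to (b,
    w(l) k).\<close>
  define m where "m x = tri (vfst x) (vsnd x) (vpair b (far w (vsnd x) \<cdot>\<^bsub>C\<^esub> vsnd (vfst x)))" for x
  define h where "h x = vpair (vpair b (far w (vsnd x) \<cdot>\<^bsub>C\<^esub> vsnd (vfst x))) (Id B b)" for x
  have K_obj: "vfst x \<in> Obj ?E" "vsnd x \<in> hom B (vfst (vfst x)) b"
    "vfst (vfst x) \<in> Obj B" "vsnd (vfst x) \<in> hom C c (fob w (vfst (vfst x)))" if "x \<in> Obj K" for x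
  proof -
    show 1: "vfst x \<in> Obj ?E" and "vsnd x \<in> hom B (vfst (vfst x)) b"
      using slice_objD[OF fs(3) b, of x] that by (auto simp: K_def' cw(3))
    show "vfst (vfst x) \<in> Obj B" "vsnd (vfst x) \<in> hom C c (fob w (vfst (vfst x)))"
      using coslice_objD[OF f(3) c 1] by auto
  qed
  have wg: "far w (vsnd x) \<cdot>\<^bsub>C\<^esub> vsnd (vfst x) \<in> hom C c (fob w b)" if "x \<in> Obj K" for x
    using Comp_hom[OF f(5) K_obj(4)[OF that] far_hom[OF f(3) K_obj(2)[OF that]]] .
  have h: "h x \<in> Obj K" if "x \<in> Obj K" for x
    using gK[of "vpair vzero (far w (vsnd x) \<cdot>\<^bsub>C\<^esub> vsnd (vfst x))"] wg[OF that]
    by (simp add: g_def h_def)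
  have GU_ob: "fob (G \<odot> ?U) x = h x" if x: "x \<in> Obj K" for x
    using fob_in[OF fU x] U_ob[OF x] by (simp add: fob_compF[OF fU x] G_ob g_def h_def)
  have m: "tri (vfst x) (vsnd x) (vfst (h x)) \<in> Arr ?E" if x: "x \<in> Obj K" for x
    using K_obj[OF x] bk[OF wg[OF x]] by (simp add: h_def tri_coslice[OF f(3) c])
  have hm: "tri x (m x) (h x) \<in> Arr K" if x: "x \<in> Obj K" for x
  proof -
    have "m x \<in> hom ?E (vfst x) (vfst (h x))"
      unfolding hom_coslice[OF f(3) c] using m[OF x] by (simp add: m_def h_def)
    moreover have "far ?s (m x) = vsnd x"
      using m[OF x] by (simp add: cw(4) m_def h_def)
    ultimately show ?thesis
      using x h[OF x] Comp_Id_left[OF f(4) K_obj(2)[OF x]]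
      by (simp add: K_def' tri_slice[OF fs(3) b]) (simp add: h_def)
  qed
  define \<eta> where "\<eta> = \<lparr>NSrc = idF K, NTrg = G \<odot> ?U, cmp = (\<lambda>x\<in>Obj K. tri x (m x) (h x))\<rparr>"
  have "is_nat (idF K) (G \<odot> ?U) \<eta>"
  proof (rule is_natI[OF is_functor_idF[OF cK] is_functor_compF[OF fU G]])
    show "cmp \<eta> x \<in> hom K (fob (idF K) x) (fob (G \<odot> ?U) x)" if x: "x \<in> Obj K" for x
      using x hm[OF x] unfolding GU_ob[OF x] K_def' hom_slice[OF fs(3) b] by (simp add: \<eta>_def K_def' idF_simps)
    show "cmp \<eta> y \<cdot>\<^bsub>K\<^esub> far (idF K) k = far (G \<odot> ?U) k \<cdot>\<^bsub>K\<^esub> cmp \<eta> x" if k: "k \<in> hom K x y" for k x y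
    proof -
      obtain p where kp: "k = tri x p y" "tri x p y \<in> Arr K"
        using k unfolding K_def' hom_slice[OF fs(3) b] by blast
      then have x: "x \<in> Obj K" and y: "y \<in> Obj K" and p: "p \<in> hom ?E (vfst x) (vfst y)"
        and eq: "vsnd y \<cdot>\<^bsub>B\<^esub> far ?s p = vsnd x"
        unfolding K_def' tri_slice[OF fs(3) b] by auto
      obtain q where pq: "p = tri (vfst x) q (vfst y)" "tri (vfst x) q (vfst y) \<in> Arr ?E"
        using p unfolding hom_coslice[OF f(3) c] by blast
      have q: "q \<in> hom B (vfst (vfst x)) (vfst (vfst y))" "far w q \<cdot>\<^bsub>C\<^esub> vsnd (vfst x) = vsnd (vfst y)"
        using pq(2) unfolding tri_coslice[OF f(3) c] by auto
      have hq: "vsnd y \<cdot>\<^bsub>B\<^esub> q = vsnd x"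
        using eq pq by (simp add: cw(4))
      \<comment> \<open>The element w(l) k of Hom(c, w b) is constant along arrows of
        \<open>K\<close>. Hence \<open>h x\<close> and \<open>h y\<close> coincide,
        \<open>?U\<close> sends \<open>k\<close> to an identity, and naturality reduces to
        \<open>m y\<close> after \<open>p\<close> being \<open>m x\<close>.\<close>
      have "far w (vsnd y) \<cdot>\<^bsub>C\<^esub> vsnd (vfst y) = far w (vsnd x) \<cdot>\<^bsub>C\<^esub> vsnd (vfst x)"
        using Comp_assoc[OF f(5) K_obj(4)[OF x] far_hom[OF f(3) q(1)] far_hom[OF f(3) K_obj(2)[OF y]]]
          far_Comp[OF f(3) q(1) K_obj(2)[OF y]] q(2) hq by simp
      then have hxy: "h y = h x"
        by (simp add: h_def)
      have Uk: "far ?U k = Id L (fob ?U x)"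
      proof -
        have "far ?U k \<in> hom L (fob ?U x) (fob ?U y)"
          using far_hom[OF fU k] .
        then obtain l where l: "far ?U k = tri (fob ?U x) l (fob ?U y)" "tri (fob ?U x) l (fob ?U y) \<in> Arr L"
          unfolding L_def' hom_slice[OF fp(3) wb] by blast
        then show ?thesis
          using L_arr[OF l(2)] triples.Id_triples[OF TL(1) fob_in[OF fU x], folded TL(2)]
            L_obj(1)[OF fob_in[OF fU x]] by (simp add: terminal_simps)
      qed
      have GUk: "far (G \<odot> ?U) k = Id K (h x)"
        using far_Id[OF G fob_in[OF fU x]] GU_ob[OF x] by (simp add: far_compF[OF fU k] fob_compF[OF fU x] Uk)
      have my: "m y \<cdot>\<^bsub>?E\<^esub> p = m x"
        using triples.Comp_triples[OF coslice_triples(1)[OF f(3) c] pq(2) m[OF y], folded coslice_triples(2)[OF f(3) c]]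
          hq hxy by (simp add: pq(1) m_def h_def)
      have "cmp \<eta> y \<cdot>\<^bsub>K\<^esub> k = tri x (m y \<cdot>\<^bsub>?E\<^esub> p) (h y)"
        using triples.Comp_triples[OF TK(1) kp(2) hm[OF y], folded TK(2)] y by (simp add: \<eta>_def kp(1))
      moreover have "tri x (m x) (h x) \<in> hom K x (h x)"
        using hm[OF x] unfolding K_def' hom_slice[OF fs(3) b] by simp
      ultimately show ?thesis
        using Comp_Id_left[OF cK] x unfolding idF_simps(2)[OF k] GUk by (simp add: \<eta>_def my hxy)
    qed
  qed (simp_all add: \<eta>_def)
  moreover have "small_functor L K G"
    using G sK sL by (simp add: small_functor_def)
  ultimately show thesis
    using that UG by blast
qed

section \<open>Coslice squares and the cohomological test for colocal equivalences\<close>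

context prederivator_loc
begin

text \<open>The slice criterion reduces the claim at each \<open>b\<close> to the comparison functor
  from a slice of \<open>coslice c w\<close> to a category over e. Its coefficients are constant,
  and it is a D-equivalence by the section constructed above.\<close>

lemma base_change_at_coslice:
  assumes cons: "conservative D" and compl: "complete_prederivator D"
    and w: "small_functor B C w" and c: "c \<in> Obj C" and X: "X \<in> Obj (D0 D terminal_cat)"
  shows "base_change_at D (coslice_square c w) X"
proof -
  let ?S = "coslice_square c w"
  interpret small_square ?S "coslice c w" terminal_cat B C
    using small_square_coslice[OF w c] .
  interpret prederivator_square D ?S "coslice c w" terminal_cat B C ..
  have "cohom_iso_at D (slice (sq_left ?S) b) (slice (sq_right ?S) (fob (sq_bot ?S) b))
      (square_slice_map ?S b) (ob (slice_forget (sq_right ?S) (fob (sq_bot ?S) b)) X)" if b: "b \<in> Obj B" for b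
  proof -
    let ?L = "slice (sq_right ?S) (fob (sq_bot ?S) b)"
    note U = square_slice_map_functor(1)[OF b]
    \<comment> \<open>The right-hand functor of the square starts at e, so the forgetful functor of
      the slice is the functor to e. The coefficients are therefore constant, and the condition is
      that of a D-equivalence.\<close>
    have "slice_forget (sq_right ?S) (fob (sq_bot ?S) b) = to_terminal ?L"
      using functor_to_terminal small_functorD(3)[OF small_slice(2)[OF right fob_in[OF small_functorD(3)[OF bot] b]]]
      by blast
    moreover obtain G \<eta> where "small_functor ?L (slice (sq_left ?S) b) G"
      "square_slice_map ?S b \<odot> G = idF ?L"
      "is_nat (idF (slice (sq_left ?S) b)) (G \<odot> square_slice_map ?S b) \<eta>"
      using coslice_square_slice_map_section[OF w c b] .
    ultimately show ?thesis
      using D_equivalence_section[OF U] X unfolding D_equivalence_iff[OF U] by simp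
  qed
  then show ?thesis
    unfolding base_change_at_iff_slices[OF cons compl X] by blast
qed

text \<open>Put M = c_* X and N = q_* w^* M. Base change and composition of couniversal arrows
  present N as the cohomology of the constant diagram X on \<open>coslice c w\<close>. By hypothesis
  the same N, with restricted counit, is p_* of the restriction of M to A, so it serves the coslice
  of \<open>w \<odot> u\<close> too. Restriction along \<open>coslice_map\<close> carries one
  couniversal arrow to the other.\<close>

lemma D_equivalence_colocally_if:
  assumes cons: "conservative D" and compl: "complete_prederivator D"
    and u: "small_functor A B u" and w: "small_functor B C w"
    and iso: "\<And>F. F \<in> Obj (D0 D C) \<Longrightarrow> cohom_iso_at D A B u (ob w F)"
  shows "D_equivalence_colocally D A B C u w (w \<odot> u)"
  unfolding D_equivalence_colocally_def commutative_triangle_def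
proof (intro conjI ballI)
  let ?v = "w \<odot> u" and ?p = "to_terminal A" and ?q = "to_terminal B"
  show v: "small_functor A C ?v"
    using small_functor_compF[OF u w] .
  fix c assume c: "c \<in> Obj C"
  let ?E = "coslice c w" and ?E' = "coslice c ?v" and ?U = "coslice_map c u w ?v"
  let ?s = "coslice_forget c w" and ?s' = "coslice_forget c ?v"
  let ?t = "to_terminal ?E" and ?t' = "to_terminal ?E'"
  let ?\<gamma> = "sq_cell (coslice_square c w)" and ?\<gamma>' = "sq_cell (coslice_square c ?v)"
  note U = coslice_map_functor[OF u w c]
  note Trg = small_functorD(7)[OF w] small_functorD(7)[OF v]
  interpret W: small_square "coslice_square c w" ?E terminal_cat B C
    using small_square_coslice[OF w c] .
  interpret W: prederivator_square D "coslice_square c w" ?E terminal_cat B C ..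
  interpret V: small_square "coslice_square c ?v" ?E' terminal_cat A C
    using small_square_coslice[OF v c] .
  interpret V: prederivator_square D "coslice_square c ?v" ?E' terminal_cat A C ..
  note s = W.left[simplified] and s' = V.left[simplified]
  note t = W.top[simplified] and t' = V.top[simplified]
  note x = W.right[simplified, unfolded Trg]
  note p = small_functor_to_terminal[OF small_functorD(1)[OF u]]
    and q = small_functor_to_terminal[OF small_functorD(2)[OF u]]
  have di: "cohom_direct_images D"
    using compl unfolding complete_prederivator_def by blast
  show "D_equivalence D ?E' ?E ?U"
    unfolding D_equivalence_iff[OF U(1)]
  proof
    fix X assume X: "X \<in> Obj (D0 D terminal_cat)"
    obtain M \<epsilon> where M: "couniversal (D1 D (point C c)) X M \<epsilon>"
      using ex_couniversal[OF di x X] .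
    note m = couniversalD[OF M D1[OF x]]
    have wM: "ob w M \<in> Obj (D0 D B)"
      using fob_in[OF D1[OF w] m(1)] .
    obtain N \<delta> where N: "couniversal (D1 D ?q) (ob w M) N \<delta>"
      using ex_couniversal[OF di q wM] .
    note n = couniversalD[OF N D1[OF q]]
    have vM: "ob u (ob w M) = ob ?v M"
      using ob_compF[OF u w m(1)] by simp
    have N': "couniversal (D1 D ?p) (ob ?v M) N (ar u \<delta>)"
      using iso[OF m(1)] unfolding cohom_iso_at_iff[OF u N] vM .
    have C: "couniversal (D1 D ?s) (ob ?t X) (ob w M) (mate D (coslice_square c w) M \<epsilon>)"
      using base_change_at_coslice[OF cons compl w c X] M unfolding base_change_at_def by (simp add: Trg)
    have C': "couniversal (D1 D ?s') (ob ?t' X) (ob ?v M) (mate D (coslice_square c ?v) M \<epsilon>)"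
      using base_change_at_coslice[OF cons compl v c X] M unfolding base_change_at_def by (simp add: Trg)
    let ?\<kappa> = "mate D (coslice_square c w) M \<epsilon> \<cdot>\<^bsub>D0 D ?E\<^esub> ar ?s \<delta>"
    have qs: "D1 D ?s \<odot> D1 D ?q = D1 D ?t" "D1 D ?s' \<odot> D1 D ?p = D1 D ?t'"
      using D1_compF[OF s q] D1_compF[OF s' p] to_terminal_compF[OF s] to_terminal_compF[OF s'] by simp_all
    have K: "couniversal (D1 D ?t) (ob ?t X) N ?\<kappa>"
      using couniversal_compF[OF C D1[OF s] N D1[OF q]] unfolding qs .
    have K': "couniversal (D1 D ?t') (ob ?t' X) N
        (mate D (coslice_square c ?v) M \<epsilon> \<cdot>\<^bsub>D0 D ?E'\<^esub> ar ?s' (ar u \<delta>))"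
      using couniversal_compF[OF C' D1[OF s'] N' D1[OF p]] unfolding qs .
    have "ar ?U ?\<kappa> = ar ?U (mate D (coslice_square c w) M \<epsilon>) \<cdot>\<^bsub>D0 D ?E'\<^esub> ar ?U (ar ?s \<delta>)"
      using far_Comp[OF D1[OF U(1)] far_hom[OF D1[OF s] n(2)] couniversalD(2)[OF C D1[OF s]]] .
    also have "ar ?U (ar ?s \<delta>) = ar ?s' (ar u \<delta>)"
      using ar_compF[OF U(1) s n(2)] ar_compF[OF s' u n(2)] U(2) by simp
    also have "ar ?U (mate D (coslice_square c w) M \<epsilon>) = mate D (coslice_square c ?v) M \<epsilon>"
    proof -
      note xt = small_functor_compF[OF t x] and ws = small_functor_compF[OF s w]
      note n\<gamma> = W.cell[simplified, unfolded Trg]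
      have "ar ?U (mate D (coslice_square c w) M \<epsilon>) = ar ?U (ar ?t \<epsilon>) \<cdot>\<^bsub>D0 D ?E'\<^esub> ar ?U (cell_at ?\<gamma> M)"
        unfolding W.mate_eq coslice_square_simps
        using far_Comp[OF D1[OF U(1)] W.\<alpha>_hom[OF m(1), unfolded coslice_square_simps Trg] far_hom[OF D1[OF t] m(2)]] .
      also have "ar ?U (ar ?t \<epsilon>) = ar ?t' \<epsilon>"
        using ar_compF[OF U(1) t m(2)] to_terminal_compF[OF U(1)] by simp
      also have "ar ?U (cell_at ?\<gamma> M) = cell_at ?\<gamma>' M"
        using cell_at_whisker_right[OF xt ws n\<gamma> U(1) m(1)] unfolding coslice_cell_restrict[OF u w c] by simp
      finally show ?thesis
        by (simp add: V.mate_eq)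
    qed
    finally have "ar ?U ?\<kappa> = mate D (coslice_square c ?v) M \<epsilon> \<cdot>\<^bsub>D0 D ?E'\<^esub> ar ?s' (ar u \<delta>)" .
    moreover have "ob ?U (ob ?t X) = ob ?t' X"
      using ob_compF[OF U(1) t X] to_terminal_compF[OF U(1)] by simp
    ultimately show "cohom_iso_at D ?E' ?E ?U (ob ?t X)"
      unfolding cohom_iso_at_iff[OF U(1) K] using K' by simp
  qed
qed (fact u w refl)+

section \<open>The cohomological criterion in terms of hom sets\<close>

text \<open>Transposed to the category over A, the component at \<open>F\<close> is u^* of the
  counit of q at w^* F: naturality of that counit lets the unit of u pass, and this unit cancels
  against the counit of u by a triangle identity. \<open>cohom_iso_at_iff\<close> then translates
  couniversality of the result.\<close>

lemma nat_iso_triangle_mor_iff: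
  assumes u: "small_functor A B u" and w: "small_functor B C w"
    and Ru: "adjunction (D1 D u) Ru \<eta>u \<epsilon>u"
    and Rq: "adjunction (D1 D (to_terminal B)) Rq \<eta>q \<epsilon>q"
    and Rp: "adjunction (D1 D (to_terminal A)) Rp \<eta>p \<epsilon>p"
  shows "nat_iso (triangle_mor D u w (w \<odot> u) Ru \<eta>u \<epsilon>u Rq \<epsilon>q Rp \<eta>p) \<longleftrightarrow>
    (\<forall>F\<in>Obj (D0 D C). cohom_iso_at D A B u (ob w F))"
proof -
  let ?v = "w \<odot> u" and ?p = "to_terminal A" and ?q = "to_terminal B"
  let ?A = "D0 D A" and ?B = "D0 D B" and ?e = "D0 D terminal_cat"
  note v = small_functor_compF[OF u w]
  note p = small_functor_to_terminal[OF small_functorD(1)[OF u]]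
    and q = small_functor_to_terminal[OF small_functorD(2)[OF u]]
  note ps = D1[OF p] and qs = D1[OF q] and us = D1[OF u] and ws = D1[OF w] and vs = D1[OF v]
  interpret Ru: adj "D1 D u" Ru \<eta>u \<epsilon>u ?B ?A using Ru us by unfold_locales
  interpret Rq: adj "D1 D ?q" Rq \<eta>q \<epsilon>q ?e ?B using Rq qs by unfold_locales
  interpret Rp: adj "D1 D ?p" Rp \<eta>p \<epsilon>p ?e ?A using Rp ps by unfold_locales
  note fRu = functor_cats[OF Ru.R] and fRq = functor_cats[OF Rq.R] and fRp = functor_cats[OF Rp.R]
  note NSrcs = nat_functors(2)[OF Rp.unit is_functor_idF[OF Rp.cats(1)]]
    nat_functors(2)[OF Ru.unit is_functor_idF[OF Ru.cats(1)]]
  let ?\<phi> = "direct_image_comparison D u Ru \<epsilon>u Rq \<epsilon>q Rp \<eta>p"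
  let ?c = "triangle_mor D u w ?v Ru \<eta>u \<epsilon>u Rq \<epsilon>q Rp \<eta>p"
  have RqRu: "is_functor ?A ?e (Rq \<odot> Ru)"
    using is_functor_compF[OF Ru.R Rq.R] .
  have NSrc_\<phi>: "NSrc ?\<phi> = Rq \<odot> Ru"
    using idF_compF[OF RqRu] by (simp add: direct_image_comparison_def NSrc_simps idN_simps NSrcs)
  have Src: "Src (NSrc ?c) = D0 D C" and Trg: "Trg (NSrc ?c) = ?e"
    using functor_cats[OF ws] fRq by (simp_all add: triangle_mor_def NSrc_simps idN_simps NSrcs)
  have pq: "D1 D u \<odot> D1 D ?q = D1 D ?p"
    using D1_compF[OF u q] to_terminal_compF[OF u] by simp
  have p_ob: "ob ?p X = ob u (ob ?q X)" if "X \<in> Obj ?e" for X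
    unfolding pq[symmetric] using fob_compF[OF qs that] .
  have p_ar: "ar ?p f = ar u (ar ?q f)" if "f \<in> hom ?e X Y" for f X Y
    unfolding pq[symmetric] using far_compF[OF qs that] .
  have "is_iso ?e (cmp ?c F) \<longleftrightarrow> cohom_iso_at D A B u (ob w F)" if F: "F \<in> Obj (D0 D C)" for F
  proof -
    define G where "G = ob w F"
    have G: "G \<in> Obj ?B"
      unfolding G_def using fob_in[OF ws F] .
    define H where "H = ob u G"
    have H: "H \<in> Obj ?A"
      unfolding H_def using fob_in[OF us G] .
    have vF: "ob ?v F = H"
      unfolding H_def G_def using ob_compF[OF u w F] .
    define N where "N = fob Rq (fob Ru H)"
    have N: "N \<in> Obj ?e"
      unfolding N_def using fob_in[OF Rq.R fob_in[OF Ru.R H]] .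
    note \<epsilon>q_hom = Rq.counit_hom[OF fob_in[OF Ru.R H], folded N_def]
    note \<epsilon>u_hom = Ru.counit_hom[OF H] and \<eta>u_hom = Ru.unit_hom[OF G, folded H_def]
    define k where "k = cmp \<epsilon>u H \<cdot>\<^bsub>?A\<^esub> ar u (cmp \<epsilon>q (fob Ru H))"
    have k: "k \<in> hom ?A (ob ?p N) H"
      unfolding k_def p_ob[OF N] using Comp_hom[OF Ru.cats(2) far_hom[OF us \<epsilon>q_hom] \<epsilon>u_hom] .
    have 1: "cmp (hcomp (idN Rp) \<epsilon>u) H = far Rp (cmp \<epsilon>u H)"
      using cmp_whisker_left[OF Ru.counit is_functor_compF[OF Ru.R us] Rp.R H] .
    have 2: "cmp (hcomp (idN (Rp \<odot> D1 D u)) (hcomp \<epsilon>q (idN Ru))) H = far Rp (ar u (cmp \<epsilon>q (fob Ru H)))"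
      using cmp_whisker_left[OF is_nat_whisker_right[OF Rq.counit is_functor_compF[OF Rq.R qs] Ru.R]
          is_functor_compF[OF Ru.R is_functor_compF[OF Rq.R qs]] is_functor_compF[OF us Rp.R] H]
        cmp_whisker_right[OF Rq.counit is_functor_compF[OF Rq.R qs] Ru.R H]
      by (simp add: far_compF[OF us \<epsilon>q_hom])
    have 3: "cmp (hcomp \<eta>p (idN (Rq \<odot> Ru))) H = cmp \<eta>p N"
      using cmp_whisker_right[OF Rp.unit is_functor_idF[OF Rp.cats(1)] RqRu H]
      by (simp add: N_def fob_compF[OF Ru.R H])
    have "cmp ?\<phi> H = far Rp (cmp \<epsilon>u H) \<cdot>\<^bsub>?e\<^esub> (far Rp (ar u (cmp \<epsilon>q (fob Ru H))) \<cdot>\<^bsub>?e\<^esub> cmp \<eta>p N)"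
      using H fRu by (simp add: direct_image_comparison_def cmp_vcomp_raw NSrc_simps idN_simps NSrcs 1 2 3)
    also have "\<dots> = far Rp k \<cdot>\<^bsub>?e\<^esub> cmp \<eta>p N"
      using Comp_assoc[OF Rp.cats(1) Rp.unit_hom[OF N] far_hom[OF Rp.R far_hom[OF us \<epsilon>q_hom, folded p_ob[OF N]]]
          far_hom[OF Rp.R \<epsilon>u_hom]]
        far_Comp[OF Rp.R far_hom[OF us \<epsilon>q_hom] \<epsilon>u_hom] by (simp add: k_def)
    finally have \<phi>: "cmp ?\<phi> H = far Rp k \<cdot>\<^bsub>?e\<^esub> cmp \<eta>p N" .
    have \<phi>_hom: "cmp ?\<phi> H \<in> hom ?e N (fob Rp H)"
      unfolding \<phi> using Rp.transpose_hom[OF N k] .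
    \<comment> \<open>Computed from the definition of \<open>hcomp\<close>, since
      \<open>cmp_whisker_right\<close> asks for naturality of \<open>?\<phi>\<close>, which has not
      been established.\<close>
    have 4: "cmp (hcomp ?\<phi> (idN (D1 D ?v))) F = cmp ?\<phi> H"
    proof -
      have "cmp (hcomp ?\<phi> (idN (D1 D ?v))) F = cmp ?\<phi> H \<cdot>\<^bsub>?e\<^esub> far (Rq \<odot> Ru) (Id ?A H)"
        using F functor_cats[OF vs] fRq
        by (simp add: hcomp_def NSrc_\<phi> idN_simps cmp_idN[OF vs] vF NSrc_simps)
      also have "\<dots> = cmp ?\<phi> H"
        using far_Id[OF RqRu H] Comp_Id_right[OF Rp.cats(1) \<phi>_hom] fob_compF[OF Ru.R H, of Rq]
        by (simp add: N_def)
      finally show ?thesis .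
    qed
    have 5: "cmp (hcomp (idN Rq) (hcomp \<eta>u (idN (D1 D w)))) F = far Rq (cmp \<eta>u G)"
      using cmp_whisker_left[OF is_nat_whisker_right[OF Ru.unit is_functor_idF[OF Ru.cats(1)] ws]
          is_functor_compF[OF ws is_functor_idF[OF Ru.cats(1)]] Rq.R F]
        cmp_whisker_right[OF Ru.unit is_functor_idF[OF Ru.cats(1)] ws F]
      by (simp add: G_def)
    have c: "cmp ?c F = cmp ?\<phi> H \<cdot>\<^bsub>?e\<^esub> far Rq (cmp \<eta>u G)"
      using F Src Trg by (simp add: triangle_mor_def cmp_vcomp_raw NSrc_simps 4 5)
    define M where "M = fob Rq G"
    have M: "M \<in> Obj ?e"
      unfolding M_def using fob_in[OF Rq.R G] .
    note \<epsilon>q_G = Rq.counit_hom[OF G, folded M_def]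
    have \<eta>_hom: "far Rq (cmp \<eta>u G) \<in> hom ?e M N"
      unfolding M_def N_def using far_hom[OF Rq.R \<eta>u_hom] .
    have c_hom: "cmp ?c F \<in> hom ?e M (fob Rp H)"
      unfolding c using Comp_hom[OF Rp.cats(1) \<eta>_hom \<phi>_hom] .
    have "cmp \<epsilon>p H \<cdot>\<^bsub>?A\<^esub> ar ?p (cmp ?c F) = (cmp \<epsilon>p H \<cdot>\<^bsub>?A\<^esub> ar ?p (cmp ?\<phi> H)) \<cdot>\<^bsub>?A\<^esub> ar ?p (far Rq (cmp \<eta>u G))"
      using far_Comp[OF ps \<eta>_hom \<phi>_hom]
        Comp_assoc[OF Rp.cats(2) far_hom[OF ps \<eta>_hom] far_hom[OF ps \<phi>_hom] Rp.counit_hom[OF H]]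
      by (simp add: c)
    also have "\<dots> = k \<cdot>\<^bsub>?A\<^esub> ar u (ar ?q (far Rq (cmp \<eta>u G)))"
      using Rp.counit_transpose[OF N k] by (simp add: \<phi> p_ar[OF \<eta>_hom])
    also have "\<dots> = cmp \<epsilon>u H \<cdot>\<^bsub>?A\<^esub> (ar u (cmp \<epsilon>q (fob Ru H)) \<cdot>\<^bsub>?A\<^esub> ar u (ar ?q (far Rq (cmp \<eta>u G))))"
      using Comp_assoc[OF Ru.cats(2) far_hom[OF us far_hom[OF qs \<eta>_hom]] far_hom[OF us \<epsilon>q_hom] \<epsilon>u_hom]
      by (simp add: k_def)
    also have "\<dots> = cmp \<epsilon>u H \<cdot>\<^bsub>?A\<^esub> ar u (cmp \<eta>u G \<cdot>\<^bsub>?B\<^esub> cmp \<epsilon>q G)"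
      using far_Comp[OF us far_hom[OF qs \<eta>_hom] \<epsilon>q_hom] Rq.counit_naturality[OF \<eta>u_hom] by simp
    also have "\<dots> = (cmp \<epsilon>u H \<cdot>\<^bsub>?A\<^esub> ar u (cmp \<eta>u G)) \<cdot>\<^bsub>?A\<^esub> ar u (cmp \<epsilon>q G)"
      using far_Comp[OF us \<epsilon>q_G \<eta>u_hom]
        Comp_assoc[OF Ru.cats(2) far_hom[OF us \<epsilon>q_G] far_hom[OF us \<eta>u_hom] \<epsilon>u_hom] by simp
    also have "\<dots> = ar u (cmp \<epsilon>q G)"
      using Ru.triangle_L[OF G, folded H_def] Comp_Id_left[OF Ru.cats(2) far_hom[OF us \<epsilon>q_G]]
      by (simp add: H_def)
    finally have "cmp \<epsilon>p H \<cdot>\<^bsub>?A\<^esub> ar ?p (cmp ?c F) = ar u (cmp \<epsilon>q G)" .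
    then have "couniversal (D1 D ?p) H M (ar u (cmp \<epsilon>q G)) \<longleftrightarrow> is_iso ?e (cmp ?c F)"
      using couniversal_iff_iso[OF Rp.couniversal_counit[OF H] ps c_hom] by simp
    then show ?thesis
      using cohom_iso_at_iff[OF u Rq.couniversal_counit[OF G]] unfolding G_def[symmetric] H_def M_def by simp
  qed
  then show ?thesis
    unfolding nat_iso_def Src Trg by blast
qed

text \<open>As adjoints exist and the right-hand side does not depend on them, any choice may be
  used. This form is the one that is applied to squares and proved for derivators.\<close>

lemma cohom_criterion_colocal_iff:
  assumes "cohom_direct_images D"
  shows "cohom_criterion_colocal D \<longleftrightarrow> (\<forall>A B C u w v. D_equivalence_colocally D A B C u w v \<longrightarrow>
    (\<forall>F\<in>Obj (D0 D C). cohom_iso_at D A B u (ob w F)))" (is "_ \<longleftrightarrow> ?R")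
proof
  assume crit: "cohom_criterion_colocal D"
  show ?R
  proof (intro allI impI)
    fix A B C u w v assume loc: "D_equivalence_colocally D A B C u w v"
    then have u: "small_functor A B u" and w: "small_functor B C w" and v: "v = w \<odot> u"
      unfolding D_equivalence_colocally_def commutative_triangle_def by blast+
    obtain Ru \<eta>u \<epsilon>u where Ru: "adjunction (D1 D u) Ru \<eta>u \<epsilon>u"
      using assms u unfolding cohom_direct_images_def by blast
    obtain Rq \<eta>q \<epsilon>q where Rq: "adjunction (D1 D (to_terminal B)) Rq \<eta>q \<epsilon>q"
      using assms small_functor_to_terminal[OF small_functorD(2)[OF u]] unfolding cohom_direct_images_def by blast
    obtain Rp \<eta>p \<epsilon>p where Rp: "adjunction (D1 D (to_terminal A)) Rp \<eta>p \<epsilon>p"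
      using assms small_functor_to_terminal[OF small_functorD(1)[OF u]] unfolding cohom_direct_images_def by blast
    have "nat_iso (triangle_mor D u w v Ru \<eta>u \<epsilon>u Rq \<epsilon>q Rp \<eta>p)"
      using crit loc Ru Rq Rp unfolding cohom_criterion_colocal_def by blast
    then show "\<forall>F\<in>Obj (D0 D C). cohom_iso_at D A B u (ob w F)"
      unfolding v nat_iso_triangle_mor_iff[OF u w Ru Rq Rp] .
  qed
next
  assume R: ?R
  show "cohom_criterion_colocal D"
    unfolding cohom_criterion_colocal_def
  proof (intro conjI allI impI assms)
    fix A B C u w v Ru \<eta>u \<epsilon>u Rq \<eta>q \<epsilon>q Rp \<eta>p \<epsilon>p
    assume loc: "D_equivalence_colocally D A B C u w v"
      and adjs: "adjunction (D1 D u) Ru \<eta>u \<epsilon>u \<and> adjunction (D1 D (to_terminal B)) Rq \<eta>q \<epsilon>q \<and>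
        adjunction (D1 D (to_terminal A)) Rp \<eta>p \<epsilon>p"
    have u: "small_functor A B u" and w: "small_functor B C w" and v: "v = w \<odot> u"
      using loc unfolding D_equivalence_colocally_def commutative_triangle_def by blast+
    show "nat_iso (triangle_mor D u w v Ru \<eta>u \<epsilon>u Rq \<epsilon>q Rp \<eta>p)"
      unfolding v using nat_iso_triangle_mor_iff[OF u w] adjs R loc by blast
  qed
qed

text \<open>For each \<open>b'\<close> separately, the criterion and its converse
  \<open>D_equivalence_colocally_if\<close> identify the colocal condition over A with an
  isomorphism on cohomology for all F. What remains is to exchange the quantifiers over F and
  \<open>b'\<close>.\<close>

lemma cohom_base_change_iff_weakly_exact:
  assumes cons: "conservative D" and compl: "complete_prederivator D" and crit: "cohom_criterion_colocal D"
    and S: "is_square S"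
  shows "cohom_base_change D S \<longleftrightarrow> weakly_exact D S"
proof -
  obtain A' A B' B where "small_square S A' A B' B"
    using S by (rule is_squareE)
  then interpret small_square S A' A B' B .
  interpret prederivator_square D S A' A B' B ..
  have di: "cohom_direct_images D"
    using compl unfolding complete_prederivator_def by blast
  have "D_equivalence_colocally D (slice u' b') (slice u (fob w b')) A (square_slice_map S b')
      (slice_forget u (fob w b')) (v \<odot> slice_forget u' b') \<longleftrightarrow>
    (\<forall>F\<in>Obj (D0 D A). cohom_iso_at D (slice u' b') (slice u (fob w b')) (square_slice_map S b')
      (ob (slice_forget u (fob w b')) F))" if b': "b' \<in> Obj B'" for b'
  proof -
    note U = square_slice_map_functor[OF b']
    note r = small_slice(2)[OF right fob_in[OF small_functorD(3)[OF bot] b']]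
    show ?thesis
      using crit D_equivalence_colocally_if[OF cons compl U(1) r, unfolded U(2)]
      unfolding cohom_criterion_colocal_iff[OF di] by blast
  qed
  then show ?thesis
    using base_change_at_iff_slices[OF cons compl]
    unfolding cohom_base_change_iff[OF di] weakly_exact_def Let_def
      small_functorD(6)[OF bot] small_functorD(6)[OF right] by blast
qed

end

section \<open>Derivators\<close>

context prederivator_square
begin

text \<open>The displayed arrow is the transpose of the homological base change morphism at
  \<open>G\<close>. It is thus the unit of the left adjoint of v^*, which is universal, followed by
  v^* of an isomorphism.\<close>

lemma universal_if_hom_base_change:
  assumes bc: "hom_base_change D S" and L: "adjunction L (D1 D w) \<eta> \<epsilon>" and G: "G \<in> Obj (D0 D B')"
  shows "universal (D1 D v) (ob u' G) (ob u (fob L G)) (cell_at \<alpha> (fob L G) \<cdot>\<^bsub>D0 D A'\<^esub> ar u' (cmp \<eta> G))"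
proof -
  obtain L' \<eta>' \<epsilon>' where L': "adjunction L' (D1 D v) \<eta>' \<epsilon>'"
    using bc unfolding hom_base_change_def by blast
  interpret L: adj L "D1 D w" \<eta> \<epsilon> "D0 D B'" "D0 D B"
    using adj_right[OF L w_star] .
  interpret L': adj L' "D1 D v" \<eta>' \<epsilon>' "D0 D A'" "D0 D A"
    using adj_right[OF L' v_star] .
  let ?d = "hom_bc_mor D S L \<eta> L' \<epsilon>'"
  have iso: "nat_iso ?d"
    using bc L L' unfolding hom_base_change_def by blast
  have NSrc_\<eta>: "NSrc \<eta> = idF (D0 D B')"
    using nat_functors(2)[OF L.unit is_functor_idF[OF L.cats(1)]] .
  have Src: "Src (NSrc ?d) = D0 D B'" and Trg: "Trg (NSrc ?d) = D0 D A"
    using functor_cats[OF L'.L] by (simp_all add: hom_bc_mor_def Let_def NSrc_simps idN_simps NSrc_\<eta>)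
  note uv = D1[OF small_functor_compF[OF left bot]]
  note nc = D2[OF small_functor_compF[OF top right] small_functor_compF[OF left bot] cell]
  note M = fob_in[OF L.L G] and \<eta> = L.unit_hom[OF G]
  note uM = fob_in[OF u_star M] and u'G = fob_in[OF u'_star G]
  let ?k = "cell_at \<alpha> (fob L G) \<cdot>\<^bsub>D0 D A'\<^esub> ar u' (cmp \<eta> G)"
  have k: "?k \<in> hom (D0 D A') (ob u' G) (ob v (ob u (fob L G)))"
    using Comp_hom[OF cat_A' far_hom[OF u'_star \<eta>] \<alpha>_hom[OF M]] .
  have 1: "cmp (hcomp \<epsilon>' (idN (D1 D u \<odot> L))) G = cmp \<epsilon>' (ob u (fob L G))"
    using cmp_whisker_right[OF L'.counit is_functor_compF[OF v_star L'.L] is_functor_compF[OF L.L u_star] G]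
    by (simp add: fob_compF[OF L.L G])
  have 2: "cmp (hcomp (idN L') (hcomp (D2 D \<alpha>) (idN L))) G = far L' (cell_at \<alpha> (fob L G))"
    using cmp_whisker_left[OF is_nat_whisker_right[OF nc uv L.L] is_functor_compF[OF L.L uv] L'.L G]
      cmp_whisker_right[OF nc uv L.L G] by simp
  have 3: "cmp (hcomp (idN (L' \<odot> D1 D u')) \<eta>) G = far L' (ar u' (cmp \<eta> G))"
    using cmp_whisker_left[OF L.unit is_functor_idF[OF L.cats(1)] is_functor_compF[OF u'_star L'.L] G]
    by (simp add: far_compF[OF u'_star \<eta>])
  have "cmp ?d G = cmp \<epsilon>' (ob u (fob L G)) \<cdot>\<^bsub>D0 D A\<^esub> (far L' (cell_at \<alpha> (fob L G)) \<cdot>\<^bsub>D0 D A\<^esub> far L' (ar u' (cmp \<eta> G)))"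
    using G Src Trg unfolding hom_bc_mor_def Let_def by (simp add: cmp_vcomp_raw NSrc_simps(1) 1 2 3)
  then have d: "cmp ?d G = cmp \<epsilon>' (ob u (fob L G)) \<cdot>\<^bsub>D0 D A\<^esub> far L' ?k"
    using far_Comp[OF L'.L far_hom[OF u'_star \<eta>] \<alpha>_hom[OF M]] by simp
  have "cmp ?d G \<in> hom (D0 D A) (fob L' (ob u' G)) (ob u (fob L G))"
    unfolding d using Comp_hom[OF L'.cats(2) far_hom[OF L'.L k] L'.counit_hom[OF uM]] .
  moreover have "is_iso (D0 D A) (cmp ?d G)"
    using iso G unfolding nat_iso_def Src Trg by blast
  moreover have "ar v (cmp ?d G) \<cdot>\<^bsub>D0 D A'\<^esub> cmp \<eta>' (ob u' G) = ?k"
    unfolding d using L'.transpose_counit[OF k uM] .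
  ultimately show ?thesis
    using universal_postcomp_iso[OF L'.universal_unit[OF u'G] v_star] by metis
qed

end

context prederivator_loc
begin

text \<open>Der 4d at a single object: the value of w_! G at \<open>c\<close> is the homology of the
  coslice with coefficients in the restriction of \<open>G\<close>.\<close>

lemma universal_coslice:
  assumes coc: "cocomplete_prederivator D" and w: "small_functor B C w" and c: "c \<in> Obj C"
    and L: "adjunction L (D1 D w) \<eta> \<epsilon>" and G: "G \<in> Obj (D0 D B)"
  shows "universal (D1 D (to_terminal (coslice c w))) (ob (coslice_forget c w) G) (ob (point C c) (fob L G))
    (cell_at (sq_cell (coslice_square c w)) (fob L G) \<cdot>\<^bsub>D0 D (coslice c w)\<^esub> ar (coslice_forget c w) (cmp \<eta> G))"
proof -
  interpret small_square "coslice_square c w" "coslice c w" terminal_cat B C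
    using small_square_coslice[OF w c] .
  interpret prederivator_square D "coslice_square c w" "coslice c w" terminal_cat B C ..
  have "hom_base_change D (coslice_square c w)"
    using coc w c unfolding cocomplete_prederivator_def by blast
  then show ?thesis
    using universal_if_hom_base_change[of L \<eta> \<epsilon> G] L G by (simp add: small_functorD(7)[OF w])
qed

text \<open>The universal property only involves maps between constant diagrams, and on these u^* is
  bijective by definition of a D-equivalence.\<close>

lemma universal_restrict:
  assumes u: "small_functor A B u" and equiv: "D_equivalence D A B u"
    and Y: "Y \<in> Obj (D0 D terminal_cat)"
    and M: "universal (D1 D (to_terminal B)) (ob (to_terminal B) Y) M \<eta>"
  shows "universal (D1 D (to_terminal A)) (ob (to_terminal A) Y) M (ar u \<eta>)"
proof -
  note p = small_functor_to_terminal[OF small_functorD(1)[OF u]]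
    and q = small_functor_to_terminal[OF small_functorD(2)[OF u]]
  note ps = D1[OF p] and qs = D1[OF q] and us = D1[OF u]
  note m = universalD[OF M qs]
  have pq: "ob u (ob (to_terminal B) X) = ob (to_terminal A) X" if "X \<in> Obj (D0 D terminal_cat)" for X
    using ob_compF[OF u q that] by (simp add: to_terminal_compF[OF u])
  show ?thesis
  proof (rule universalI[OF ps m(1)])
    show "ar u \<eta> \<in> hom (D0 D A) (ob (to_terminal A) Y) (ob (to_terminal A) M)"
      using far_hom[OF us m(2)] by (simp add: pq Y m(1))
    fix X assume X: "X \<in> Obj (D0 D terminal_cat)"
    have "bij_betw (ar u) (hom (D0 D B) (ob (to_terminal B) Y) (ob (to_terminal B) X))
        (hom (D0 D A) (ob (to_terminal A) Y) (ob (to_terminal A) X))"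
      using equiv X Y unfolding D_equivalence_def Let_def by blast
    then have "bij_betw (ar u \<circ> (\<lambda>f. ar (to_terminal B) f \<cdot>\<^bsub>D0 D B\<^esub> \<eta>)) (hom (D0 D terminal_cat) M X)
        (hom (D0 D A) (ob (to_terminal A) Y) (ob (to_terminal A) X))"
      using m(3)[OF X] by (rule bij_betw_trans[rotated])
    moreover have "(ar u \<circ> (\<lambda>f. ar (to_terminal B) f \<cdot>\<^bsub>D0 D B\<^esub> \<eta>)) f = ar (to_terminal A) f \<cdot>\<^bsub>D0 D A\<^esub> ar u \<eta>"
      if f: "f \<in> hom (D0 D terminal_cat) M X" for f
      using far_Comp[OF us m(2) far_hom[OF qs f]] ar_compF[OF u q f] by (simp add: to_terminal_compF[OF u])
    ultimately show "bij_betw (\<lambda>f. ar (to_terminal A) f \<cdot>\<^bsub>D0 D A\<^esub> ar u \<eta>) (hom (D0 D terminal_cat) M X)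
        (hom (D0 D A) (ob (to_terminal A) Y) (ob (to_terminal A) X))"
      by (simp cong: bij_betw_cong)
  qed
qed

text \<open>
  The homological counterpart of the criterion: \<open>v\<^sub>! p\<^sup>* \<rightarrow> w\<^sub>! q\<^sup>*\<close> is an isomorphism because, at an
  object \<open>c\<close>, it compares the left Kan extensions of constant diagrams on \<open>c\A\<close> and \<open>c\B\<close>.
\<close>

lemma universal_restrict_colocal:
  assumes cons: "conservative D" and coc: "cocomplete_prederivator D"
    and loc: "D_equivalence_colocally D A B C u w (w \<odot> u)"
    and L: "adjunction L (D1 D w) \<eta> \<epsilon>" and Y: "Y \<in> Obj (D0 D terminal_cat)"
  shows "universal (D1 D (w \<odot> u)) (ob (to_terminal A) Y) (fob L (ob (to_terminal B) Y))
    (ar u (cmp \<eta> (ob (to_terminal B) Y)))"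
proof -
  let ?v = "w \<odot> u" and ?p = "to_terminal A" and ?q = "to_terminal B"
  let ?G = "ob (to_terminal B) Y" and ?G' = "ob (to_terminal A) Y"
  have u: "small_functor A B u" and w: "small_functor B C w"
    using loc unfolding D_equivalence_colocally_def commutative_triangle_def by blast+
  note v = small_functor_compF[OF u w]
  note p = small_functor_to_terminal[OF small_functorD(1)[OF u]]
    and q = small_functor_to_terminal[OF small_functorD(2)[OF u]]
  note us = D1[OF u] and ws = D1[OF w] and vs = D1[OF v]
  have G: "?G \<in> Obj (D0 D B)" and G': "?G' \<in> Obj (D0 D A)"
    using fob_in[OF D1[OF q] Y] fob_in[OF D1[OF p] Y] by auto
  have uG: "ob u ?G = ?G'"
    using ob_compF[OF u q Y] by (simp add: to_terminal_compF[OF u])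
  obtain L' \<eta>' \<epsilon>' where L': "adjunction L' (D1 D ?v) \<eta>' \<epsilon>'"
    using coc v unfolding cocomplete_prederivator_def hom_direct_images_def by blast
  interpret L: adj L "D1 D w" \<eta> \<epsilon> "D0 D B" "D0 D C"
    using adj_right[OF L ws] .
  interpret L': adj L' "D1 D ?v" \<eta>' \<epsilon>' "D0 D A" "D0 D C"
    using adj_right[OF L' vs] .
  define M where "M = fob L ?G"
  define M' where "M' = fob L' ?G'"
  have M: "M \<in> Obj (D0 D C)" and M': "M' \<in> Obj (D0 D C)"
    unfolding M_def M'_def using fob_in[OF L.L G] fob_in[OF L'.L G'] .
  note \<eta>_hom = L.unit_hom[OF G, folded M_def] and \<eta>'_hom = L'.unit_hom[OF G', folded M'_def]
  note univ' = L'.universal_unit[OF G', folded M'_def]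
  define h where "h = ar u (cmp \<eta> ?G)"
  have h: "h \<in> hom (D0 D A) ?G' (ob ?v M)"
    unfolding h_def using far_hom[OF us \<eta>_hom] by (simp add: uG ob_compF[OF u w M])
  \<comment> \<open>\<open>f\<close> is the comparison v_! p^* Y \<rightarrow> w_! q^* Y; the claim
    follows from its invertibility, tested at the objects of \<open>C\<close>.\<close>
  obtain f where f: "f \<in> hom (D0 D C) M' M" "ar ?v f \<cdot>\<^bsub>D0 D A\<^esub> cmp \<eta>' ?G' = h"
    using universal_factor[OF univ' vs M h] .
  have "is_iso (D0 D terminal_cat) (ar (point C c) f)" if c: "c \<in> Obj C" for c
  proof -
    let ?E = "coslice c w" and ?E' = "coslice c ?v" and ?U = "coslice_map c u w ?v"
    let ?s = "coslice_forget c w" and ?s' = "coslice_forget c ?v"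
    let ?t = "to_terminal ?E" and ?t' = "to_terminal ?E'"
    let ?\<gamma> = "sq_cell (coslice_square c w)" and ?\<gamma>' = "sq_cell (coslice_square c ?v)"
    note U = coslice_map_functor[OF u w c]
    note Trg = small_functorD(7)[OF w] small_functorD(7)[OF v]
    interpret W: small_square "coslice_square c w" ?E terminal_cat B C
      using small_square_coslice[OF w c] .
    interpret W: prederivator_square D "coslice_square c w" ?E terminal_cat B C ..
    interpret V: small_square "coslice_square c ?v" ?E' terminal_cat A C
      using small_square_coslice[OF v c] .
    interpret V: prederivator_square D "coslice_square c ?v" ?E' terminal_cat A C ..
    note s = W.left[simplified] and s' = V.left[simplified]
    note t = W.top[simplified] and t' = V.top[simplified]
    note x = W.right[simplified, unfolded Trg]
    note \<gamma>_hom = W.\<alpha>_hom[unfolded coslice_square_simps Trg]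
    note \<gamma>'_hom = V.\<alpha>_hom[unfolded coslice_square_simps Trg]
    \<comment> \<open>On a coslice the restriction of a constant diagram is again constant; these
      are the coefficients to which the D-equivalence of coslices applies.\<close>
    have sG: "ob ?s ?G = ob ?t Y" and s'G': "ob ?s' ?G' = ob ?t' Y"
      using ob_compF[OF s q Y] ob_compF[OF s' p Y] by (simp_all add: to_terminal_compF[OF s] to_terminal_compF[OF s'])
    define \<kappa> where "\<kappa> = cell_at ?\<gamma> M \<cdot>\<^bsub>D0 D ?E\<^esub> ar ?s (cmp \<eta> ?G)"
    define \<kappa>' where "\<kappa>' = cell_at ?\<gamma>' M' \<cdot>\<^bsub>D0 D ?E'\<^esub> ar ?s' (cmp \<eta>' ?G')"
    have "universal (D1 D ?t) (ob ?t Y) (ob (point C c) M) \<kappa>"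
      using universal_coslice[OF coc w c L G] unfolding \<kappa>_def M_def sG .
    moreover have "D_equivalence D ?E' ?E ?U"
      using loc c unfolding D_equivalence_colocally_def by blast
    ultimately have 1: "universal (D1 D ?t') (ob ?t' Y) (ob (point C c) M) (ar ?U \<kappa>)"
      using universal_restrict[OF U(1) _ Y] by blast
    have 2: "universal (D1 D ?t') (ob ?t' Y) (ob (point C c) M') \<kappa>'"
      using universal_coslice[OF coc v c L' G'] unfolding \<kappa>'_def M'_def s'G' .
    have "ar ?U \<kappa> = ar ?U (cell_at ?\<gamma> M) \<cdot>\<^bsub>D0 D ?E'\<^esub> ar ?U (ar ?s (cmp \<eta> ?G))"
      unfolding \<kappa>_def using far_Comp[OF D1[OF U(1)] far_hom[OF D1[OF s] \<eta>_hom] \<gamma>_hom[OF M]] .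
    also have "ar ?U (ar ?s (cmp \<eta> ?G)) = ar ?s' h"
      using ar_compF[OF U(1) s \<eta>_hom] ar_compF[OF s' u \<eta>_hom] U(2) by (simp add: h_def)
    also have "ar ?U (cell_at ?\<gamma> M) = cell_at ?\<gamma>' M"
      using cell_at_whisker_right[OF small_functor_compF[OF t x] small_functor_compF[OF s w]
          W.cell[simplified, unfolded Trg] U(1) M] unfolding coslice_cell_restrict[OF u w c] by simp
    also have "cell_at ?\<gamma>' M \<cdot>\<^bsub>D0 D ?E'\<^esub> ar ?s' h =
        (cell_at ?\<gamma>' M \<cdot>\<^bsub>D0 D ?E'\<^esub> ar ?s' (ar ?v f)) \<cdot>\<^bsub>D0 D ?E'\<^esub> ar ?s' (cmp \<eta>' ?G')"
      unfolding f(2)[symmetric] far_Comp[OF D1[OF s'] \<eta>'_hom far_hom[OF vs f(1)]]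
      using Comp_assoc[OF V.cat_A' far_hom[OF D1[OF s'] \<eta>'_hom] far_hom[OF D1[OF s'] far_hom[OF vs f(1)]] \<gamma>'_hom[OF M]]
      by simp
    also have "\<dots> = (ar ?t' (ar (point C c) f) \<cdot>\<^bsub>D0 D ?E'\<^esub> cell_at ?\<gamma>' M') \<cdot>\<^bsub>D0 D ?E'\<^esub> ar ?s' (cmp \<eta>' ?G')"
      using V.\<alpha>_natural[OF f(1), unfolded coslice_square_simps Trg] by simp
    also have "\<dots> = ar ?t' (ar (point C c) f) \<cdot>\<^bsub>D0 D ?E'\<^esub> \<kappa>'"
      unfolding \<kappa>'_def
      using Comp_assoc[OF V.cat_A' far_hom[OF D1[OF s'] \<eta>'_hom] \<gamma>'_hom[OF M']
          far_hom[OF D1[OF t'] far_hom[OF D1[OF x] f(1)]]] .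
    finally have "ar ?t' (ar (point C c) f) \<cdot>\<^bsub>D0 D ?E'\<^esub> \<kappa>' = ar ?U \<kappa>" ..
    \<comment> \<open>Both arrows are universal with the same source, the constant diagram
      \<open>Y\<close> on \<open>?E'\<close>, and the value of \<open>f\<close> at \<open>c\<close>
      carries one to the other.\<close>
    then show ?thesis
      using universal_compare[OF 1 2 D1[OF t'] far_hom[OF D1[OF x] f(1)]] by blast
  qed
  then have "is_iso (D0 D C) f"
    using cons homD(1)[OF f(1)] small_functorD(2)[OF w] unfolding conservative_def by blast
  then show ?thesis
    using universal_postcomp_iso[OF univ' vs f(1)] unfolding f(2) h_def M_def by blast
qed

text \<open>Both Hom(q^* Y, w^* F) and Hom(p^* Y, u^* w^* F) are identified with Hom(w_! q^* Y, F),
  the latter because \<open>universal_restrict_colocal\<close> lets w_! q^* Y serve as v_! p^* Y.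
  The identifications are compatible with u^*, which is therefore bijective.\<close>

lemma cohom_criterion_colocal_if_cocomplete:
  assumes cons: "conservative D" and coc: "cocomplete_prederivator D" and di: "cohom_direct_images D"
  shows "cohom_criterion_colocal D"
  unfolding cohom_criterion_colocal_iff[OF di]
proof (intro allI impI ballI)
  fix A B C u w v F assume loc: "D_equivalence_colocally D A B C u w v" and F: "F \<in> Obj (D0 D C)"
  then have u: "small_functor A B u" and w: "small_functor B C w" and v_eq: "v = w \<odot> u"
    unfolding D_equivalence_colocally_def commutative_triangle_def by blast+
  note v = small_functor_compF[OF u w]
  note us = D1[OF u] and ws = D1[OF w]
  have q: "small_functor B terminal_cat (to_terminal B)"
    using small_functor_to_terminal[OF small_functorD(2)[OF u]] .
  obtain L \<eta> \<epsilon> where L: "adjunction L (D1 D w) \<eta> \<epsilon>"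
    using coc w unfolding cocomplete_prederivator_def hom_direct_images_def by blast
  interpret L: adj L "D1 D w" \<eta> \<epsilon> "D0 D B" "D0 D C"
    using adj_right[OF L ws] .
  show "cohom_iso_at D A B u (ob w F)"
    unfolding cohom_iso_at_def
  proof
    fix Y assume Y: "Y \<in> Obj (D0 D terminal_cat)"
    let ?G = "ob (to_terminal B) Y" and ?G' = "ob (to_terminal A) Y"
    let ?M = "fob L ?G"
    have G: "?G \<in> Obj (D0 D B)"
      using fob_in[OF D1[OF q] Y] .
    note \<eta>_hom = L.unit_hom[OF G]
    note univ = universal_restrict_colocal[OF cons coc loc[unfolded v_eq] L Y]
    have "bij_betw (\<lambda>g. ar (w \<odot> u) g \<cdot>\<^bsub>D0 D A\<^esub> ar u (cmp \<eta> ?G)) (hom (D0 D C) ?M F)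
        (hom (D0 D A) ?G' (ob u (ob w F)))"
      using universalD(3)[OF univ D1[OF v] F] by (simp add: ob_compF[OF u w F])
    moreover have "ar (w \<odot> u) g \<cdot>\<^bsub>D0 D A\<^esub> ar u (cmp \<eta> ?G) = (ar u \<circ> (\<lambda>g. ar w g \<cdot>\<^bsub>D0 D B\<^esub> cmp \<eta> ?G)) g"
      if g: "g \<in> hom (D0 D C) ?M F" for g
      using far_Comp[OF us \<eta>_hom far_hom[OF ws g]] by (simp add: ar_compF[OF u w g])
    ultimately have "bij_betw (ar u \<circ> (\<lambda>g. ar w g \<cdot>\<^bsub>D0 D B\<^esub> cmp \<eta> ?G)) (hom (D0 D C) ?M F)
        (hom (D0 D A) ?G' (ob u (ob w F)))"
      by (simp cong: bij_betw_cong)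
    then show "bij_betw (ar u) (hom (D0 D B) ?G (ob w F)) (hom (D0 D A) ?G' (ob u (ob w F)))"
      using bij_betw_comp_iff[OF universalD(3)[OF L.universal_unit[OF G] ws F]] by blast
  qed
qed

end

theorem mainTheorem6:
  fixes D :: "('v::universe, 'o, 'm) prederiv"
  assumes "prederivator D"
  shows "(conservative D \<and> complete_prederivator D \<and> cohom_criterion_colocal D \<longrightarrow>
            (\<forall>S. is_square S \<longrightarrow> (cohom_base_change D S \<longleftrightarrow> weakly_exact D S)))
       \<and> (derivator D \<longrightarrow>
            conservative D \<and> complete_prederivator D \<and> cohom_criterion_colocal D)"
proof -
  interpret prederivator_loc D
    using assms by unfold_locales
  show ?thesis
    using cohom_base_change_iff_weakly_exact cohom_criterion_colocal_if_cocomplete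
    unfolding derivator_def complete_prederivator_def by blast
qed

end
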